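(* For every $\mu\in\mathcal F_{X_0}$, the metric measure space $(G,d_G,\mu)$ has the Calderón–Zygmund property (CZP) with respect to the family $\mathcal D^{X_0}$.
   Context: **Group setting.** $N$ is a stratified Lie group of step $S\ge 1$: simply connected, with Lie algebra $\mathfrak n=\bigoplus_{j=1}^S\mathfrak n_j$, $[\mathfrak n_i,\mathfrak n_j]\subset\mathfrak n_{i+j}$ (with $\mathfrak n_l=0$ for $l>S$), $\mathfrak n_1$ generating $\mathfrak n$. $dn$ is the Haar measure on $N$ (push-forward of Lebesgue measure by $\exp_N$). $A=(\mathbb R_+,\cdot)$ acts on $N$ by the automorphic dilations $D_a(\exp_N(\sum_j Y_j))=\exp_N(\sum_j a^jY_j)$, $Y_j\in\mathfrak n_j$. $G=N\rtimes A$ has product $(n,a)(n',a')=(nD_a(n'),aa')$, identity $1_G=(1_N,1)$, and right Haar measure $d\rho(n,a)=a^{-1}\,dn\,da$. Fix a basis $\{\breve X_{1,i}:1\le i\le q_1\}$ of $\mathfrak n_1$. $d_N$ is the (left-invariant) Carnot–Carathéodory distance on $N$ for which $\breve X_{1,1},\dots,\breve X_{1,q_1}$ is an orthonormal horizontal frame. In the Lie algebra $\mathfrak g=\mathfrak n\oplus\mathfrak a$ of $G$, $X_0$ is the generator of $A$ with $\exp(tX_0)=(1_N,e^t)$, and $X_{1,i}$ is the left-invariant vector field on $G$ whose value at $1_G$ is $\breve X_{1,i}$. $d_G$ is the left-invariant Carnot–Carathéodory distance on $G$ for which $X_0,X_{1,1},\dots,X_{1,q_1}$ is an orthonormal horizontal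 frame. In everything below, $Z=X_0$. **Flow measures.** A Borel measure $\mu$ on $G$ is a $Z$-flow measure if $d\mu=\varphi\,d\rho$ with $\varphi:G\to[0,\infty)$ satisfying $\varphi(x)=\varphi(x\exp(tZ))$ for all $x\in G$, $t\in\mathbb R$. Put $\mu_N(F)=\int_F\varphi(n,1)\,dn$ for Borel $F\subset N$. $\mathcal F_Z$ is the set of $Z$-flow measures $\mu$ such that $(N,d_N,\mu_N)$ is doubling, i.e. balls have positive finite measure and for every $C>1$ there is $D(\mu_N,C)>1$ with $\mu_N(B(x,Cr))\le D(\mu_N,C)\mu_N(B(x,r))$ for all $x\in N$, $r>0$. **Christ cubes.** For $\mu\in\mathcal F_Z$, fix a Christ decomposition of $(N,d_N,\mu_N)$: families $\mathcal Q_k$ ($k\in\mathbb Z$) of countably many pairwise disjoint open sets of $N$ ("cubes of generation $k$"), $\mathcal Q=\bigcup_k\mathcal Q_k$, and constants $\delta\in(0,1)$, $C_1,c>0$ such that: (i) $\mu_N(N\setminus\bigcup_{Q\in\mathcal Q_k}Q)=0$ for all $k$; (ii) each $Q\in\mathcal Q_k$ is contained in a unique $p_N(Q)\in\mathcal Q_{k-1}$ and is disjoint from every other element of $\mathcal Q_{k-1}$; (iii) for each $Q\in\mathcal Q_k$ there is $n_Q\in Q$ with $B_N(n_Q,c\delta^k)\subset Q\subset B_N(n_Q,C_1\delta^k)$; (iv) $\mu_N(p_N(Q))\le C_1\mu_N(Q)$ and $s_N(Q):=\{Q'\in\mathcal Q:p_N(Q')=Q\}$ has at most $C_1$ elements.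 It is assumed that $C_1\ge3$ and $\#s_N(Q)\ge2$ for all $Q$. **Cylinders.** For $E\subset N$, $r>1$, $a\in A$: $P_{r,E}(a)=\{(n,1)\exp(tZ):n\in E,\ t\in U_r(a)\}$, $U_r(a)=(\log(a/r),\log(ar))$. Fix $\gamma\ge5$ and $\lambda>e^3/\delta$. $P_{r,Q}(a)$ with $Q\in\mathcal Q_k$ is *admissible* if either $r>e$ and $ar^2\le\delta^k\le\lambda ar^\gamma$ ( *large* ), or $1<r\le e$ and $ae^2\log r\le\delta^k\le\lambda ae^2\log r$ ( *small* ). **The family $\mathcal D^Z$.** For an admissible $P=P_{r,Q}(a)$, the set of sons is $s(P)=\{P_{\sqrt r,Q}(a/\sqrt r),P_{\sqrt r,Q}(a\sqrt r)\}$ if both of these are admissible, and $s(P)=\{P_{r,Q'}(a):Q'\in s_N(Q)\}$ otherwise; $s^1(P)=s(P)$, $s^{m+1}(P)=\bigcup_{P'\in s^m(P)}s(P')$. Put $p^\downarrow(P)=P_{r^3,Q}(a/r^2)$, $p^\uparrow(P)=P_{r^2,Q}(ar)$, $p^\leftrightarrow(P)=P_{r,p_N(Q)}(a)$, and $\mathcal S(P)=\{P_{r,Q'}(a):Q'\in\mathcal Q_j\}$ if $Q\in\mathcal Q_j$. Fix a large admissible $P_0=P_{r_0,Q_0}(1)$ and define recursively $P_{k+1}=p^\leftrightarrow(P_k)$ whenever this is admissible; at the successive values of $k$ for which it is not, $P_{k+1}$ is alternately $p^\uparrow(P_k)$ and $p^\downarrow(P_k)$, starting with $p^\uparrow$.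 For $k\ge0$ let $\mathcal S_k=\mathcal S(P_k)$; let $\widetilde{\mathcal S}_k=\emptyset$ if $P_{k+1}=p^\leftrightarrow(P_k)$ and $\widetilde{\mathcal S}_k=\mathcal S(P_{k+1}\setminus P_k)$ otherwise, where, if $P_k=P_{r,Q}(a)$, $P_{k+1}\setminus P_k$ stands (up to a null set) for the cylinder $P_{r,Q}(ar^2)$ when $P_{k+1}=p^\uparrow(P_k)$ and $P_{r^2,Q}(a/r^3)$ when $P_{k+1}=p^\downarrow(P_k)$. With $\widetilde{\mathcal S}_\ell^m=\bigcup_{P\in\widetilde{\mathcal S}_\ell}s^m(P)$, put $\mathcal D^Z_{-k}=\mathcal S_k\cup\widetilde{\mathcal S}_k\cup\bigcup_{\ell>k}\widetilde{\mathcal S}_\ell^{\ell-k}$ for $k\ge0$, $\mathcal D^Z_k=\bigcup_{P\in\mathcal D^Z_{k-1}}s(P)$ for $k\ge1$, and $\mathcal D^Z=\bigcup_{k\in\mathbb Z}\mathcal D^Z_k$. **CZP.** A metric measure space $(X,d,\mu)$ with $\mu(X)=\infty$ has the CZP if there is $C_0\ge1$ such that for every $f\in L^1(\mu)$ and $\alpha>0$ there exist a countable family of sets $\mathcal E(f,\alpha)=\{E_j\}$, numbers $r_j>0$, points $x_j\in X$ and a decomposition $f=g+\sum_jb_j$ such that for every $j$: (a) $|g|\le C_0\alpha$ $\mu$-a.e.; (b) $b_j=0$ on $X\setminus E_j$; (c) $\sum_j\|b_j\|_1\le C_0\|f\|_1$ and $\int_{E_j}b_j\,d\mu=0$; (d)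 $E_j\subset B(x_j,C_0r_j)$; (e) $\sum_j\mu(E_j^* )\le\frac{C_0}{\alpha}\|f\|_1$, where $E_j^*=\{x:d(x,E_j)<r_j\}$. In this case, with $\mathcal E=\{E\in\mathcal E(f,\alpha):f\in L^1(\mu),\alpha>0\}$, the space has the CZP *with respect to the family* $\mathcal E$. *)

theory Defs
  imports "HOL-Analysis.Analysis"
begin

section \<open>Lie groups in global coordinates\<close>

text \<open>\<open>Ck k f\<close>: \<open>f\<close> is of class \<open>C\<^sup>k\<close> on the whole (finite-dimensional) space, expressed by iterated
  Frechet derivatives evaluated in fixed directions.\<close>

primrec Ck :: "nat \<Rightarrow> ('a::euclidean_space \<Rightarrow> 'b::euclidean_space) \<Rightarrow> bool" where
  "Ck 0 f = continuous_on UNIV f"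
| "Ck (Suc k) f = ((\<forall>x. f differentiable (at x)) \<and> (\<forall>v. Ck k (\<lambda>x. frechet_derivative f (at x) v)))"

definition smooth :: "('a::euclidean_space \<Rightarrow> 'b::euclidean_space) \<Rightarrow> bool" where
  "smooth f \<longleftrightarrow> (\<forall>k. Ck k f)"

text \<open>The left-invariant vector field, for a group law \<open>m\<close> with identity \<open>e\<close>, whose value at \<open>e\<close> is
  the vector \<open>v\<close>: the differential at \<open>e\<close> of the left translation by \<open>x\<close>, applied to \<open>v\<close>.\<close>

definition left_inv_field ::
    "('a::euclidean_space \<Rightarrow> 'a \<Rightarrow> 'a) \<Rightarrow> 'a \<Rightarrow> 'a \<Rightarrow> 'a \<Rightarrow> 'a" where
  "left_inv_field m e v x = frechet_derivative (m x) (at e) v"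

text \<open>A simply connected nilpotent Lie group \<open>N\<close> is diffeomorphic to its Lie algebra through \<open>exp\<^sub>N\<close>.
  We identify \<open>N\<close> with its Lie algebra, a Euclidean space \<open>'n\<close>, in this way: \<open>exp\<^sub>N\<close> becomes the
  identity map, the identity element is \<open>0\<close>, and \<open>t \<mapsto> t *\<^sub>R x\<close> is the one-parameter subgroup with
  initial velocity \<open>x\<close>. The Haar measure \<open>dn\<close> becomes \<open>lborel\<close>; the inner product of \<open>'n\<close>
  plays no role besides normalizing it.\<close>

definition lie_group_exp :: "('n::euclidean_space \<Rightarrow> 'n \<Rightarrow> 'n) \<Rightarrow> bool" where
  "lie_group_exp m \<longleftrightarrow>
     Groups.group m 0 uminus \<and>
     smooth (\<lambda>p. m (fst p) (snd p)) \<and>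
     (\<forall>s t x. m (s *\<^sub>R x) (t *\<^sub>R x) = (s + t) *\<^sub>R x)"

text \<open>The commutator, at the identity, of the left-invariant vector fields determined by \<open>u\<close> and \<open>v\<close>.
  (In coordinates, the commutator of two vector fields \<open>U\<close>, \<open>V\<close> is \<open>DV U - DU V\<close>.)\<close>

definition lie_bracket :: "('n::euclidean_space \<Rightarrow> 'n \<Rightarrow> 'n) \<Rightarrow> 'n \<Rightarrow> 'n \<Rightarrow> 'n" where
  "lie_bracket m u v =
     frechet_derivative (left_inv_field m 0 v) (at 0) u -
     frechet_derivative (left_inv_field m 0 u) (at 0) v"

text \<open>The layers are \<open>V 1, \<dots>, V S\<close>; all other values of \<open>V\<close> are set to \<open>{0}\<close> by convention.\<close>

definition stratified_group ::
    "('n::euclidean_space \<Rightarrow> 'n \<Rightarrow> 'n) \<Rightarrow> (nat \<Rightarrow> 'n set) \<Rightarrow> nat \<Rightarrow> bool" where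
  "stratified_group m V S \<longleftrightarrow>
     1 \<le> S \<and> lie_group_exp m \<and>
     (\<forall>j. subspace (V j)) \<and> V 0 = {0} \<and> (\<forall>j>S. V j = {0}) \<and>
     (\<forall>x. \<exists>!y. (\<forall>j. y j \<in> V j) \<and> x = (\<Sum>j=1..S. y j)) \<and>
     (\<forall>i\<ge>1. \<forall>j\<ge>1. \<forall>u\<in>V i. \<forall>v\<in>V j. lie_bracket m u v \<in> V (i + j)) \<and>
     (\<lambda>L. subspace L \<and> (\<forall>u\<in>L. \<forall>v\<in>L. lie_bracket m u v \<in> L)) hull V 1 = UNIV"

definition layer_part :: "(nat \<Rightarrow> 'n::euclidean_space set) \<Rightarrow> nat \<Rightarrow> 'n \<Rightarrow> nat \<Rightarrow> 'n" where
  "layer_part V S x = (THE y. (\<forall>j. y j \<in> V j) \<and> x = (\<Sum>j=1..S. y j))"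

definition dil :: "(nat \<Rightarrow> 'n::euclidean_space set) \<Rightarrow> nat \<Rightarrow> real \<Rightarrow> 'n \<Rightarrow> 'n" where
  "dil V S a x = (\<Sum>j=1..S. a ^ j *\<^sub>R layer_part V S x j)"


section \<open>The semidirect product\<close>

text \<open>\<open>G = N \<rtimes> A\<close> is the open subset \<open>G_set\<close> of \<open>'n \<times> real\<close>, with identity \<open>(0, 1)\<close>.\<close>

definition G_set :: "('n::euclidean_space \<times> real) set" where
  "G_set = UNIV \<times> {0<..}"

definition gmul :: "('n::euclidean_space \<Rightarrow> 'n \<Rightarrow> 'n) \<Rightarrow> (nat \<Rightarrow> 'n set) \<Rightarrow> nat \<Rightarrow>
    'n \<times> real \<Rightarrow> 'n \<times> real \<Rightarrow> 'n \<times> real" where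
  "gmul m V S x y = (m (fst x) (dil V S (snd x) (fst y)), snd x * snd y)"

definition rho :: "('n::euclidean_space \<times> real) measure" where
  "rho = density (restrict_space lborel G_set) (\<lambda>x. ennreal (1 / snd x))"

definition exp_X0 :: "real \<Rightarrow> 'n::euclidean_space \<times> real" where
  "exp_X0 t = (0, exp t)"


section \<open>Carnot--Caratheodory distances\<close>

text \<open>\<open>F\<close> is a finite set of tangent vectors at the identity \<open>e\<close>; the corresponding left-invariant
  vector fields form the orthonormal horizontal frame. The function \<open>u\<close> gives the coordinates of the
  velocity of the curve \<open>c\<close> in this frame.\<close>

definition horizontal_curve :: "('a::euclidean_space \<Rightarrow> 'a \<Rightarrow> 'a) \<Rightarrow> 'a \<Rightarrow> 'a set \<Rightarrow> 'a set \<Rightarrow>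
    (real \<Rightarrow> 'a) \<Rightarrow> ('a \<Rightarrow> real \<Rightarrow> real) \<Rightarrow> bool" where
  "horizontal_curve m e X F c u \<longleftrightarrow>
     c piecewise_C1_differentiable_on {0..1} \<and> c ` {0..1} \<subseteq> X \<and>
     (\<exists>T. finite T \<and> (\<forall>t\<in>{0..1} - T.
        (c has_vector_derivative (\<Sum>v\<in>F. u v t *\<^sub>R left_inv_field m e v (c t))) (at t)))"

text \<open>The length is a nonnegative (Lebesgue) integral because the library's piecewise \<open>C\<^sup>1\<close> curves may
  have infinite length: their velocity can be unbounded near the finitely many exceptional points.\<close>

definition horizontal_length :: "'a set \<Rightarrow> ('a \<Rightarrow> real \<Rightarrow> real) \<Rightarrow> ennreal" where
  "horizontal_length F u = (\<integral>\<^sup>+t\<in>{0..1}. ennreal (sqrt (\<Sum>v\<in>F. (u v t)\<^sup>2)) \<partial>lborel)"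

text \<open>Distances take values in \<open>[0, \<infinity>]\<close>, the infimum of the empty set being \<open>\<infinity>\<close>. That the distances
  below are finite is Chow's theorem.\<close>

definition cc_dist ::
    "('a::euclidean_space \<Rightarrow> 'a \<Rightarrow> 'a) \<Rightarrow> 'a \<Rightarrow> 'a set \<Rightarrow> 'a set \<Rightarrow> 'a \<Rightarrow> 'a \<Rightarrow> ennreal" where
  "cc_dist m e X F x y =
     Inf {horizontal_length F u | c u. horizontal_curve m e X F c u \<and> c 0 = x \<and> c 1 = y}"

definition dN :: "('n::euclidean_space \<Rightarrow> 'n \<Rightarrow> 'n) \<Rightarrow> 'n set \<Rightarrow> 'n \<Rightarrow> 'n \<Rightarrow> ennreal" where
  "dN m B = cc_dist m 0 UNIV B"

text \<open>\<open>X\<^sub>0\<close> has value \<open>(0, 1)\<close> at the identity, since \<open>exp_X0 t = (0, e\<^sup>t)\<close>.\<close>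

definition dG :: "('n::euclidean_space \<Rightarrow> 'n \<Rightarrow> 'n) \<Rightarrow> (nat \<Rightarrow> 'n set) \<Rightarrow> nat \<Rightarrow> 'n set \<Rightarrow>
    'n \<times> real \<Rightarrow> 'n \<times> real \<Rightarrow> ennreal" where
  "dG m V S B = cc_dist (gmul m V S) (0, 1) G_set (insert (0, 1) ((\<lambda>v. (v, 0)) ` B))"

definition dball :: "('a \<Rightarrow> 'a \<Rightarrow> ennreal) \<Rightarrow> 'a set \<Rightarrow> 'a \<Rightarrow> real \<Rightarrow> 'a set" where
  "dball d X x r = {y \<in> X. d x y < ennreal r}"


section \<open>Flow measures\<close>

definition doubling :: "('a \<Rightarrow> 'a \<Rightarrow> ennreal) \<Rightarrow> 'a measure \<Rightarrow> bool" where
  "doubling d \<nu> \<longleftrightarrow>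
     (\<forall>x\<in>space \<nu>. \<forall>r>0. dball d (space \<nu>) x r \<in> sets \<nu> \<and>
        0 < emeasure \<nu> (dball d (space \<nu>) x r) \<and> emeasure \<nu> (dball d (space \<nu>) x r) < \<infinity>) \<and>
     (\<forall>C>1. \<exists>D>1. \<forall>x\<in>space \<nu>. \<forall>r>0.
        emeasure \<nu> (dball d (space \<nu>) x (C * r)) \<le> ennreal D * emeasure \<nu> (dball d (space \<nu>) x r))"

definition flow_density :: "('n::euclidean_space \<Rightarrow> 'n \<Rightarrow> 'n) \<Rightarrow> (nat \<Rightarrow> 'n set) \<Rightarrow> nat \<Rightarrow>
    ('n \<times> real) measure \<Rightarrow> ('n \<times> real \<Rightarrow> real) \<Rightarrow> bool" where
  "flow_density m V S \<mu> \<phi> \<longleftrightarrow>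
     \<phi> \<in> borel_measurable rho \<and> (\<forall>x\<in>G_set. 0 \<le> \<phi> x) \<and>
     (\<forall>x\<in>G_set. \<forall>t. \<phi> x = \<phi> (gmul m V S x (exp_X0 t))) \<and>
     \<mu> = density rho (\<lambda>x. ennreal (\<phi> x))"

definition flow_measure :: "('n::euclidean_space \<Rightarrow> 'n \<Rightarrow> 'n) \<Rightarrow> (nat \<Rightarrow> 'n set) \<Rightarrow> nat \<Rightarrow>
    ('n \<times> real) measure \<Rightarrow> bool" where
  "flow_measure m V S \<mu> \<longleftrightarrow> (\<exists>\<phi>. flow_density m V S \<mu> \<phi>)"

text \<open>Two flow densities of \<open>\<mu>\<close> agree almost everywhere and are invariant under the flow, hence
  \<open>mu_N\<close> does not depend on the chosen one.\<close>

definition mu_N :: "('n::euclidean_space \<Rightarrow> 'n \<Rightarrow> 'n) \<Rightarrow> (nat \<Rightarrow> 'n set) \<Rightarrow> nat \<Rightarrow>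
    ('n \<times> real) measure \<Rightarrow> 'n measure" where
  "mu_N m V S \<mu> = density lborel (\<lambda>n. ennreal ((SOME \<phi>. flow_density m V S \<mu> \<phi>) (n, 1)))"

definition flow_class :: "('n::euclidean_space \<Rightarrow> 'n \<Rightarrow> 'n) \<Rightarrow> (nat \<Rightarrow> 'n set) \<Rightarrow> nat \<Rightarrow> 'n set \<Rightarrow>
    ('n \<times> real) measure set" where
  "flow_class m V S B = {\<mu>. flow_measure m V S \<mu> \<and> doubling (dN m B) (mu_N m V S \<mu>)}"


section \<open>Christ cubes\<close>

text \<open>\<open>\<Q> k\<close> is the set of cubes of generation \<open>k\<close>. The generation is carried along explicitly in
  \<open>cube_parent\<close> and \<open>cube_sons\<close>, although under \<open>christ_cubes\<close> it is determined by the cube.\<close>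

definition cube_parent :: "(int \<Rightarrow> 'n set set) \<Rightarrow> int \<Rightarrow> 'n set \<Rightarrow> 'n set" where
  "cube_parent \<Q> k Q = (THE P. P \<in> \<Q> (k - 1) \<and> Q \<subseteq> P)"

definition cube_sons :: "(int \<Rightarrow> 'n set set) \<Rightarrow> int \<Rightarrow> 'n set \<Rightarrow> 'n set set" where
  "cube_sons \<Q> k Q = {Q' \<in> \<Q> (k + 1). cube_parent \<Q> (k + 1) Q' = Q}"

definition christ_cubes :: "('n::topological_space \<Rightarrow> 'n \<Rightarrow> ennreal) \<Rightarrow> 'n measure \<Rightarrow>
    (int \<Rightarrow> 'n set set) \<Rightarrow> real \<Rightarrow> real \<Rightarrow> real \<Rightarrow> bool" where
  "christ_cubes d \<nu> \<Q> \<delta> C1 c \<longleftrightarrow>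
     0 < \<delta> \<and> \<delta> < 1 \<and> 3 \<le> C1 \<and> 0 < c \<and>
     (\<forall>k. countable (\<Q> k) \<and> disjoint (\<Q> k) \<and> (\<forall>Q\<in>\<Q> k. open Q)) \<and>
     (\<forall>k. emeasure \<nu> (UNIV - \<Union>(\<Q> k)) = 0) \<and>
     (\<forall>k. \<forall>Q\<in>\<Q> k. (\<exists>!P. P \<in> \<Q> (k - 1) \<and> Q \<subseteq> P) \<and>
        (\<forall>P\<in>\<Q> (k - 1). P \<noteq> cube_parent \<Q> k Q \<longrightarrow> Q \<inter> P = {})) \<and>
     (\<forall>k. \<forall>Q\<in>\<Q> k. \<exists>n\<in>Q. dball d UNIV n (c * \<delta> powi k) \<subseteq> Q \<and>
        Q \<subseteq> dball d UNIV n (C1 * \<delta> powi k)) \<and>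
     (\<forall>k. \<forall>Q\<in>\<Q> k. emeasure \<nu> (cube_parent \<Q> k Q) \<le> ennreal C1 * emeasure \<nu> Q \<and>
        finite (cube_sons \<Q> k Q) \<and> real (card (cube_sons \<Q> k Q)) \<le> C1 \<and>
        2 \<le> card (cube_sons \<Q> k Q))"


section \<open>Cylinders\<close>

text \<open>\<open>Cyl r k Q a\<close> stands for \<open>P\<^bsub>r,Q\<^esub>(a)\<close> with \<open>Q\<close> a cube of generation \<open>k\<close>; the set itself is
  \<open>cyl_set\<close> of it.\<close>

datatype 'n cyl = Cyl real int "'n set" real

fun cyl_set :: "('n::euclidean_space \<Rightarrow> 'n \<Rightarrow> 'n) \<Rightarrow> (nat \<Rightarrow> 'n set) \<Rightarrow> nat \<Rightarrow>
    'n cyl \<Rightarrow> ('n \<times> real) set" where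
  "cyl_set m V S (Cyl r k Q a) =
     {gmul m V S (n, 1) (exp_X0 t) | n t. n \<in> Q \<and> ln (a / r) < t \<and> t < ln (a * r)}"

fun large_admissible ::
    "(int \<Rightarrow> 'n set set) \<Rightarrow> real \<Rightarrow> real \<Rightarrow> real \<Rightarrow> 'n cyl \<Rightarrow> bool" where
  "large_admissible \<Q> \<delta> gam lam (Cyl r k Q a) \<longleftrightarrow>
     Q \<in> \<Q> k \<and> 0 < a \<and> exp 1 < r \<and>
     a * r\<^sup>2 \<le> \<delta> powi k \<and> \<delta> powi k \<le> lam * a * r powr gam"

fun small_admissible :: "(int \<Rightarrow> 'n set set) \<Rightarrow> real \<Rightarrow> real \<Rightarrow> 'n cyl \<Rightarrow> bool" where
  "small_admissible \<Q> \<delta> lam (Cyl r k Q a) \<longleftrightarrow>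
     Q \<in> \<Q> k \<and> 0 < a \<and> 1 < r \<and> r \<le> exp 1 \<and>
     a * exp 2 * ln r \<le> \<delta> powi k \<and> \<delta> powi k \<le> lam * a * exp 2 * ln r"

definition admissible ::
    "(int \<Rightarrow> 'n set set) \<Rightarrow> real \<Rightarrow> real \<Rightarrow> real \<Rightarrow> 'n cyl \<Rightarrow> bool" where
  "admissible \<Q> \<delta> gam lam P \<longleftrightarrow> large_admissible \<Q> \<delta> gam lam P \<or> small_admissible \<Q> \<delta> lam P"

fun cyl_sons :: "(int \<Rightarrow> 'n set set) \<Rightarrow> real \<Rightarrow> real \<Rightarrow> real \<Rightarrow> 'n cyl \<Rightarrow> 'n cyl set" where
  "cyl_sons \<Q> \<delta> gam lam (Cyl r k Q a) =
     (if admissible \<Q> \<delta> gam lam (Cyl (sqrt r) k Q (a / sqrt r)) \<and>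
         admissible \<Q> \<delta> gam lam (Cyl (sqrt r) k Q (a * sqrt r))
      then {Cyl (sqrt r) k Q (a / sqrt r), Cyl (sqrt r) k Q (a * sqrt r)}
      else {Cyl r (k + 1) Q' a | Q'. Q' \<in> cube_sons \<Q> k Q})"

primrec cyl_desc ::
    "(int \<Rightarrow> 'n set set) \<Rightarrow> real \<Rightarrow> real \<Rightarrow> real \<Rightarrow> nat \<Rightarrow> 'n cyl \<Rightarrow> 'n cyl set" where
  "cyl_desc \<Q> \<delta> gam lam 0 P = {P}"
| "cyl_desc \<Q> \<delta> gam lam (Suc i) P =
     (\<Union>P'\<in>cyl_desc \<Q> \<delta> gam lam i P. cyl_sons \<Q> \<delta> gam lam P')"

fun p_down :: "'n cyl \<Rightarrow> 'n cyl" where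
  "p_down (Cyl r k Q a) = Cyl (r ^ 3) k Q (a / r\<^sup>2)"

fun p_up :: "'n cyl \<Rightarrow> 'n cyl" where
  "p_up (Cyl r k Q a) = Cyl (r\<^sup>2) k Q (a * r)"

fun p_side :: "(int \<Rightarrow> 'n set set) \<Rightarrow> 'n cyl \<Rightarrow> 'n cyl" where
  "p_side \<Q> (Cyl r k Q a) = Cyl r (k - 1) (cube_parent \<Q> k Q) a"

fun cyl_slab :: "(int \<Rightarrow> 'n set set) \<Rightarrow> 'n cyl \<Rightarrow> 'n cyl set" where
  "cyl_slab \<Q> (Cyl r k Q a) = {Cyl r k Q' a | Q'. Q' \<in> \<Q> k}"

text \<open>The cylinders \<open>p_up P \<setminus> P\<close> and \<open>p_down P \<setminus> P\<close> (up to null sets).\<close>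

fun up_rest :: "'n cyl \<Rightarrow> 'n cyl" where
  "up_rest (Cyl r k Q a) = Cyl r k Q (a * r\<^sup>2)"

fun down_rest :: "'n cyl \<Rightarrow> 'n cyl" where
  "down_rest (Cyl r k Q a) = Cyl (r\<^sup>2) k Q (a / r ^ 3)"


section \<open>The family of partitions\<close>

text \<open>The Boolean component records whether the next vertical step is an upward one.\<close>

primrec cyl_chain :: "(int \<Rightarrow> 'n set set) \<Rightarrow> real \<Rightarrow> real \<Rightarrow> real \<Rightarrow> 'n cyl \<Rightarrow> nat \<Rightarrow>
    'n cyl \<times> bool" where
  "cyl_chain \<Q> \<delta> gam lam P0 0 = (P0, True)"
| "cyl_chain \<Q> \<delta> gam lam P0 (Suc k) =
     (case cyl_chain \<Q> \<delta> gam lam P0 k of (P, up) \<Rightarrow>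
        if admissible \<Q> \<delta> gam lam (p_side \<Q> P) then (p_side \<Q> P, up)
        else if up then (p_up P, False) else (p_down P, True))"

definition slab :: "(int \<Rightarrow> 'n set set) \<Rightarrow> real \<Rightarrow> real \<Rightarrow> real \<Rightarrow> 'n cyl \<Rightarrow> nat \<Rightarrow> 'n cyl set" where
  "slab \<Q> \<delta> gam lam P0 k = cyl_slab \<Q> (fst (cyl_chain \<Q> \<delta> gam lam P0 k))"

definition rest_slab ::
    "(int \<Rightarrow> 'n set set) \<Rightarrow> real \<Rightarrow> real \<Rightarrow> real \<Rightarrow> 'n cyl \<Rightarrow> nat \<Rightarrow> 'n cyl set" where
  "rest_slab \<Q> \<delta> gam lam P0 k =
     (case cyl_chain \<Q> \<delta> gam lam P0 k of (P, up) \<Rightarrow>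
        if admissible \<Q> \<delta> gam lam (p_side \<Q> P) then {}
        else if up then cyl_slab \<Q> (up_rest P) else cyl_slab \<Q> (down_rest P))"

text \<open>\<open>DZ_neg k\<close> is generation \<open>-k\<close> and \<open>DZ_pos k\<close> is generation \<open>k\<close>.\<close>

definition DZ_neg :: "(int \<Rightarrow> 'n set set) \<Rightarrow> real \<Rightarrow> real \<Rightarrow> real \<Rightarrow> 'n cyl \<Rightarrow> nat \<Rightarrow> 'n cyl set" where
  "DZ_neg \<Q> \<delta> gam lam P0 k =
     slab \<Q> \<delta> gam lam P0 k \<union> rest_slab \<Q> \<delta> gam lam P0 k \<union>
     (\<Union>l\<in>{k<..}. \<Union>P\<in>rest_slab \<Q> \<delta> gam lam P0 l. cyl_desc \<Q> \<delta> gam lam (l - k) P)"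

primrec DZ_pos :: "(int \<Rightarrow> 'n set set) \<Rightarrow> real \<Rightarrow> real \<Rightarrow> real \<Rightarrow> 'n cyl \<Rightarrow> nat \<Rightarrow> 'n cyl set" where
  "DZ_pos \<Q> \<delta> gam lam P0 0 = DZ_neg \<Q> \<delta> gam lam P0 0"
| "DZ_pos \<Q> \<delta> gam lam P0 (Suc k) =
     (\<Union>P\<in>DZ_pos \<Q> \<delta> gam lam P0 k. cyl_sons \<Q> \<delta> gam lam P)"

definition DZ :: "(int \<Rightarrow> 'n set set) \<Rightarrow> real \<Rightarrow> real \<Rightarrow> real \<Rightarrow> 'n cyl \<Rightarrow> 'n cyl set" where
  "DZ \<Q> \<delta> gam lam P0 =
     (\<Union>k. DZ_neg \<Q> \<delta> gam lam P0 k) \<union> (\<Union>k. DZ_pos \<Q> \<delta> gam lam P0 k)"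


section \<open>The Calderon--Zygmund property\<close>

definition star_set :: "('a \<Rightarrow> 'a \<Rightarrow> ennreal) \<Rightarrow> 'a set \<Rightarrow> 'a set \<Rightarrow> real \<Rightarrow> 'a set" where
  "star_set d X E r = {x \<in> X. (INF y\<in>E. d x y) < ennreal r}"

text \<open>The families are indexed by an arbitrary, possibly finite, set \<open>J\<close> of natural numbers. The sets
  \<open>E j\<close> and \<open>star_set\<close> of them are required to be measurable, as \<open>emeasure\<close> vanishes on non-measurable
  sets. The series of the \<open>b j\<close> converges almost everywhere.\<close>

definition cz_decomposition :: "('a \<Rightarrow> 'a \<Rightarrow> ennreal) \<Rightarrow> 'a measure \<Rightarrow> real \<Rightarrow> ('a \<Rightarrow> complex) \<Rightarrow> real \<Rightarrow>
    nat set \<Rightarrow> (nat \<Rightarrow> 'a set) \<Rightarrow> (nat \<Rightarrow> real) \<Rightarrow> (nat \<Rightarrow> 'a) \<Rightarrow>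
    ('a \<Rightarrow> complex) \<Rightarrow> (nat \<Rightarrow> 'a \<Rightarrow> complex) \<Rightarrow> bool" where
  "cz_decomposition d \<mu> C0 f \<alpha> J E r x g b \<longleftrightarrow>
     g \<in> borel_measurable \<mu> \<and>
     (AE y in \<mu>. ((\<lambda>j. b j y) summable_on J) \<and> f y = g y + (\<Sum>\<^sub>\<infinity>j\<in>J. b j y)) \<and>
     (AE y in \<mu>. norm (g y) \<le> C0 * \<alpha>) \<and>
     (\<forall>j\<in>J. E j \<in> sets \<mu> \<and> 0 < r j \<and> x j \<in> space \<mu> \<and>
        (\<forall>y\<in>space \<mu> - E j. b j y = 0) \<and>
        integrable \<mu> (b j) \<and> (LINT y:E j|\<mu>. b j y) = 0 \<and>
        E j \<subseteq> dball d (space \<mu>) (x j) (C0 * r j) \<and>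
        star_set d (space \<mu>) (E j) (r j) \<in> sets \<mu>) \<and>
     (\<Sum>\<^sub>\<infinity>j\<in>J. ennreal (LINT y|\<mu>. norm (b j y))) \<le> ennreal (C0 * (LINT y|\<mu>. norm (f y))) \<and>
     (\<Sum>\<^sub>\<infinity>j\<in>J. emeasure \<mu> (star_set d (space \<mu>) (E j) (r j)))
        \<le> ennreal (C0 / \<alpha> * (LINT y|\<mu>. norm (f y)))"

text \<open>\<open>EE f \<alpha>\<close> is the family of sets used in the decomposition of \<open>f\<close> at height \<open>\<alpha>\<close>; \<open>\<E>\<close> is the
  collection of all sets that occur.\<close>

definition CZP_wrt :: "('a \<Rightarrow> 'a \<Rightarrow> ennreal) \<Rightarrow> 'a measure \<Rightarrow> 'a set set \<Rightarrow> bool" where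
  "CZP_wrt d \<mu> \<E> \<longleftrightarrow>
     emeasure \<mu> (space \<mu>) = \<infinity> \<and>
     (\<exists>C0\<ge>1. \<exists>EE :: ('a \<Rightarrow> complex) \<Rightarrow> real \<Rightarrow> 'a set set.
        (\<forall>f \<alpha>. integrable \<mu> f \<longrightarrow> 0 < \<alpha> \<longrightarrow>
           (\<exists>J E r x g b. EE f \<alpha> = E ` J \<and> cz_decomposition d \<mu> C0 f \<alpha> J E r x g b)) \<and>
        \<E> = \<Union> {EE f \<alpha> | f \<alpha>. integrable \<mu> f \<and> 0 < \<alpha>})"

end

theory Submission
  imports Defs
begin

text \<open>
  The cylinders of generation \<open>k\<close> form nested partitions of \<open>G\<close> up to null sets. A cylinder and the
  one containing it in the previous generation have comparable measures, and going back in the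
  generations the measure tends to infinity, because vertical enlargements occur infinitely often.
  Hence every cylinder on which the average of \<open>|f|\<close> exceeds \<open>\<alpha>\<close> lies in a maximal one, and
  subtracting the averages on the maximal cylinders gives the decomposition. That \<open>|f| \<le> \<alpha>\<close> off the
  maximal cylinders does not need a maximal inequality: by outer regularity an exceptional set is
  covered, up to little measure, by disjoint cylinders with small averages. The maximal cylinders for
  all \<open>f\<close> and \<open>\<alpha>\<close> need not exhaust the family, so for \<open>f\<close> the indicator function of a cylinder \<open>P\<close>
  and \<open>\<alpha> = 1\<close> the set \<open>P\<close> is added with a vanishing \<open>b\<close>.

  The radius belonging to \<open>P\<^bsub>r,Q\<^esub>(a)\<close> is \<open>(log r)/2\<close>. The inclusion of a large cylinder in a ball comes
  from paths which go up to height \<open>a r\<^sup>\<gamma>\<close>, move horizontally and come down again. Conversely a path of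
  length \<open>s\<close> from height \<open>h\<close> stays below height \<open>h e\<^sup>s\<close>, so its projection to \<open>N\<close> has length at
  most \<open>h e\<^sup>s s\<close>. Chow's theorem is not needed to see that balls are open: an open Christ cube lies in a
  ball of comparable radius around one of its points, so by left invariance all balls of \<open>N\<close> are
  neighbourhoods of their centres.
\<close>

section \<open>Integrals of arbitrary functions and Carnot--Caratheodory distances\<close>

text \<open>Two inequalities shape the constants. Let \<open>D\<close> be the scale
  \<open>\<delta> powi k\<close> of a cube. Subdividing the cube can fail only at the lower bound of
  admissibility; then \<open>exp 3 < lam * \<delta>\<close> puts \<open>D\<close> so far below the
  upper bound that both vertical halves are admissible. For a large cylinder, passing to the parent
  cube can fail only at the upper bound; then \<open>5 \<le> gam\<close> forces
  \<open>a * r ^ 5 \<le> D\<close>, the lower bound for the cylinder enlarged upwards. So there is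
  always a move left.

  Towards finer generations both \<open>ln r\<close> and \<open>D\<close> must shrink, while each
  move shrinks only one of them. A fixed height ties them together: admissibility bounds
  \<open>ln r\<close> by a multiple of \<open>D\<close>, and \<open>D\<close> by a multiple of
  \<open>ln r\<close> for small cylinders. Towards coarser generations, the alternation of upward
  and downward steps exhausts all positive heights.

  In the coordinates \<open>(n, h)\<close> the measure is the product of \<open>mu_N\<close> and
  \<open>dh / h\<close>, so a cylinder has the \<open>mu_N\<close>-measure of its cube times
  \<open>2 * ln r\<close>. By \<open>3 \<le> C1\<close>, one constant bounds both ratios that occur:
  that of a parent cube to its son, and that of logarithmic heights, which at most triple.\<close>

text \<open>The coordinates \<open>u\<close> of a horizontal curve need not be measurable, and then \<open>horizontal_length\<close> is an
  inner integral. The inequalities needed to join, reverse and rescale curves hold for all functions.\<close>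

lemma nn_integral_leI_simple:
  assumes "\<And>g. g \<in> borel_measurable M \<Longrightarrow> g \<le> f \<Longrightarrow> integral\<^sup>N M g \<le> X"
  shows "integral\<^sup>N M f \<le> X"
  unfolding nn_integral_def
proof (rule SUP_least, clarsimp)
  fix g assume g: "simple_function M g" "g \<le> f"
  then have "integral\<^sup>S M g = integral\<^sup>N M g" by (simp add: nn_integral_eq_simple_integral)
  also have "\<dots> \<le> X" using g by (intro assms borel_measurable_simple_function)
  finally show "integral\<^sup>S M g \<le> X" .
qed

text \<open>A measurable minorant \<open>g\<close> of the left integrand is carried to the
  measurable minorant \<open>g ((x - t) / a) / ennreal \<bar>a\<bar>\<close> of \<open>f\<close>,
  and the change of variables theorem is applied to the latter.\<close>

lemma nn_integral_real_affine_le: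
  fixes f :: "real \<Rightarrow> ennreal"
  assumes "a \<noteq> 0"
  shows "(\<integral>\<^sup>+x. ennreal \<bar>a\<bar> * f (t + a * x) \<partial>lborel) \<le> (\<integral>\<^sup>+x. f x \<partial>lborel)"
proof (rule nn_integral_leI_simple)
  fix g :: "real \<Rightarrow> ennreal" assume g: "g \<in> borel_measurable lborel" and le: "g \<le> (\<lambda>x. ennreal \<bar>a\<bar> * f (t + a * x))"
  have [measurable]: "g \<in> borel_measurable borel" using g by simp
  have "g ((x - t) / a) / ennreal \<bar>a\<bar> \<le> f x" for x
  proof -
    have "t + a * ((x - t) / a) = x" using assms by simp
    then have "g ((x - t) / a) \<le> ennreal \<bar>a\<bar> * f x" using le by (metis le_funE)
    then have "g ((x - t) / a) / ennreal \<bar>a\<bar> \<le> (f x * ennreal \<bar>a\<bar>) / ennreal \<bar>a\<bar>"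
      by (intro divide_right_mono_ennreal) (simp add: mult.commute)
    also have "\<dots> = f x" using assms by (intro ennreal_mult_divide_eq) auto
    finally show ?thesis .
  qed
  then have "(\<integral>\<^sup>+x. g ((x - t) / a) / ennreal \<bar>a\<bar> \<partial>lborel) \<le> (\<integral>\<^sup>+x. f x \<partial>lborel)"
    by (intro nn_integral_mono) auto
  moreover have "(\<integral>\<^sup>+x. g ((x - t) / a) / ennreal \<bar>a\<bar> \<partial>lborel)
     = ennreal \<bar>a\<bar> * (\<integral>\<^sup>+x. g ((t + a * x - t) / a) / ennreal \<bar>a\<bar> \<partial>lborel)"
    using assms by (intro nn_integral_real_affine) auto
  moreover have "\<dots> = (\<integral>\<^sup>+x. g x \<partial>lborel)"
    using assms by (subst nn_integral_cmult[symmetric])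
      (auto simp: ennreal_times_divide ennreal_mult_divide_eq mult.commute[of "ennreal \<bar>a\<bar>"])
  ultimately show "integral\<^sup>N lborel g \<le> (\<integral>\<^sup>+x. f x \<partial>lborel)" by simp
qed

text \<open>Inner integrals are in general not subadditive in the integrand. A split along a
  measurable set is harmless, because a measurable minorant of \<open>f\<close> can be cut along the
  same set.\<close>

lemma nn_integral_add_le:
  assumes A: "A \<in> sets M"
  shows "(\<integral>\<^sup>+x. f x \<partial>M) \<le> (\<integral>\<^sup>+x\<in>A. f x \<partial>M) + (\<integral>\<^sup>+x\<in>-A. f x \<partial>M)"
proof (rule nn_integral_leI_simple)
  fix g assume [measurable]: "g \<in> borel_measurable M" and le: "g \<le> f"
  have "integral\<^sup>N M g = (\<integral>\<^sup>+x. g x * indicator A x + g x * indicator (space M - A) x \<partial>M)"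
    by (intro nn_integral_cong) (auto split: split_indicator)
  also have "\<dots> = (\<integral>\<^sup>+x\<in>A. g x \<partial>M) + (\<integral>\<^sup>+x\<in>space M - A. g x \<partial>M)"
    using A by (intro nn_integral_add) auto
  also have "\<dots> \<le> (\<integral>\<^sup>+x\<in>A. f x \<partial>M) + (\<integral>\<^sup>+x\<in>-A. f x \<partial>M)"
    using le by (intro add_mono nn_integral_mono) (auto split: split_indicator simp: le_fun_def)
  finally show "integral\<^sup>N M g \<le> (\<integral>\<^sup>+x\<in>A. f x \<partial>M) + (\<integral>\<^sup>+x\<in>-A. f x \<partial>M)" .
qed

lemma nn_integral_cmult_le:
  assumes "0 < k"
  shows "(\<integral>\<^sup>+x. ennreal k * f x \<partial>M) \<le> ennreal k * (\<integral>\<^sup>+x. f x \<partial>M)"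
proof (rule nn_integral_leI_simple)
  fix g assume [measurable]: "g \<in> borel_measurable M" and le: "g \<le> (\<lambda>x. ennreal k * f x)"
  have *: "g x / ennreal k \<le> f x" for x
  proof -
    have "g x / ennreal k \<le> (f x * ennreal k) / ennreal k"
      using le by (intro divide_right_mono_ennreal) (simp add: mult.commute le_fun_def)
    also have "\<dots> = f x" using assms by (intro ennreal_mult_divide_eq) auto
    finally show ?thesis .
  qed
  have "integral\<^sup>N M g = (\<integral>\<^sup>+x. ennreal k * (g x / ennreal k) \<partial>M)"
    using assms by (intro nn_integral_cong) (auto simp: ennreal_times_divide ennreal_mult_divide_eq mult.commute[of "ennreal k"])
  also have "\<dots> = ennreal k * (\<integral>\<^sup>+x. g x / ennreal k \<partial>M)" by (intro nn_integral_cmult) auto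
  also have "\<dots> \<le> ennreal k * (\<integral>\<^sup>+x. f x \<partial>M)" using * by (intro mult_left_mono nn_integral_mono) auto
  finally show "integral\<^sup>N M g \<le> \<dots>" .
qed

text \<open>The derivative may be unbounded near the exceptional points, so the fundamental theorem
  is used for the gauge integral. It makes \<open>c'\<close> Lebesgue measurable on the interval; if
  the right side is finite, \<open>c'\<close> is then absolutely integrable there.\<close>

lemma norm_diff_le_nn_integral:
  fixes c :: "real \<Rightarrow> 'a::euclidean_space"
  assumes "finite T" "a \<le> b" "continuous_on {a..b} c"
    and "\<And>t. t \<in> {a<..<b} - T \<Longrightarrow> (c has_vector_derivative c' t) (at t)"
  shows "ennreal (norm (c b - c a)) \<le> (\<integral>\<^sup>+t\<in>{a..b}. ennreal (norm (c' t)) \<partial>lborel)"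
proof (cases "(\<integral>\<^sup>+t\<in>{a..b}. ennreal (norm (c' t)) \<partial>lborel) = \<infinity>")
  case False
  have hi: "(c' has_integral (c b - c a)) {a..b}"
    using assms by (intro fundamental_theorem_of_calculus_interior_strong) auto
  have eq: "(\<integral>\<^sup>+t. ennreal (norm (indicat_real {a..b} t *\<^sub>R c' t)) \<partial>lebesgue)
      = (\<integral>\<^sup>+t\<in>{a..b}. ennreal (norm (c' t)) \<partial>lborel)"
    by (subst nn_integral_completion) (auto intro!: nn_integral_cong split: split_indicator)
  have "integrable lebesgue (\<lambda>t. indicat_real {a..b} t *\<^sub>R c' t)"
  proof (rule integrableI_bounded)
    show "(\<lambda>t. indicat_real {a..b} t *\<^sub>R c' t) \<in> borel_measurable lebesgue"
      using has_integral_implies_lebesgue_measurable[OF hi] .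
    show "(\<integral>\<^sup>+t. ennreal (norm (indicat_real {a..b} t *\<^sub>R c' t)) \<partial>lebesgue) < \<infinity>"
      unfolding eq using False by (simp add: top.not_eq_extremum)
  qed
  then have ai: "c' absolutely_integrable_on {a..b}" by (simp add: set_integrable_def)
  have "c b - c a = (LINT t:{a..b}|lebesgue. c' t)"
    using set_lebesgue_integral_eq_integral(2)[OF ai] hi by (metis integral_unique)
  also have "ennreal (norm \<dots>) \<le> (\<integral>\<^sup>+t. ennreal (norm (indicat_real {a..b} t *\<^sub>R c' t)) \<partial>lebesgue)"
    unfolding set_lebesgue_integral_def
    using ai by (intro integral_norm_bound_ennreal) (simp add: set_integrable_def)
  finally show ?thesis unfolding eq .
qed simp

section \<open>Horizontal curves and the metric axioms of Carnot--Caratheodory distances\<close>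

definition speed :: "'a set \<Rightarrow> ('a \<Rightarrow> real \<Rightarrow> real) \<Rightarrow> real \<Rightarrow> ennreal" where
  "speed F u t = ennreal (sqrt (\<Sum>v\<in>F. (u v t)\<^sup>2))"

lemma horizontal_length_speed: "horizontal_length F u = (\<integral>\<^sup>+t\<in>{0..1}. speed F u t \<partial>lborel)"
  by (simp add: horizontal_length_def speed_def)

lemma speed_scale: "speed F (\<lambda>v t. k * u v (h t)) t = ennreal \<bar>k\<bar> * speed F u (h t)"
  by (simp add: speed_def power_mult_distrib flip: sum_distrib_left ennreal_mult'')
     (simp add: real_sqrt_mult ennreal_mult')

text \<open>This covers reversal (\<open>a = -1\<close>, \<open>t0 = 1\<close>) and the two halves
  of a concatenation (\<open>a = 2\<close>, \<open>t0 = 0\<close> or \<open>t0 = -1\<close>). It is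
  why the coordinates of those curves are written in unsimplified forms such as
  \<open>1 + (- 1) * t\<close>.\<close>

lemma horizontal_length_affine_le:
  assumes "a \<noteq> 0"
  shows "(\<integral>\<^sup>+x. speed F (\<lambda>v t. a * u v (t0 + a * t)) x * indicator {0..1} (t0 + a * x) \<partial>lborel)
           \<le> horizontal_length F u"
proof -
  have "(\<integral>\<^sup>+x. speed F (\<lambda>v t. a * u v (t0 + a * t)) x * indicator {0..1} (t0 + a * x) \<partial>lborel)
    = (\<integral>\<^sup>+x. ennreal \<bar>a\<bar> * (speed F u (t0 + a * x) * indicator {0..1} (t0 + a * x)) \<partial>lborel)"
    by (simp only: speed_scale[of F a u "\<lambda>t. t0 + a * t"] mult.assoc)
  also have "\<dots> \<le> (\<integral>\<^sup>+x. speed F u x * indicator {0..1} x \<partial>lborel)"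
    using nn_integral_real_affine_le[OF assms, of "\<lambda>x. speed F u x * indicator {0..1} x"] by simp
  finally show ?thesis by (simp add: horizontal_length_speed)
qed

lemma cc_dist_lessE:
  assumes "cc_dist m e X F x y < r"
  obtains c u where "horizontal_curve m e X F c u" "c 0 = x" "c 1 = y" "horizontal_length F u < r"
  using assms unfolding cc_dist_def Inf_less_iff by blast

lemma cc_dist_le:
  assumes "horizontal_curve m e X F c u" "c 0 = x" "c 1 = y"
  shows "cc_dist m e X F x y \<le> horizontal_length F u"
  using assms unfolding cc_dist_def by (intro Inf_lower) blast

lemma horizontal_curve_reverse:
  assumes "horizontal_curve m e X F c u"
  shows "horizontal_curve m e X F (\<lambda>t. c (1 - t)) (\<lambda>v t. - 1 * u v (1 + (- 1) * t))"
proof -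
  obtain T where T: "finite T" and d: "\<And>t. t \<in> {0..1} - T \<Longrightarrow>
      (c has_vector_derivative (\<Sum>v\<in>F. u v t *\<^sub>R left_inv_field m e v (c t))) (at t)"
    and pc: "c piecewise_C1_differentiable_on {0..1}" and im: "c ` {0..1} \<subseteq> X"
    using assms unfolding horizontal_curve_def by blast
  have "valid_path c" using pc by (simp add: valid_path_def)
  then have "valid_path (reversepath c)" by simp
  then have "(\<lambda>t. c (1 - t)) piecewise_C1_differentiable_on {0..1}"
    by (simp add: valid_path_def reversepath_def)
  moreover have "(\<lambda>t. c (1 - t)) ` {0..1} \<subseteq> X" using im by force
  moreover have "((\<lambda>t. c (1 - t)) has_vector_derivative
      (\<Sum>v\<in>F. (- 1 * u v (1 + (- 1) * t)) *\<^sub>R left_inv_field m e v (c (1 - t)))) (at t)"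
    if t: "t \<in> {0..1} - (\<lambda>s. 1 - s) ` T" for t
  proof -
    have "1 - t \<in> {0..1} - T" using t by (auto simp: image_iff)
    from d[OF this]
    have "((c \<circ> (\<lambda>t. 1 - t)) has_vector_derivative
       (- 1) *\<^sub>R (\<Sum>v\<in>F. u v (1 - t) *\<^sub>R left_inv_field m e v (c (1 - t)))) (at t)"
      by (intro vector_diff_chain_at) (auto intro!: derivative_eq_intros)
    then show ?thesis by (simp add: o_def sum_negf)
  qed
  ultimately show ?thesis unfolding horizontal_curve_def using T
    by (blast intro: finite_imageI)
qed

lemma cc_dist_commute: "cc_dist m e X F x y = cc_dist m e X F y x"
proof -
  have "cc_dist m e X F y x \<le> cc_dist m e X F x y" for x y
  proof (rule dense_ge)
    fix r assume "cc_dist m e X F x y < r"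
    then obtain c u where c: "horizontal_curve m e X F c u" "c 0 = x" "c 1 = y" "horizontal_length F u < r"
      by (rule cc_dist_lessE)
    let ?u = "\<lambda>v t. - 1 * u v (1 + (- 1) * t)"
    have "cc_dist m e X F y x \<le> horizontal_length F ?u"
      using c by (intro cc_dist_le[OF horizontal_curve_reverse[OF c(1)]]) auto
    also have "horizontal_length F ?u
      = (\<integral>\<^sup>+x. speed F ?u x * indicator {0..1} (1 + (- 1) * x) \<partial>lborel)"
      unfolding horizontal_length_speed by (intro nn_integral_cong) (auto split: split_indicator)
    also have "\<dots> \<le> horizontal_length F u"
      by (rule horizontal_length_affine_le) simp
    finally show "cc_dist m e X F y x \<le> r" using c(4) by simp
  qed
  then show ?thesis by (intro antisym)
qed

lemma has_vector_derivative_transform_open: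
  assumes "(f has_vector_derivative D) (at t)" "open U" "t \<in> U" "\<And>s. s \<in> U \<Longrightarrow> g s = f s"
  shows "(g has_vector_derivative D) (at t)"
  using assms has_vector_derivative_transform_within_open[of f D t U g] by metis

lemma horizontal_curve_join:
  assumes "horizontal_curve m e X F c1 u1" "horizontal_curve m e X F c2 u2" "c1 1 = c2 0"
  shows "horizontal_curve m e X F (c1 +++ c2)
    (\<lambda>v t. if t \<le> 1/2 then 2 * u1 v (0 + 2 * t) else 2 * u2 v (-1 + 2 * t))"
    (is "horizontal_curve m e X F ?c ?u")
proof -
  obtain T1 where T1: "finite T1" and d1: "\<And>t. t \<in> {0..1} - T1 \<Longrightarrow>
      (c1 has_vector_derivative (\<Sum>v\<in>F. u1 v t *\<^sub>R left_inv_field m e v (c1 t))) (at t)"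
    and pc1: "c1 piecewise_C1_differentiable_on {0..1}" and im1: "c1 ` {0..1} \<subseteq> X"
    using assms(1) unfolding horizontal_curve_def by blast
  obtain T2 where T2: "finite T2" and d2: "\<And>t. t \<in> {0..1} - T2 \<Longrightarrow>
      (c2 has_vector_derivative (\<Sum>v\<in>F. u2 v t *\<^sub>R left_inv_field m e v (c2 t))) (at t)"
    and pc2: "c2 piecewise_C1_differentiable_on {0..1}" and im2: "c2 ` {0..1} \<subseteq> X"
    using assms(2) unfolding horizontal_curve_def by blast
  have "valid_path (c1 +++ c2)"
    using pc1 pc2 assms(3) by (intro valid_path_join) (auto simp: valid_path_def pathfinish_def pathstart_def)
  then have pc: "?c piecewise_C1_differentiable_on {0..1}" by (simp add: valid_path_def)
  have im: "?c ` {0..1} \<subseteq> X"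
  proof clarify
    fix t :: real assume "t \<in> {0..1}"
    then show "?c t \<in> X"
      using im1 im2 by (auto simp: joinpaths_def image_subset_iff)
  qed
  define T where "T = {1/2} \<union> (\<lambda>s. s / 2) ` T1 \<union> (\<lambda>s. (s + 1) / 2) ` T2"
  have T: "finite T" using T1 T2 by (simp add: T_def)
  have "(?c has_vector_derivative (\<Sum>v\<in>F. ?u v t *\<^sub>R left_inv_field m e v (?c t))) (at t)"
    if t: "t \<in> {0..1} - T" for t
  proof (cases "t < 1/2")
    case True
    have "2 * t \<notin> T1"
    proof
      assume "2 * t \<in> T1"
      then have "2 * t / 2 \<in> T" unfolding T_def by blast
      then show False using t by simp
    qed
    then have "2 * t \<in> {0..1} - T1" using t True by simp
    from d1[OF this]
    have "((c1 \<circ> (\<lambda>t. 2 * t)) has_vector_derivative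
       2 *\<^sub>R (\<Sum>v\<in>F. u1 v (2 * t) *\<^sub>R left_inv_field m e v (c1 (2 * t)))) (at t)"
      by (intro vector_diff_chain_at) (auto intro!: derivative_eq_intros)
    then have "(?c has_vector_derivative
       2 *\<^sub>R (\<Sum>v\<in>F. u1 v (2 * t) *\<^sub>R left_inv_field m e v (c1 (2 * t)))) (at t)"
      by (rule has_vector_derivative_transform_open[where U="{..<1/2}"]) (use True in \<open>auto simp: joinpaths_def\<close>)
    then show ?thesis using True by (simp add: joinpaths_def scaleR_sum_right)
  next
    case False
    then have t2: "t > 1/2" using t by (auto simp: T_def)
    have "2 * t - 1 \<notin> T2"
    proof
      assume "2 * t - 1 \<in> T2"
      then have "(2 * t - 1 + 1) / 2 \<in> T" unfolding T_def by blast
      then show False using t by simp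
    qed
    then have "2 * t - 1 \<in> {0..1} - T2" using t t2 by simp
    from d2[OF this]
    have "((c2 \<circ> (\<lambda>t. 2 * t - 1)) has_vector_derivative
       2 *\<^sub>R (\<Sum>v\<in>F. u2 v (2 * t - 1) *\<^sub>R left_inv_field m e v (c2 (2 * t - 1)))) (at t)"
      by (intro vector_diff_chain_at) (auto intro!: derivative_eq_intros)
    then have "(?c has_vector_derivative
       2 *\<^sub>R (\<Sum>v\<in>F. u2 v (2 * t - 1) *\<^sub>R left_inv_field m e v (c2 (2 * t - 1)))) (at t)"
      by (rule has_vector_derivative_transform_open[where U="{1/2<..}"]) (use t2 in \<open>auto simp: joinpaths_def\<close>)
    then show ?thesis using t2 by (simp add: joinpaths_def scaleR_sum_right)
  qed
  then show ?thesis unfolding horizontal_curve_def using pc im T by blast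
qed

lemma cc_dist_triangle: "cc_dist m e X F x z \<le> cc_dist m e X F x y + cc_dist m e X F y z"
proof (rule ennreal_le_epsilon)
  fix \<epsilon> :: real assume fin: "cc_dist m e X F x y + cc_dist m e X F y z < top" and \<epsilon>: "0 < \<epsilon>"
  \<comment> \<open>Adding a positive number is strict only at finite values;
    \<open>ennreal_le_epsilon\<close> supplies finiteness. Near-optimal curves then replace optimal
    ones, which need not exist.\<close>
  have *: "a < a + ennreal (\<epsilon>/2)" if "a < top" for a
    using that \<epsilon> by (cases a) (auto simp: ennreal_less_iff simp flip: ennreal_plus)
  have "cc_dist m e X F x y < cc_dist m e X F x y + ennreal (\<epsilon>/2)"
    using fin by (intro *) (simp add: less_top)
  then obtain c1 u1 where c1: "horizontal_curve m e X F c1 u1" "c1 0 = x" "c1 1 = y"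
      "horizontal_length F u1 < cc_dist m e X F x y + ennreal (\<epsilon>/2)"
    by (rule cc_dist_lessE)
  have "cc_dist m e X F y z < cc_dist m e X F y z + ennreal (\<epsilon>/2)"
    using fin by (intro *) (simp add: less_top)
  then obtain c2 u2 where c2: "horizontal_curve m e X F c2 u2" "c2 0 = y" "c2 1 = z"
      "horizontal_length F u2 < cc_dist m e X F y z + ennreal (\<epsilon>/2)"
    by (rule cc_dist_lessE)
  let ?u = "\<lambda>v t. if t \<le> 1/2 then 2 * u1 v (0 + 2 * t) else 2 * u2 v (-1 + 2 * t)"
  let ?v1 = "\<lambda>v t. 2 * u1 v (0 + 2 * t)" and ?v2 = "\<lambda>v t. 2 * u2 v (-1 + 2 * t)"
  have "cc_dist m e X F x z \<le> horizontal_length F ?u"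
    using c1 c2 by (intro cc_dist_le[OF horizontal_curve_join[OF c1(1) c2(1)]]) (auto simp: joinpaths_def)
  also have "\<dots> \<le> (\<integral>\<^sup>+t\<in>{..1/2}. speed F ?u t * indicator {0..1} t \<partial>lborel)
      + (\<integral>\<^sup>+t\<in>-{..1/2}. speed F ?u t * indicator {0..1} t \<partial>lborel)"
    unfolding horizontal_length_speed by (rule nn_integral_add_le) simp
  also have "\<dots> \<le> (\<integral>\<^sup>+x. speed F ?v1 x * indicator {0..1} (0 + 2 * x) \<partial>lborel)
      + (\<integral>\<^sup>+x. speed F ?v2 x * indicator {0..1} (-1 + 2 * x) \<partial>lborel)"
    by (intro add_mono nn_integral_mono) (auto simp: speed_def split: split_indicator)
  also have "\<dots> \<le> horizontal_length F u1 + horizontal_length F u2"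
    by (intro add_mono horizontal_length_affine_le) auto
  also have "\<dots> \<le> (cc_dist m e X F x y + ennreal (\<epsilon>/2)) + (cc_dist m e X F y z + ennreal (\<epsilon>/2))"
    using c1 c2 by (intro add_mono) auto
  also have "\<dots> = cc_dist m e X F x y + cc_dist m e X F y z + ennreal \<epsilon>"
    using \<epsilon> by (simp add: ac_simps flip: ennreal_plus)
  finally show "cc_dist m e X F x z \<le> cc_dist m e X F x y + cc_dist m e X F y z + ennreal \<epsilon>" .
qed

section \<open>Carnot groups\<close>

locale carnot_group =
  fixes m :: "'n::euclidean_space \<Rightarrow> 'n \<Rightarrow> 'n" and V :: "nat \<Rightarrow> 'n set" and S :: nat and B :: "'n set"
  assumes strat: "stratified_group m V S" and indep: "independent B" and span_B: "span B = V 1"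
begin

abbreviation "X v \<equiv> left_inv_field m 0 v"
abbreviation "DM p w \<equiv> frechet_derivative (\<lambda>p. m (fst p) (snd p)) (at p) w"
abbreviation "dist_N \<equiv> dN m B"
abbreviation "dist_G \<equiv> dG m V S B"

lemma finite_B: "finite B"
  using indep by (rule finiteI_independent)

lemma grp: "Groups.group m 0 uminus"
  using strat by (simp add: stratified_group_def lie_group_exp_def)

lemma m_assoc: "m (m x y) z = m x (m y z)"
proof -
  interpret Groups.group m 0 uminus by (rule grp)
  show ?thesis by (rule assoc)
qed

lemma m_simps [simp]: "m 0 x = x" "m x 0 = x" "m (- x) x = 0" "m x (- x) = 0"
proof -
  interpret Groups.group m 0 uminus by (rule grp)
  show "m 0 x = x" "m x 0 = x" "m (- x) x = 0" "m x (- x) = 0" by simp_all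
qed

lemma m_cancel [simp]: "m x (m (- x) y) = y" "m (- x) (m x y) = y"
  by (simp_all flip: m_assoc)

lemma m_differentiable: "(\<lambda>p. m (fst p) (snd p)) differentiable (at p)"
  and DM_continuous: "continuous_on UNIV (\<lambda>p. DM p w)"
proof -
  have "Ck 2 (\<lambda>p. m (fst p) (snd p))"
    using strat by (simp add: stratified_group_def lie_group_exp_def smooth_def)
  then have *: "Ck (Suc (Suc 0)) (\<lambda>p. m (fst p) (snd p))" by (simp add: numeral_2_eq_2)
  then show "(\<lambda>p. m (fst p) (snd p)) differentiable (at p)" by (simp del: split_paired_All)
  have "(\<lambda>p. DM p w) differentiable (at p)" for p using * by (simp del: split_paired_All)
  then show "continuous_on UNIV (\<lambda>p. DM p w)"
    by (intro continuous_at_imp_continuous_on ballI differentiable_imp_continuous_within)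
qed

lemma m_has_derivative: "(m x has_derivative (\<lambda>w. DM (x, y) (0, w))) (at y)"
proof -
  have 1: "((\<lambda>y. (x, y)) has_derivative (\<lambda>w. (0, w))) (at y)"
    by (auto intro!: derivative_eq_intros)
  have 2: "((\<lambda>p. m (fst p) (snd p)) has_derivative frechet_derivative (\<lambda>p. m (fst p) (snd p)) (at (x, y)))
      (at (x, y))"
    using m_differentiable frechet_derivative_works by blast
  have "((\<lambda>p. m (fst p) (snd p)) \<circ> (\<lambda>y. (x, y)) has_derivative
     (frechet_derivative (\<lambda>p. m (fst p) (snd p)) (at (x, y)) \<circ> (\<lambda>w. (0, w)))) (at y)"
    by (rule diff_chain_at[OF 1 2])
  then show ?thesis by (simp add: o_def)
qed

lemma m_continuous: "continuous_on A (m x)"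
  using m_has_derivative has_derivative_continuous
  by (intro continuous_at_imp_continuous_on ballI) blast

lemma X_eq: "X v x = DM (x, 0) (0, v)"
  unfolding left_inv_field_def frechet_derivative_at[OF m_has_derivative[of x 0], symmetric] ..

lemma DM_linear: "linear (\<lambda>w. DM (x, y) (0, w))"
  using m_has_derivative has_derivative_linear by blast

lemma X_continuous: "continuous_on A (X v)"
  unfolding X_eq[abs_def]
  by (rule continuous_on_compose2[OF DM_continuous]) (auto intro!: continuous_intros)

text \<open>Associativity writes the translation by \<open>m g x\<close> as the composition of two
  translations; this is the chain rule at \<open>0\<close>.\<close>

lemma X_left_translate: "X v (m g x) = DM (g, x) (0, X v x)"
proof -
  have eq: "m (m g x) = m g \<circ> m x" by (auto simp: m_assoc)
  have "(m g has_derivative (\<lambda>w. DM (g, x) (0, w))) (at (m x 0))"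
    using m_has_derivative[of g x] by simp
  then have "(m g \<circ> m x has_derivative (\<lambda>w. DM (g, x) (0, w)) \<circ> (\<lambda>w. DM (x, 0) (0, w))) (at 0)"
    by (rule diff_chain_at[OF m_has_derivative])
  then have "(m (m g x) has_derivative (\<lambda>w. DM (g, x) (0, DM (x, 0) (0, w)))) (at 0)"
    unfolding eq by (simp add: o_def)
  then have "X v (m g x) = DM (g, x) (0, DM (x, 0) (0, v))"
    by (simp only: left_inv_field_def frechet_derivative_at[symmetric])
  then show ?thesis by (simp only: X_eq[of v x])
qed

lemma horizontal_curve_left_translate:
  assumes "horizontal_curve m 0 UNIV B c u"
  shows "horizontal_curve m 0 UNIV B (\<lambda>t. m g (c t)) u"
proof -
  obtain T where T: "finite T" and d: "\<And>t. t \<in> {0..1} - T \<Longrightarrow>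
      (c has_vector_derivative (\<Sum>v\<in>B. u v t *\<^sub>R X v (c t))) (at t)"
    and pc: "c piecewise_C1_differentiable_on {0..1}"
    using assms unfolding horizontal_curve_def by blast
  have chain: "((\<lambda>t. m g (c t)) has_vector_derivative DM (g, c t) (0, D)) (at t)"
    if "(c has_vector_derivative D) (at t)" for t D
    using vector_derivative_diff_chain_within[OF that, of "m g" "\<lambda>w. DM (g, c t) (0, w)"]
      has_derivative_at_withinI[OF m_has_derivative] by (simp add: o_def)
  from pc obtain T' D where contc: "continuous_on {0..1} c" and T': "finite T'"
    and D: "\<And>t. t \<in> {0..1} - T' \<Longrightarrow> (c has_vector_derivative D t) (at t)"
    and contD: "continuous_on ({0..1} - T') D"
    unfolding piecewise_C1_differentiable_on_def C1_differentiable_on_def by blast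
  have contc': "continuous_on ({0..1} - T') c" using contc by (rule continuous_on_subset) auto
  \<comment> \<open>\<open>DM_continuous\<close> gives continuity in the base point for a fixed
    direction only, so the moving direction \<open>D t\<close> is expanded in the standard
    basis.\<close>
  have eq: "DM (g, x) (0, w) = (\<Sum>i\<in>Basis. (w \<bullet> i) *\<^sub>R DM (g, x) (0, i))" for x w
  proof -
    have "DM (g, x) (0, \<Sum>i\<in>Basis. (w \<bullet> i) *\<^sub>R i) = (\<Sum>i\<in>Basis. (w \<bullet> i) *\<^sub>R DM (g, x) (0, i))"
      unfolding linear_sum[OF DM_linear] by (simp only: linear_scale[OF DM_linear])
    then show ?thesis by (simp add: euclidean_representation)
  qed
  have "continuous_on ({0..1} - T') (\<lambda>t. DM (g, c t) (0, D t))"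
    unfolding eq[of _ "D _"] using contD contc'
    by (intro continuous_intros continuous_on_compose2[OF DM_continuous]) auto
  then have "(\<lambda>t. m g (c t)) C1_differentiable_on ({0..1} - T')"
    unfolding C1_differentiable_on_def
    by (intro exI[of _ "\<lambda>t. DM (g, c t) (0, D t)"] conjI ballI chain D)
  moreover have "continuous_on {0..1} (\<lambda>t. m g (c t))"
    by (rule continuous_on_compose2[OF m_continuous contc]) auto
  ultimately have "(\<lambda>t. m g (c t)) piecewise_C1_differentiable_on {0..1}"
    unfolding piecewise_C1_differentiable_on_def using T' by (intro conjI exI[of _ T'])
  moreover have "((\<lambda>t. m g (c t)) has_vector_derivative (\<Sum>v\<in>B. u v t *\<^sub>R X v (m g (c t)))) (at t)"
    if "t \<in> {0..1} - T" for t
    using chain[OF d[OF that]]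
    by (simp add: X_left_translate linear_sum[OF DM_linear] linear_scale[OF DM_linear])
  ultimately show ?thesis unfolding horizontal_curve_def using T
    by (intro conjI exI[of _ T] ballI) auto
qed

lemma dist_N_left_translate_le: "dist_N (m g x) (m g y) \<le> dist_N x y"
proof (rule dense_ge)
  fix r assume "dist_N x y < r"
  then obtain c u where "horizontal_curve m 0 UNIV B c u" "c 0 = x" "c 1 = y" "horizontal_length B u < r"
    unfolding dN_def by (rule cc_dist_lessE)
  then show "dist_N (m g x) (m g y) \<le> r"
    using cc_dist_le[OF horizontal_curve_left_translate, of c u g "m g x" "m g y"]
    by (auto simp: dN_def)
qed

lemma dist_N_ball_nhd:
  assumes "\<And>\<epsilon>. 0 < \<epsilon> \<Longrightarrow> \<exists>x U. open U \<and> x \<in> U \<and> U \<subseteq> dball dist_N UNIV x \<epsilon>"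
    and "0 < \<epsilon>"
  obtains U where "open U" "x \<in> U" "U \<subseteq> dball dist_N UNIV x \<epsilon>"
proof -
  obtain y U where U: "open U" "y \<in> U" "U \<subseteq> dball dist_N UNIV y \<epsilon>"
    using assms by blast
  \<comment> \<open>Left translation by \<open>m y (- x)\<close> takes \<open>x\<close> to
    \<open>y\<close>.\<close>
  let ?U = "m (m y (- x)) -` U"
  have "open ?U" using U(1) m_continuous by (intro open_vimage)
  moreover have "x \<in> ?U" using U(2) by (simp add: m_assoc)
  moreover have "?U \<subseteq> dball dist_N UNIV x \<epsilon>"
  proof
    fix z assume "z \<in> ?U"
    then have "dist_N y (m (m y (- x)) z) < ennreal \<epsilon>" using U(3) by (auto simp: dball_def)
    moreover have "dist_N (m (m x (- y)) y) (m (m x (- y)) (m (m y (- x)) z)) \<le> dist_N y (m (m y (- x)) z)"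
      by (rule dist_N_left_translate_le)
    moreover have "m (m x (- y)) (m (m y (- x)) z) = z" by (simp add: m_assoc)
    ultimately show "z \<in> dball dist_N UNIV x \<epsilon>" by (simp add: dball_def m_assoc)
  qed
  ultimately show ?thesis using that by blast
qed

lemma norm_frame_sum_le:
  "norm (\<Sum>v\<in>B. u v t *\<^sub>R X v x) \<le> (\<Sum>v\<in>B. norm (X v x)) * sqrt (\<Sum>v\<in>B. (u v t)\<^sup>2)"
proof -
  have "norm (\<Sum>v\<in>B. u v t *\<^sub>R X v x) \<le> (\<Sum>v\<in>B. \<bar>u v t\<bar> * norm (X v x))"
    by (rule sum_norm_le) simp
  also have "\<dots> \<le> (\<Sum>v\<in>B. sqrt (\<Sum>v\<in>B. (u v t)\<^sup>2) * norm (X v x))"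
  proof (intro sum_mono mult_right_mono)
    fix v assume "v \<in> B"
    then have "(u v t)\<^sup>2 \<le> (\<Sum>v\<in>B. (u v t)\<^sup>2)"
      using finite_B by (intro member_le_sum) auto
    then show "\<bar>u v t\<bar> \<le> sqrt (\<Sum>v\<in>B. (u v t)\<^sup>2)" by (intro real_le_rsqrt) simp
  qed simp
  finally show ?thesis by (simp only: sum_distrib_right mult.commute)
qed

text \<open>The frame fields are bounded by some \<open>M\<close> on a closed Euclidean ball of
  radius \<rho>, so a horizontal curve from the centre that leaves the ball has length at least
  \<open>\<rho> / M\<close>.\<close>

lemma small_dist_N_ball:
  assumes "open U" "x \<in> U"
  obtains \<epsilon> where "0 < \<epsilon>" "dball dist_N UNIV x \<epsilon> \<subseteq> U"
proof -
  obtain \<rho> where \<rho>: "0 < \<rho>" "ball x \<rho> \<subseteq> U" using assms openE by blast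
  have "continuous_on (cball x \<rho>) (\<lambda>y. \<Sum>v\<in>B. norm (X v y))"
    by (intro continuous_intros X_continuous)
  from compact_imp_bounded[OF compact_continuous_image[OF this compact_cball]]
  obtain M where M: "M > 0" "\<And>y. y \<in> cball x \<rho> \<Longrightarrow> (\<Sum>v\<in>B. norm (X v y)) \<le> M"
    unfolding bounded_pos by (auto simp: sum_nonneg)
  have "dball dist_N UNIV x (\<rho> / M) \<subseteq> ball x \<rho>"
  proof
    fix y assume "y \<in> dball dist_N UNIV x (\<rho> / M)"
    then have "dist_N x y < ennreal (\<rho> / M)" by (simp add: dball_def)
    then obtain c u where cu: "horizontal_curve m 0 UNIV B c u" "c 0 = x" "c 1 = y"
      "horizontal_length B u < ennreal (\<rho> / M)"
      unfolding dN_def by (rule cc_dist_lessE)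
    obtain T where T: "finite T" and d: "\<And>t. t \<in> {0..1} - T \<Longrightarrow>
      (c has_vector_derivative (\<Sum>v\<in>B. u v t *\<^sub>R X v (c t))) (at t)"
      and pc: "c piecewise_C1_differentiable_on {0..1}"
      using cu(1) unfolding horizontal_curve_def by blast
    have contc: "continuous_on {0..1} c" using pc by (simp add: piecewise_C1_differentiable_on_def)
    show "y \<in> ball x \<rho>"
    proof (rule ccontr)
      assume "y \<notin> ball x \<rho>"
      \<comment> \<open>The times at which the curve is at distance at least \<rho> from
        \<open>x\<close>; the smallest is the first exit time.\<close>
      let ?E = "{0..1} \<inter> (\<lambda>t. dist x (c t)) -` {\<rho>..}"
      have "closed ?E" using contc by (intro continuous_closed_preimage continuous_intros) auto
      then have "compact ?E" by (simp add: compact_eq_bounded_closed bounded_Int)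
      moreover have "1 \<in> ?E" using \<open>y \<notin> ball x \<rho>\<close> cu(3) by (auto simp: )
      ultimately obtain s where s: "s \<in> ?E" "\<And>t. t \<in> ?E \<Longrightarrow> s \<le> t"
        using compact_attains_inf[of ?E] by blast
      have inb: "c t \<in> cball x \<rho>" if "t \<in> {0..<s}" for t
      proof (rule ccontr)
        assume "c t \<notin> cball x \<rho>"
        then have "t \<in> ?E" using that s(1) by auto
        then show False using s(2)[of t] that by simp
      qed
      \<comment> \<open>The bound \<open>M\<close> is available only before the exit time
        \<open>s\<close>; the value at \<open>s\<close> itself does not affect the integral and is
        set to \<open>0\<close>.\<close>
      let ?d = "\<lambda>t. if t < s then \<Sum>v\<in>B. u v t *\<^sub>R X v (c t) else 0"
      have "ennreal \<rho> \<le> ennreal (norm (c s - c 0))"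
        using s(1) cu(2) by (auto simp: dist_norm norm_minus_commute intro!: ennreal_leI)
      also have "\<dots> \<le> (\<integral>\<^sup>+t\<in>{0..s}. ennreal (norm (?d t)) \<partial>lborel)"
      proof (rule norm_diff_le_nn_integral[OF T])
        show "continuous_on {0..s} c" using s(1) by (intro continuous_on_subset[OF contc]) auto
        show "(c has_vector_derivative ?d t) (at t)" if "t \<in> {0<..<s} - T" for t
        proof -
          have "t \<in> {0..1} - T" using that s(1) by auto
          from d[OF this] show ?thesis using that by simp
        qed
      qed (use s(1) in simp)
      also have "\<dots> \<le> (\<integral>\<^sup>+t. ennreal M * (speed B u t * indicator {0..1} t) \<partial>lborel)"
      proof (intro nn_integral_mono)
        fix t
        show "ennreal (norm (?d t)) * indicator {0..s} t \<le> ennreal M * (speed B u t * indicator {0..1} t)"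
        proof (cases "t \<in> {0..<s}")
          case True
          have "norm (\<Sum>v\<in>B. u v t *\<^sub>R X v (c t)) \<le> M * sqrt (\<Sum>v\<in>B. (u v t)\<^sup>2)"
            using norm_frame_sum_le[of u t "c t"] M(2)[OF inb[OF True]]
            by (meson order_trans mult_right_mono real_sqrt_ge_zero sum_nonneg zero_le_power2)
          then have "ennreal (norm (\<Sum>v\<in>B. u v t *\<^sub>R X v (c t))) \<le> ennreal M * speed B u t"
            using M(1) by (simp add: speed_def ennreal_leI flip: ennreal_mult')
          moreover have "t \<in> {0..1}" using True s(1) by auto
          ultimately show ?thesis using True by simp
        qed (auto split: split_indicator)
      qed
      also have "\<dots> \<le> ennreal M * horizontal_length B u"
        unfolding horizontal_length_speed using M(1) by (rule nn_integral_cmult_le)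
      also have "\<dots> < ennreal M * ennreal (\<rho> / M)"
        using cu(4) M(1) by (intro ennreal_mult_strict_left_mono) auto
      also have "\<dots> = ennreal \<rho>" using M \<rho> by (simp flip: ennreal_mult')
      finally show False by simp
    qed
  qed
  then show ?thesis using that[of "\<rho> / M"] \<rho> M by auto
qed

end

section \<open>Dilations and the geometry of the semidirect product\<close>

context carnot_group
begin

lemma subspace_V: "subspace (V j)"
  using strat by (simp add: stratified_group_def)

lemma S_ge_1: "1 \<le> S"
  using strat by (simp add: stratified_group_def)

lemma layer_part:
  shows "layer_part V S x j \<in> V j" and "x = (\<Sum>j=1..S. layer_part V S x j)"
proof -
  have "\<exists>!y. (\<forall>j. y j \<in> V j) \<and> x = (\<Sum>j=1..S. y j)" using strat by (simp add: stratified_group_def)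
  from theI'[OF this]
  show "layer_part V S x j \<in> V j" "x = (\<Sum>j=1..S. layer_part V S x j)"
    unfolding layer_part_def by blast+
qed

lemma layer_part_eqI:
  assumes "\<And>j. y j \<in> V j" "x = (\<Sum>j=1..S. y j)"
  shows "layer_part V S x = y"
proof -
  have "\<exists>!y. (\<forall>j. y j \<in> V j) \<and> x = (\<Sum>j=1..S. y j)" using strat by (simp add: stratified_group_def)
  then show ?thesis unfolding layer_part_def by (rule the1_equality) (use assms in blast)
qed

lemma linear_dil: "linear (dil V S a)"
proof (rule linearI)
  fix x y
  have "layer_part V S (x + y) = (\<lambda>j. layer_part V S x j + layer_part V S y j)"
    using layer_part(2)[of x] layer_part(2)[of y]
    by (intro layer_part_eqI subspace_add subspace_V layer_part(1)) (simp add: sum.distrib)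
  then show "dil V S a (x + y) = dil V S a x + dil V S a y"
    by (simp add: dil_def scaleR_add_right sum.distrib)
next
  fix r x
  have "layer_part V S (r *\<^sub>R x) = (\<lambda>j. r *\<^sub>R layer_part V S x j)"
    using layer_part(2)[of x]
    by (intro layer_part_eqI subspace_scale subspace_V layer_part(1)) (simp flip: scaleR_sum_right)
  then show "dil V S a (r *\<^sub>R x) = r *\<^sub>R dil V S a x"
    by (simp add: dil_def scaleR_sum_right mult.commute)
qed

lemma dil_0 [simp]: "dil V S a 0 = 0"
  using linear_dil by (rule linear_0)

lemma dil_V1:
  assumes "v \<in> V 1"
  shows "dil V S a v = a *\<^sub>R v"
proof -
  have "layer_part V S v = (\<lambda>j. if j = 1 then v else 0)"
    using assms S_ge_1 by (intro layer_part_eqI) (auto intro: subspace_0 subspace_V)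
  then have "dil V S a v = (\<Sum>j=1..S. if j = 1 then a *\<^sub>R v else 0)"
    unfolding dil_def by (intro sum.cong) auto
  then show ?thesis using S_ge_1 by simp
qed

abbreviation "gm \<equiv> gmul m V S"
abbreviation "FG \<equiv> insert (0, 1) ((\<lambda>v. (v, 0)) ` B) :: ('n \<times> real) set"

lemma gm_X0: "gm (n, 1) (exp_X0 t) = (n, exp t)"
  by (simp add: gmul_def exp_X0_def)

text \<open>Left translation by \<open>(n, h)\<close> acts on the \<open>N\<close>-component through
  \<open>dil V S h\<close>, which is multiplication by \<open>h\<close> on the first layer. Hence
  the horizontal fields of \<open>N\<close> appear scaled by the height, and horizontal motion at
  height \<open>h\<close> is cheaper by the factor \<open>1 / h\<close>.\<close>

lemma left_inv_field_G:
  assumes "v \<in> V 1"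
  shows "left_inv_field gm (0, 1) (v, s) (n, h) = (h *\<^sub>R X v n, h * s)"
proof -
  have "((\<lambda>y. dil V S h (fst y)) has_derivative (\<lambda>w. dil V S h (fst w))) (at (0, 1))"
    by (intro bounded_linear_imp_has_derivative bounded_linear_compose[OF _ bounded_linear_fst]
        linear_conv_bounded_linear[THEN iffD1] linear_dil)
  moreover have "(m n has_derivative (\<lambda>w. DM (n, 0) (0, w))) (at (dil V S h (fst (0, 1 :: real))))"
    using m_has_derivative[of n 0] by simp
  ultimately have "((\<lambda>y. m n (dil V S h (fst y))) has_derivative (\<lambda>w. DM (n, 0) (0, dil V S h (fst w)))) (at (0, 1 :: real))"
    by (rule has_derivative_compose)
  then have "(gm (n, h) has_derivative (\<lambda>w. (DM (n, 0) (0, dil V S h (fst w)), h * snd w))) (at (0, 1))"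
    unfolding gmul_def[abs_def] fst_conv snd_conv
    by (intro has_derivative_Pair) (auto intro!: derivative_eq_intros)
  then have "left_inv_field gm (0, 1) (v, s) (n, h) = (DM (n, 0) (0, dil V S h v), h * s)"
    unfolding left_inv_field_def by (simp add: frechet_derivative_at[symmetric])
  also have "DM (n, 0) (0, dil V S h v) = h *\<^sub>R DM (n, 0) (0, v)"
    unfolding dil_V1[OF assms] by (simp only: linear_scale[OF DM_linear])
  finally show ?thesis by (simp only: X_eq[of v n])
qed

lemma sum_FG: "(\<Sum>w\<in>FG. f w) = f (0, 1) + (\<Sum>v\<in>B. f (v, 0))"
  using finite_B by (subst sum.insert) (auto simp: sum.reindex inj_on_def)

lemma velocity_G:
  "(\<Sum>w\<in>FG. u w t *\<^sub>R left_inv_field gm (0, 1) w (n, h))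
     = (\<Sum>v\<in>B. (u (v, 0) t * h) *\<^sub>R X v n, u (0, 1) t * h)"
proof -
  have 0: "left_inv_field gm (0, 1) (0, 1) (n, h) = (0, h)"
  proof -
    have "X 0 n = 0" unfolding X_eq by (rule linear_0[OF DM_linear])
    moreover have "0 \<in> V 1" using subspace_V by (rule subspace_0)
    ultimately show ?thesis using left_inv_field_G[of 0 1 n h] by simp
  qed
  have "left_inv_field gm (0, 1) (v, 0) (n, h) = (h *\<^sub>R X v n, 0)" if "v \<in> B" for v
    using that span_B span_base[of v B] left_inv_field_G[of v 0 n h] by simp
  then have "(\<Sum>v\<in>B. u (v, 0) t *\<^sub>R left_inv_field gm (0, 1) (v, 0) (n, h))
      = (\<Sum>v\<in>B. ((u (v, 0) t * h) *\<^sub>R X v n, 0))"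
    by (intro sum.cong) auto
  also have "\<dots> = (\<Sum>v\<in>B. (u (v, 0) t * h) *\<^sub>R X v n, 0)"
    by (simp add: sum_prod)
  finally show ?thesis unfolding sum_FG 0 by simp
qed

lemma speed_FG: "speed FG u t = ennreal (sqrt ((u (0, 1) t)\<^sup>2 + (\<Sum>v\<in>B. (u (v, 0) t)\<^sup>2)))"
  unfolding speed_def by (subst sum_FG) simp

lemma dist_G_horizontal:
  assumes "0 < h" "dist_N n n' < ennreal \<rho>"
  shows "dist_G (n, h) (n', h) < ennreal (\<rho> / h)"
proof -
  obtain c u where cu: "horizontal_curve m 0 UNIV B c u" "c 0 = n" "c 1 = n'"
    "horizontal_length B u < ennreal \<rho>"
    using assms(2) unfolding dN_def by (rule cc_dist_lessE)
  obtain T where T: "finite T" and d: "\<And>t. t \<in> {0..1} - T \<Longrightarrow>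
      (c has_vector_derivative (\<Sum>v\<in>B. u v t *\<^sub>R X v (c t))) (at t)"
    and pc: "c piecewise_C1_differentiable_on {0..1}"
    using cu(1) unfolding horizontal_curve_def by blast
  \<comment> \<open>The condition \<open>snd p = 0\<close> picks out the frame vectors coming from
    \<open>B\<close>; the vertical coordinate is \<open>0\<close>. Division by \<open>h\<close>
    compensates for the scaled fields.\<close>
  define w where "w = (\<lambda>(p :: 'n \<times> real) t. if snd p = 0 then 1 / h * u (fst p) t else 0)"
  obtain T' D where contc: "continuous_on {0..1} c" and T': "finite T'"
    and D: "\<And>t. t \<in> {0..1} - T' \<Longrightarrow> (c has_vector_derivative D t) (at t)"
    and contD: "continuous_on ({0..1} - T') D"
    using pc unfolding piecewise_C1_differentiable_on_def C1_differentiable_on_def by blast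
  have lift: "((\<lambda>t. (c t, h)) has_vector_derivative (E, 0)) (at t)"
    if "(c has_vector_derivative E) (at t)" for t E
    using that by (auto intro!: derivative_eq_intros)
  have "(\<lambda>t. (c t, h)) C1_differentiable_on ({0..1} - T')"
    unfolding C1_differentiable_on_def
    by (intro exI[of _ "\<lambda>t. (D t, 0)"] conjI ballI lift D continuous_intros contD)
  then have pc': "(\<lambda>t. (c t, h)) piecewise_C1_differentiable_on {0..1}"
    unfolding piecewise_C1_differentiable_on_def using T' contc
    by (intro conjI exI[of _ T'] continuous_intros)
  have "horizontal_curve gm (0, 1) G_set FG (\<lambda>t. (c t, h)) w"
    unfolding horizontal_curve_def velocity_G
  proof (intro conjI exI[of _ T] ballI pc' T)
    show "(\<lambda>t. (c t, h)) ` {0..1} \<subseteq> G_set" using assms(1) by (auto simp: G_set_def)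
    fix t assume "t \<in> {0..1} - T"
    from lift[OF d[OF this]]
    show "((\<lambda>t. (c t, h)) has_vector_derivative
       (\<Sum>v\<in>B. (w (v, 0) t * h) *\<^sub>R X v (c t), w (0, 1) t * h)) (at t)"
      using assms(1) by (simp add: w_def)
  qed
  then have "dist_G (n, h) (n', h) \<le> horizontal_length FG w"
    unfolding dG_def by (rule cc_dist_le) (use cu in auto)
  also have "\<dots> = (\<integral>\<^sup>+t. ennreal (1 / h) * (speed B u t * indicator {0..1} t) \<partial>lborel)"
    unfolding horizontal_length_speed
  proof (intro nn_integral_cong)
    fix t
    have "speed FG w t = speed B (\<lambda>v t. 1 / h * u v t) t"
      unfolding speed_FG by (simp add: speed_def w_def)
    also have "\<dots> = ennreal (1 / h) * speed B u t"
      using speed_scale[of B "1 / h" u "\<lambda>t. t"] assms(1) by simp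
    finally show "speed FG w t * indicator {0..1} t = ennreal (1 / h) * (speed B u t * indicator {0..1} t)"
      by (simp add: mult.assoc)
  qed
  also have "\<dots> \<le> ennreal (1 / h) * horizontal_length B u"
    unfolding horizontal_length_speed using assms(1) by (intro nn_integral_cmult_le) simp
  also have "\<dots> < ennreal (1 / h) * ennreal \<rho>"
    using cu(4) assms(1) by (intro ennreal_mult_strict_left_mono) auto
  also have "\<dots> = ennreal (\<rho> / h)" using assms(1) by (simp flip: ennreal_mult')
  finally show ?thesis .
qed

text \<open>Flow lines of \<open>X_0\<close> have unit speed in the variable \<open>ln h\<close>;
  the curve used interpolates \<open>ln h\<close> linearly.\<close>

lemma dist_G_vertical:
  assumes "0 < h" "0 < h'"
  shows "dist_G (n, h) (n, h') \<le> ennreal \<bar>ln h - ln h'\<bar>"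
proof -
  define k where "k = ln h' - ln h"
  define c where "c = (\<lambda>t. (n, exp (ln h + t * k)))"
  define u where "u = (\<lambda>p (t::real). if p = (0 :: 'n, 1 :: real) then k else 0)"
  have der: "(c has_vector_derivative (0, k * exp (ln h + t * k))) (at t)" for t
    unfolding c_def
    by (intro has_vector_derivative_Pair) (auto intro!: derivative_eq_intros simp: has_vector_derivative_def mult_ac)
  have "c C1_differentiable_on {0..1}"
    unfolding C1_differentiable_on_def
    by (intro exI[of _ "\<lambda>t. (0, k * exp (ln h + t * k))"] conjI ballI der continuous_intros)
  then have pc: "c piecewise_C1_differentiable_on {0..1}" by (rule C1_differentiable_imp_piecewise)
  have "horizontal_curve gm (0, 1) G_set FG c u"
    unfolding horizontal_curve_def
  proof (intro conjI exI[of _ "{}"] ballI pc)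
    show "c ` {0..1} \<subseteq> G_set" by (auto simp: c_def G_set_def)
    fix t
    have "u (v, 0) t = 0" for v by (simp add: u_def)
    then have "(\<Sum>w\<in>FG. u w t *\<^sub>R left_inv_field gm (0, 1) w (c t)) = (0, k * exp (ln h + t * k))"
      unfolding c_def velocity_G by (simp add: u_def)
    then show "(c has_vector_derivative (\<Sum>w\<in>FG. u w t *\<^sub>R left_inv_field gm (0, 1) w (c t))) (at t)"
      using der by simp
  qed simp
  then have "dist_G (n, h) (n, h') \<le> horizontal_length FG u"
    unfolding dG_def by (rule cc_dist_le) (use assms in \<open>auto simp: c_def k_def\<close>)
  also have "\<dots> = (\<integral>\<^sup>+t\<in>{0..1::real}. ennreal \<bar>k\<bar> \<partial>lborel)"
    unfolding horizontal_length_speed speed_FG by (intro nn_integral_cong) (simp add: u_def)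
  also have "\<dots> = ennreal \<bar>k\<bar>" by (simp add: nn_integral_cmult)
  finally show ?thesis by (simp add: k_def abs_minus_commute)
qed

text \<open>A vertical path to an intermediate height \<open>H\<close>, a horizontal path there, and
  a vertical path to the end. The choice of \<open>H\<close> balances the three terms and is made in
  \<open>G_nhd\<close> and \<open>rect_subset_ball\<close>.\<close>

lemma dist_G_via:
  assumes "0 < h" "0 < H" "0 < h'" "0 < \<rho>" "dist_N n n' < ennreal \<rho>"
  shows "dist_G (n, h) (n', h') < ennreal (\<bar>ln h - ln H\<bar> + \<rho> / H + \<bar>ln H - ln h'\<bar>)"
proof -
  have "dist_G (n, h) (n', h') \<le> dist_G (n, h) (n, H) + dist_G (n, H) (n', h')"
    unfolding dG_def by (rule cc_dist_triangle)
  also have "\<dots> \<le> dist_G (n, h) (n, H) + (dist_G (n, H) (n', H) + dist_G (n', H) (n', h'))"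
    unfolding dG_def by (intro add_left_mono cc_dist_triangle)
  also have "\<dots> \<le> ennreal \<bar>ln h - ln H\<bar> + (dist_G (n, H) (n', H) + ennreal \<bar>ln H - ln h'\<bar>)"
    using assms by (intro add_mono dist_G_vertical order_refl)
  also have "\<dots> = dist_G (n, H) (n', H) + ennreal (\<bar>ln h - ln H\<bar> + \<bar>ln H - ln h'\<bar>)"
    by (simp add: ac_simps)
  also have "\<dots> < ennreal (\<rho> / H) + ennreal (\<bar>ln h - ln H\<bar> + \<bar>ln H - ln h'\<bar>)"
    using dist_G_horizontal[OF assms(2,5)] by (simp add: add.commute[of _ "ennreal (\<bar>ln h - ln H\<bar> + \<bar>ln H - ln h'\<bar>)"] ennreal_add_left_cancel_less)
  also have "\<dots> = ennreal (\<bar>ln h - ln H\<bar> + \<rho> / H + \<bar>ln H - ln h'\<bar>)"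
    using assms by (simp add: ac_simps flip: ennreal_plus)
  finally show ?thesis .
qed

lemma dist_G_lessD:
  assumes "0 < h" "0 < r" "dist_G (n, h) (n', h') < ennreal r"
  shows "\<bar>ln h - ln h'\<bar> < r" and "dist_N n n' < ennreal (h * exp r * r)"
proof -
  obtain c u where cu: "horizontal_curve gm (0, 1) G_set FG c u" "c 0 = (n, h)" "c 1 = (n', h')"
    "horizontal_length FG u < ennreal r"
    using assms(3) unfolding dG_def by (rule cc_dist_lessE)
  obtain T where T: "finite T" and d: "\<And>t. t \<in> {0..1} - T \<Longrightarrow>
      (c has_vector_derivative (\<Sum>w\<in>FG. u w t *\<^sub>R left_inv_field gm (0, 1) w (c t))) (at t)"
    and pc: "c piecewise_C1_differentiable_on {0..1}" and im: "c ` {0..1} \<subseteq> G_set"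
    using cu(1) unfolding horizontal_curve_def by blast
  have pos: "0 < snd (c t)" if "t \<in> {0..1}" for t
    using im that by (force simp: G_set_def)
  have d': "(c has_vector_derivative
     (\<Sum>v\<in>B. (u (v, 0) t * snd (c t)) *\<^sub>R X v (fst (c t)), u (0, 1) t * snd (c t))) (at t)"
    if "t \<in> {0..1} - T" for t
    using d[OF that] velocity_G[of u t "fst (c t)" "snd (c t)"] by simp
  have dfst: "((\<lambda>t. fst (c t)) has_vector_derivative
     (\<Sum>v\<in>B. (u (v, 0) t * snd (c t)) *\<^sub>R X v (fst (c t)))) (at t)" if "t \<in> {0..1} - T" for t
    using bounded_linear.has_vector_derivative[OF bounded_linear_fst d'[OF that]] by simp
  have dsnd: "((\<lambda>t. snd (c t)) has_vector_derivative u (0, 1) t * snd (c t)) (at t)"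
    if "t \<in> {0..1} - T" for t
    using bounded_linear.has_vector_derivative[OF bounded_linear_snd d'[OF that]] by simp
  have contc: "continuous_on {0..1} c" using pc by (simp add: piecewise_C1_differentiable_on_def)
  \<comment> \<open>The logarithm of the height has derivative \<open>u (0, 1)\<close>, which the
    speed dominates. The bound is proved at every time, not only at the end, because the horizontal
    estimate needs the height along the whole curve.\<close>
  have bound: "\<bar>ln (snd (c s)) - ln h\<bar> < r" if s: "s \<in> {0..1}" for s
  proof -
    have "ennreal (norm (ln (snd (c s)) - ln (snd (c 0)))) \<le> (\<integral>\<^sup>+t\<in>{0..s}. ennreal (norm (u (0, 1) t)) \<partial>lborel)"
    proof (rule norm_diff_le_nn_integral[OF T])
      show "continuous_on {0..s} (\<lambda>t. ln (snd (c t)))"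
        using s pos by (intro continuous_intros continuous_on_subset[OF contc]) force+
      show "((\<lambda>t. ln (snd (c t))) has_vector_derivative u (0, 1) t) (at t)" if "t \<in> {0<..<s} - T" for t
      proof -
        have t: "t \<in> {0..1} - T" "t \<in> {0..1}" using that s by auto
        have "((\<lambda>t. ln (snd (c t))) has_real_derivative 1 / snd (c t) * (u (0, 1) t * snd (c t))) (at t)"
          using dsnd[OF t(1)] pos[OF t(2)]
          by (intro DERIV_chain2[OF DERIV_ln_divide]) (auto simp: has_real_derivative_iff_has_vector_derivative)
        then show ?thesis using pos[OF t(2)] by (simp add: has_real_derivative_iff_has_vector_derivative)
      qed
    qed (use s in auto)
    also have "\<dots> \<le> (\<integral>\<^sup>+t\<in>{0..1}. speed FG u t \<partial>lborel)"
      unfolding speed_FG using s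
      by (intro nn_integral_mono)
         (auto split: split_indicator intro!: ennreal_leI real_le_rsqrt simp: sum_nonneg)
    also have "\<dots> < ennreal r" using cu(4) by (simp add: horizontal_length_speed)
    finally show ?thesis using cu(2) by (simp add: ennreal_less_iff)
  qed
  from bound[of 1] show "\<bar>ln h - ln h'\<bar> < r" using cu(3) by (simp add: abs_minus_commute)
  have le: "snd (c s) \<le> h * exp r" if "s \<in> {0..1}" for s
  proof -
    have "ln (snd (c s)) \<le> ln h + r" using bound[OF that] by simp
    then have "exp (ln (snd (c s))) \<le> exp (ln h + r)" by simp
    then show ?thesis using pos[OF that] assms(1) by (simp add: exp_add)
  qed
  obtain T' D where T': "finite T'"
    and D: "\<And>t. t \<in> {0..1} - T' \<Longrightarrow> (c has_vector_derivative D t) (at t)"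
    and contD: "continuous_on ({0..1} - T') D"
    using pc unfolding piecewise_C1_differentiable_on_def C1_differentiable_on_def by blast
  have "(\<lambda>t. fst (c t)) C1_differentiable_on ({0..1} - T')"
    unfolding C1_differentiable_on_def
    by (intro exI[of _ "\<lambda>t. fst (D t)"] conjI ballI bounded_linear.has_vector_derivative[OF bounded_linear_fst] D
        continuous_intros contD)
  then have pc': "(\<lambda>t. fst (c t)) piecewise_C1_differentiable_on {0..1}"
    unfolding piecewise_C1_differentiable_on_def using T' contc
    by (intro conjI exI[of _ T'] continuous_intros)
  \<comment> \<open>Projecting to \<open>N\<close> multiplies each horizontal coordinate by the
    current height; this is the source of the factor \<open>h * exp r\<close>.\<close>
  let ?w = "\<lambda>v t. u (v, 0) t * snd (c t)"
  have "horizontal_curve m 0 UNIV B (\<lambda>t. fst (c t)) ?w"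
    unfolding horizontal_curve_def
    by (intro conjI exI[of _ T] ballI pc' T dfst) auto
  then have "dist_N n n' \<le> horizontal_length B ?w"
    unfolding dN_def by (rule cc_dist_le) (use cu in auto)
  also have "\<dots> \<le> (\<integral>\<^sup>+t. ennreal (h * exp r) * (speed FG u t * indicator {0..1} t) \<partial>lborel)"
    unfolding horizontal_length_speed
  proof (intro nn_integral_mono)
    fix t
    show "speed B ?w t * indicator {0..1} t \<le> ennreal (h * exp r) * (speed FG u t * indicator {0..1} t)"
    proof (cases "t \<in> {0..1}")
      case True
      have "sqrt (\<Sum>v\<in>B. (u (v, 0) t * snd (c t))\<^sup>2) = snd (c t) * sqrt (\<Sum>v\<in>B. (u (v, 0) t)\<^sup>2)"
        using pos[OF True]
        by (simp add: power_mult_distrib real_sqrt_mult flip: sum_distrib_right)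
      also have "\<dots> \<le> (h * exp r) * sqrt ((u (0, 1) t)\<^sup>2 + (\<Sum>v\<in>B. (u (v, 0) t)\<^sup>2))"
        using pos[OF True] le[OF True] assms(1) by (intro mult_mono) (auto simp: sum_nonneg)
      finally have "speed B ?w t \<le> ennreal (h * exp r) * speed FG u t"
        unfolding speed_FG using assms(1) by (simp add: speed_def ennreal_leI flip: ennreal_mult')
      then show ?thesis using True by simp
    qed simp
  qed
  also have "\<dots> \<le> ennreal (h * exp r) * horizontal_length FG u"
    unfolding horizontal_length_speed using assms(1) by (intro nn_integral_cmult_le) simp
  also have "\<dots> < ennreal (h * exp r) * ennreal r"
    using cu(4) assms(1) by (intro ennreal_mult_strict_left_mono) auto
  also have "\<dots> = ennreal (h * exp r * r)" using assms by (simp flip: ennreal_mult')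
  finally show "dist_N n n' < ennreal (h * exp r * r)" .
qed

end

section \<open>Calderon--Zygmund decompositions from nested partitions\<close>

text \<open>The measure \<open>|f| d\<mu>\<close>. A comparison of the average of \<open>|f|\<close>
  on \<open>P\<close> with \<alpha> becomes a comparison of two measures of \<open>P\<close>,
  without division.\<close>

definition norm_density :: "'a measure \<Rightarrow> ('a \<Rightarrow> 'b::{banach, second_countable_topology}) \<Rightarrow> 'a measure" where
  "norm_density \<mu> f = density \<mu> (\<lambda>x. ennreal (norm (f x)))"

lemma sets_norm_density [simp]: "sets (norm_density \<mu> f) = sets \<mu>"
  and space_norm_density [simp]: "space (norm_density \<mu> f) = space \<mu>"
  by (simp_all add: norm_density_def)

lemma emeasure_norm_density:
  assumes "integrable \<mu> f" "P \<in> sets \<mu>"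
  shows "emeasure (norm_density \<mu> f) P = (\<integral>\<^sup>+x\<in>P. ennreal (norm (f x)) \<partial>\<mu>)"
  using assms unfolding norm_density_def by (intro emeasure_density) auto

lemma emeasure_norm_density_space:
  assumes "integrable \<mu> f"
  shows "emeasure (norm_density \<mu> f) (space \<mu>) = ennreal (LINT x|\<mu>. norm (f x))"
proof -
  have "emeasure (norm_density \<mu> f) (space \<mu>) = (\<integral>\<^sup>+x. ennreal (norm (f x)) \<partial>\<mu>)"
    using assms by (subst emeasure_norm_density) (auto intro!: nn_integral_cong)
  also have "\<dots> = ennreal (LINT x|\<mu>. norm (f x))" using assms by (intro nn_integral_eq_integral) auto
  finally show ?thesis .
qed

text \<open>Larger indices mean finer generations, and covering is asked of generation 0. The last
  assumption merges outer regularity with the fact that almost every point of an open set lies in a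
  member inside that set; in this form it involves no topology.\<close>

locale nested_basis =
  fixes \<mu> :: "'a measure" and D :: "int \<Rightarrow> 'a set set" and C :: real
  assumes C_ge_1: "1 \<le> C"
    and countable_D: "countable (D k)"
    and disjoint_D: "disjoint (D k)"
    and sets_D: "P \<in> D k \<Longrightarrow> P \<in> sets \<mu>"
    and pos_D: "P \<in> D k \<Longrightarrow> 0 < emeasure \<mu> P"
    and fin_D: "P \<in> D k \<Longrightarrow> emeasure \<mu> P < \<infinity>"
    and parent: "P \<in> D (k + 1) \<Longrightarrow> \<exists>P'\<in>D k. P \<subseteq> P' \<and> emeasure \<mu> P' \<le> ennreal C * emeasure \<mu> P"
    and growing: "P \<in> D k \<Longrightarrow> \<exists>j\<le>k. \<exists>P'\<in>D j. P \<subseteq> P' \<and> ennreal M \<le> emeasure \<mu> P'"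
    and cover: "AE x in \<mu>. x \<in> \<Union>(D 0)"
    and differentiation_basis: "P0 \<in> D 0 \<Longrightarrow> A \<in> sets \<mu> \<Longrightarrow> A \<subseteq> P0 \<Longrightarrow> 0 < \<epsilon> \<Longrightarrow>
      \<exists>U\<in>sets \<mu>. A \<subseteq> U \<and> emeasure \<mu> U \<le> emeasure \<mu> A + ennreal \<epsilon> \<and>
        (AE x in \<mu>. x \<in> A \<longrightarrow> (\<exists>k. \<exists>P\<in>D k. x \<in> P \<and> P \<subseteq> U))"
begin

lemma nonempty_D: "P \<in> D k \<Longrightarrow> P \<noteq> {}"
  using pos_D by fastforce

lemma ancestor:
  assumes "P \<in> D k" "j \<le> k"
  shows "\<exists>P'\<in>D j. P \<subseteq> P'"
  using assms(2)
proof (induction rule: int_le_induct)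
  case base
  then show ?case using assms(1) by blast
next
  case (step i)
  then obtain P' where "P' \<in> D i" "P \<subseteq> P'" by blast
  moreover from this obtain P'' where "P'' \<in> D (i - 1)" "P' \<subseteq> P''"
    using parent[of P' "i - 1"] by auto
  ultimately show ?case by blast
qed

lemma nested:
  assumes "P \<in> D k" "P' \<in> D j" "j \<le> k" "P \<inter> P' \<noteq> {}"
  shows "P \<subseteq> P'"
proof -
  obtain P'' where "P'' \<in> D j" "P \<subseteq> P''" using ancestor assms by blast
  then have "P'' = P'" using disjoint_D[of j] assms by (auto simp: disjoint_def)
  then show ?thesis using \<open>P \<subseteq> P''\<close> by simp
qed

text \<open>The maximal members satisfying \<open>bad\<close>. Maximality is expressed through
  generations: for a set that occurs in several of them, the condition can hold only at the earliest
  one.\<close>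

definition sel :: "('a set \<Rightarrow> bool) \<Rightarrow> 'a set set" where
  "sel bad = {P. \<exists>k. P \<in> D k \<and> bad P \<and> (\<forall>j<k. \<forall>P'\<in>D j. P \<subseteq> P' \<longrightarrow> \<not> bad P')}"

lemma sel_D: "P \<in> sel bad \<Longrightarrow> P \<in> (\<Union>k. D k)" and sel_bad: "P \<in> sel bad \<Longrightarrow> bad P"
  by (auto simp: sel_def)

lemma countable_sel: "countable (sel bad)"
  by (rule countable_subset[of _ "\<Union>k. D k"]) (auto simp: sel_def countable_D)

lemma disjoint_sel: "disjoint (sel bad)"
proof -
  have *: "P = Q" if "P \<in> D k" "bad P" "\<forall>j<k. \<forall>P'\<in>D j. P \<subseteq> P' \<longrightarrow> \<not> bad P'"
    "Q \<in> D j" "bad Q" "j \<le> k" "P \<inter> Q \<noteq> {}" for P Q j k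
  proof (cases "j = k")
    case True
    then show ?thesis using that disjoint_D[of k] by (auto simp: disjoint_def)
  next
    case False
    then have "j < k" using that(6) by simp
    moreover have "P \<subseteq> Q" using nested[OF that(1,4,6,7)] .
    ultimately show ?thesis using that(3,4,5) by blast
  qed
  have "P = Q" if P: "P \<in> sel bad" and Q: "Q \<in> sel bad" and ne: "P \<inter> Q \<noteq> {}" for P Q
  proof -
    obtain k where k: "P \<in> D k" "bad P" "\<forall>j<k. \<forall>P'\<in>D j. P \<subseteq> P' \<longrightarrow> \<not> bad P'"
      using P by (auto simp: sel_def)
    obtain j where j: "Q \<in> D j" "bad Q" "\<forall>i<j. \<forall>P'\<in>D i. Q \<subseteq> P' \<longrightarrow> \<not> bad P'"
      using Q by (auto simp: sel_def)
    show ?thesis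
    proof (cases "j \<le> k")
      case True
      then show ?thesis using *[OF k j(1,2) _ ne] by simp
    next
      case False
      then show ?thesis using *[OF j k(1,2)] ne by (simp add: Int_commute)
    qed
  qed
  then show ?thesis unfolding disjoint_def by blast
qed

text \<open>Bad sets have measure at most \<open>M\<close>, whereas some ancestor \<open>P0\<close>
  of \<open>P\<close> is larger. So the bad sets containing \<open>P\<close> lie in the finitely
  many generations after that of \<open>P0\<close>, and there is a coarsest one.\<close>

lemma sel_cover:
  assumes bd: "\<And>P. bad P \<Longrightarrow> emeasure \<mu> P \<le> ennreal M" and P: "P \<in> D k" "bad P"
  obtains P' where "P' \<in> sel bad" "P \<subseteq> P'"
proof -
  \<comment> \<open>The threshold exceeds \<open>ennreal M\<close> also for negative
    \<open>M\<close>, where \<open>ennreal M\<close> is \<open>0\<close>.\<close>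
  obtain j0 P0 where j0: "j0 \<le> k" "P0 \<in> D j0" "P \<subseteq> P0" "ennreal (\<bar>M\<bar> + 1) \<le> emeasure \<mu> P0"
    using growing[OF P(1)] by blast
  define R where "R i \<longleftrightarrow> (\<exists>P'\<in>D (j0 + int i). P \<subseteq> P' \<and> bad P')" for i
  have above: "j0 < j" if "P' \<in> D j" "P \<subseteq> P'" "bad P'" for j P'
  proof (rule ccontr)
    assume "\<not> j0 < j"
    then have "j \<le> j0" by simp
    moreover have "P0 \<inter> P' \<noteq> {}" using j0(3) that(2) nonempty_D[OF P(1)] by blast
    ultimately have "P0 \<subseteq> P'" by (rule nested[OF j0(2) that(1)])
    then have "emeasure \<mu> P0 \<le> emeasure \<mu> P'" using sets_D that by (intro emeasure_mono) auto
    also have "\<dots> \<le> ennreal M" by (rule bd[OF that(3)])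
    finally have "ennreal (\<bar>M\<bar> + 1) \<le> ennreal M" by (rule order_trans[OF j0(4)])
    then show False by (cases "0 \<le> M") (auto simp: ennreal_le_iff ennreal_neg)
  qed
  have "R (nat (k - j0))" using P j0(1) by (auto simp: R_def)
  then have R: "R (LEAST i. R i)" by (rule LeastI)
  then obtain P' where P': "P' \<in> D (j0 + int (LEAST i. R i))" "P \<subseteq> P'" "bad P'"
    by (auto simp: R_def)
  have "\<not> bad P''" if "j < j0 + int (LEAST i. R i)" "P'' \<in> D j" "P' \<subseteq> P''" for j P''
  proof
    assume "bad P''"
    have "j0 < j" using above[OF that(2) _ \<open>bad P''\<close>] P'(2) that(3) by blast
    then have "R (nat (j - j0))" using that P' \<open>bad P''\<close> by (auto simp: R_def)
    then have "(LEAST i. R i) \<le> nat (j - j0)" by (rule Least_le)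
    then show False using that(1) \<open>j0 < j\<close> by linarith
  qed
  then have "P' \<in> sel bad" unfolding sel_def using P' by blast
  then show ?thesis using that P'(2) by blast
qed

lemma sel_parent:
  assumes "P \<in> sel bad"
  obtains k P' where "P' \<in> D k" "P \<subseteq> P'" "\<not> bad P'" "emeasure \<mu> P' \<le> ennreal C * emeasure \<mu> P"
proof -
  obtain k where k: "P \<in> D k" "\<forall>j<k. \<forall>P'\<in>D j. P \<subseteq> P' \<longrightarrow> \<not> bad P'"
    using assms by (auto simp: sel_def)
  then have "P \<in> D ((k - 1) + 1)" by simp
  from parent[OF this] obtain P' where P': "P' \<in> D (k - 1)" "P \<subseteq> P'" "emeasure \<mu> P' \<le> ennreal C * emeasure \<mu> P"
    by blast
  moreover have "\<not> bad P'" using k(2) P' by force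
  ultimately show ?thesis using that by blast
qed

lemma emeasure_Union_countable_le:
  assumes "countable F" "disjoint F" "F \<subseteq> sets N" "F \<subseteq> sets M" "\<And>P. P \<in> F \<Longrightarrow> emeasure N P \<le> a * emeasure M P"
  shows "emeasure N (\<Union>F) \<le> a * emeasure M (\<Union>F)"
proof -
  have d: "disjoint_family_on (\<lambda>P. P) F"
    using assms(2) by (auto simp: disjoint_family_on_def disjoint_def)
  have "emeasure N (\<Union>F) = (\<integral>\<^sup>+P. emeasure N P \<partial>count_space F)"
    using emeasure_UN_countable[of F "\<lambda>P. P" N, OF _ assms(1) d] assms(3) by (simp add: subset_iff)
  also have "\<dots> \<le> (\<integral>\<^sup>+P. a * emeasure M P \<partial>count_space F)"
    using assms(5) by (intro nn_integral_mono) auto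
  also have "\<dots> = a * (\<integral>\<^sup>+P. emeasure M P \<partial>count_space F)" by (intro nn_integral_cmult) auto
  also have "(\<integral>\<^sup>+P. emeasure M P \<partial>count_space F) = emeasure M (\<Union>F)"
    using emeasure_UN_countable[of F "\<lambda>P. P" M, OF _ assms(1) d] assms(4) by (simp add: subset_iff)
  finally show ?thesis .
qed

theorem stopping_family:
  fixes f :: "'a \<Rightarrow> 'b::{banach, second_countable_topology}"
  assumes f: "integrable \<mu> f" and \<alpha>: "0 < \<alpha>"
  obtains F where "countable F" "disjoint F" "F \<subseteq> (\<Union>k. D k)"
    "\<And>P. P \<in> F \<Longrightarrow> ennreal \<alpha> * emeasure \<mu> P \<le> emeasure (norm_density \<mu> f) P"
    "\<And>P. P \<in> F \<Longrightarrow> emeasure (norm_density \<mu> f) P \<le> ennreal (C * \<alpha>) * emeasure \<mu> P"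
    "AE x in \<mu>. x \<notin> \<Union>F \<longrightarrow> norm (f x) \<le> \<alpha>"
proof -
  have [measurable]: "f \<in> borel_measurable \<mu>" using f by simp
  define \<nu> where "\<nu> = norm_density \<mu> f"
  have [simp]: "sets \<nu> = sets \<mu>" "space \<nu> = space \<mu>" by (simp_all add: \<nu>_def)
  define bad where "bad P \<longleftrightarrow> P \<in> sets \<mu> \<and> ennreal \<alpha> * emeasure \<mu> P < emeasure \<nu> P" for P
  define F where "F = sel bad"
  have F_D: "F \<subseteq> (\<Union>k. D k)" unfolding F_def using sel_D by blast
  have F_sets: "F \<subseteq> sets \<mu>" using F_D sets_D by blast
  note tot = emeasure_norm_density_space[OF f, folded \<nu>_def]
  have bd: "emeasure \<mu> P \<le> ennreal ((LINT x|\<mu>. norm (f x)) / \<alpha>)" if "bad P" for P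
  proof -
    have "ennreal \<alpha> * emeasure \<mu> P \<le> emeasure \<nu> (space \<mu>)"
      using that emeasure_space[of \<nu> P] by (auto simp: bad_def)
    then have "(emeasure \<mu> P * ennreal \<alpha>) / ennreal \<alpha> \<le> ennreal (LINT x|\<mu>. norm (f x)) / ennreal \<alpha>"
      unfolding tot by (intro divide_right_mono_ennreal) (simp add: mult.commute)
    then show ?thesis using \<alpha> by (simp add: ennreal_mult_divide_eq divide_ennreal)
  qed
  \<comment> \<open>Inside one member \<open>P0\<close> of generation 0 the exceptional set
    \<open>A\<close> has finite measure \<open>a\<close>. The margin \<eta> then leads to
    \<open>(\<alpha> + \<eta>) * a \<le> \<alpha> * (a + \<epsilon>)\<close> for all positive
    \<epsilon>.\<close>
  have AE0: "AE x in \<mu>. x \<in> P0 \<longrightarrow> x \<notin> \<Union>F \<longrightarrow> norm (f x) < \<alpha> + \<eta>"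
    if \<eta>: "0 < \<eta>" and P0: "P0 \<in> D 0" for \<eta> P0
  proof -
    define A where "A = {x \<in> P0 - \<Union>F. \<alpha> + \<eta> \<le> norm (f x)}"
    have UF: "\<Union>F \<in> sets \<mu>"
      using F_sets countable_sel unfolding F_def by (intro sets.countable_Union) auto
    have "A = {x \<in> space \<mu>. \<alpha> + \<eta> \<le> norm (f x)} \<inter> P0 - \<Union>F"
      using sets.sets_into_space[OF sets_D[OF P0]] by (auto simp: A_def)
    then have A[measurable]: "A \<in> sets \<mu>" using UF sets_D[OF P0] by simp
    have A_P0: "A \<subseteq> P0" by (auto simp: A_def)
    have A_le: "ennreal (\<alpha> + \<eta>) * emeasure \<mu> A \<le> emeasure \<nu> A"
    proof -
      have "ennreal (\<alpha> + \<eta>) * emeasure \<mu> A = (\<integral>\<^sup>+x. ennreal (\<alpha> + \<eta>) * indicator A x \<partial>\<mu>)"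
        by (simp add: nn_integral_cmult_indicator)
      also have "\<dots> \<le> (\<integral>\<^sup>+x\<in>A. ennreal (norm (f x)) \<partial>\<mu>)"
        by (intro nn_integral_mono) (auto simp: A_def ennreal_leI split: split_indicator)
      finally show ?thesis by (simp add: \<nu>_def emeasure_norm_density[OF f A])
    qed
    have finA: "emeasure \<mu> A < \<infinity>"
      using emeasure_mono[OF A_P0 sets_D[OF P0]] fin_D[OF P0] by (rule le_less_trans)
    then obtain a where a: "emeasure \<mu> A = ennreal a" "0 \<le> a" by (cases "emeasure \<mu> A") auto
    have "(\<alpha> + \<eta>) * a \<le> \<alpha> * (a + \<epsilon>)" if \<epsilon>: "0 < \<epsilon>" for \<epsilon>
    proof -
      obtain U where U: "U \<in> sets \<mu>" "A \<subseteq> U" "emeasure \<mu> U \<le> emeasure \<mu> A + ennreal \<epsilon>"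
        "AE x in \<mu>. x \<in> A \<longrightarrow> (\<exists>k. \<exists>P\<in>D k. x \<in> P \<and> P \<subseteq> U)"
        using differentiation_basis[OF P0 A A_P0 \<epsilon>] by blast
      \<comment> \<open>The selection is used a second time, now for members inside \<open>U\<close>
        that meet \<open>A\<close>: the maximal ones are disjoint, stay in \<open>U\<close> and
        cover almost all of \<open>A\<close>.\<close>
      define bad2 where "bad2 P \<longleftrightarrow> P \<subseteq> U \<and> P \<inter> A \<noteq> {}" for P
      define F2 where "F2 = sel bad2"
      have bd2: "emeasure \<mu> P \<le> ennreal (a + \<epsilon>)" if "bad2 P" for P
      proof -
        have "emeasure \<mu> P \<le> emeasure \<mu> U" using that U(1) by (intro emeasure_mono) (auto simp: bad2_def)
        also have "\<dots> \<le> ennreal (a + \<epsilon>)" using U(3) a \<epsilon> by simp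
        finally show ?thesis .
      qed
      have F2: "countable F2" "disjoint F2" "F2 \<subseteq> sets \<mu>" "\<Union>F2 \<subseteq> U"
      proof -
        show "countable F2" "disjoint F2" unfolding F2_def by (rule countable_sel disjoint_sel)+
        show "F2 \<subseteq> sets \<mu>" unfolding F2_def using sel_D sets_D by blast
        show "\<Union>F2 \<subseteq> U" unfolding F2_def using sel_bad[of _ bad2] bad2_def by blast
      qed
      \<comment> \<open>A set in \<open>F2\<close> with too large an average would lie in some
        member of \<open>F\<close>, but it meets \<open>A\<close>, which avoids the union of
        \<open>F\<close>.\<close>
      have good: "emeasure \<nu> P \<le> ennreal \<alpha> * emeasure \<mu> P" if "P \<in> F2" for P
      proof (rule ccontr)
        assume "\<not> ?thesis"
        then have "bad P" using that F2(3) by (auto simp: bad_def)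
        moreover obtain k where "P \<in> D k" using sel_D[of P bad2] \<open>P \<in> F2\<close> unfolding F2_def by auto
        ultimately obtain P' where "P' \<in> F" "P \<subseteq> P'"
          using sel_cover[of bad, OF bd] unfolding F_def by blast
        moreover have "P \<inter> A \<noteq> {}" using that sel_bad[of P bad2] by (auto simp: F2_def bad2_def)
        ultimately show False by (auto simp: A_def)
      qed
      have "emeasure \<nu> A \<le> emeasure \<nu> (\<Union>F2)"
      proof (rule emeasure_mono_AE)
        have "AE x in \<mu>. x \<in> A \<longrightarrow> x \<in> \<Union>F2"
          using U(4)
        proof eventually_elim
          case (elim x)
          show ?case
          proof
            assume "x \<in> A"
            with elim obtain k P where P: "P \<in> D k" "x \<in> P" "P \<subseteq> U" by blast
            then have "bad2 P" using \<open>x \<in> A\<close> by (auto simp: bad2_def)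
            then obtain P' where "P' \<in> F2" "P \<subseteq> P'"
              using sel_cover[of bad2, OF bd2 P(1)] unfolding F2_def by blast
            then show "x \<in> \<Union>F2" using P(2) by blast
          qed
        qed
        then show "AE x in \<nu>. x \<in> A \<longrightarrow> x \<in> \<Union>F2"
          unfolding \<nu>_def norm_density_def by (subst AE_density) auto
        show "\<Union>F2 \<in> sets \<nu>" using F2 by (simp add: sets.countable_Union)
      qed
      also have "\<dots> \<le> ennreal \<alpha> * emeasure \<mu> (\<Union>F2)"
        using F2 good by (intro emeasure_Union_countable_le) auto
      also have "\<dots> \<le> ennreal \<alpha> * emeasure \<mu> U"
        using F2 U(1) by (intro mult_left_mono emeasure_mono) auto
      also have "\<dots> \<le> ennreal \<alpha> * ennreal (a + \<epsilon>)"
        using U(3) a \<epsilon> by (intro mult_left_mono) simp_all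
      finally have "ennreal (\<alpha> + \<eta>) * ennreal a \<le> ennreal \<alpha> * ennreal (a + \<epsilon>)"
        using A_le a(1) by (metis order_trans)
      then have "ennreal ((\<alpha> + \<eta>) * a) \<le> ennreal (\<alpha> * (a + \<epsilon>))"
        using \<alpha> \<eta> a(2) by (simp add: ennreal_mult')
      then show ?thesis using \<alpha> \<eta> \<epsilon> a(2) by (subst (asm) ennreal_le_iff) auto
    qed
    \<comment> \<open>With this \<epsilon> the inequality becomes
      \<open>\<eta> * a \<le> \<eta> * a / 2\<close>. The chosen \<epsilon> is positive unless
      \<open>a\<close> is already \<open>0\<close>.\<close>
    from this[of "\<eta> * a / (2 * \<alpha>)"] have "a = 0"
      using \<alpha> \<eta> a(2) by (cases "a = 0") (auto simp: field_simps)
    then have "A \<in> null_sets \<mu>" using a by (auto intro!: null_setsI)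
    from AE_not_in[OF this] show ?thesis
      by (rule AE_mp) (auto intro!: AE_I2 simp: A_def not_le)
  qed
  have "AE x in \<mu>. \<forall>n::nat. \<forall>P0\<in>D 0. x \<in> P0 \<longrightarrow> x \<notin> \<Union>F \<longrightarrow> norm (f x) < \<alpha> + 1 / Suc n"
    unfolding AE_all_countable AE_ball_countable[OF countable_D] by (intro allI ballI AE0) simp_all
  with cover have "AE x in \<mu>. x \<notin> \<Union>F \<longrightarrow> norm (f x) \<le> \<alpha>"
  proof eventually_elim
    case (elim x)
    show ?case
    proof (rule impI, rule field_le_epsilon)
      fix e :: real assume "x \<notin> \<Union>F" "0 < e"
      obtain n where "1 / real (Suc n) < e" using \<open>0 < e\<close> by (rule nat_approx_posE)
      moreover have "norm (f x) < \<alpha> + 1 / real (Suc n)" using elim \<open>x \<notin> \<Union>F\<close> by blast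
      ultimately show "norm (f x) \<le> \<alpha> + e" by linarith
    qed
  qed
  moreover have "emeasure \<nu> P \<le> ennreal (C * \<alpha>) * emeasure \<mu> P" if "P \<in> F" for P
  proof -
    obtain k P' where P': "P' \<in> D k" "P \<subseteq> P'" "\<not> bad P'" "emeasure \<mu> P' \<le> ennreal C * emeasure \<mu> P"
      using sel_parent \<open>P \<in> F\<close> unfolding F_def by blast
    have "emeasure \<nu> P \<le> emeasure \<nu> P'" using P' sets_D by (intro emeasure_mono) auto
    also have "\<dots> \<le> ennreal \<alpha> * emeasure \<mu> P'" using P' sets_D by (auto simp: bad_def)
    also have "\<dots> \<le> ennreal \<alpha> * (ennreal C * emeasure \<mu> P)" using P'(4) by (intro mult_left_mono) auto
    also have "\<dots> = ennreal (C * \<alpha>) * emeasure \<mu> P"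
      using C_ge_1 \<alpha> by (simp add: ennreal_mult' mult_ac)
    finally show ?thesis .
  qed
  moreover have "ennreal \<alpha> * emeasure \<mu> P \<le> emeasure \<nu> P" if "P \<in> F" for P
    using sel_bad[of P bad] that unfolding F_def by (auto simp: bad_def)
  moreover have "countable F" "disjoint F" unfolding F_def by (rule countable_sel disjoint_sel)+
  ultimately show ?thesis using that[of F] F_D unfolding \<nu>_def by simp
qed

end

lemma infsum_ennreal_le:
  fixes h :: "'i \<Rightarrow> ennreal"
  assumes "\<And>I. finite I \<Longrightarrow> I \<subseteq> J \<Longrightarrow> sum h I \<le> b"
  shows "infsum h J \<le> b"
  by (rule infsum_le_finite_sums) (auto intro: nonneg_summable_on_complete assms)

text \<open>The factor \<open>2\<close> in the bound on the measures of the sets in \<open>H\<close> leaves room for one set more than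
  the stopping family \<open>F\<close>, on which \<open>b = 0\<close>.\<close>

lemma cz_decomposition_of_stopping_family:
  fixes f :: "'a \<Rightarrow> complex" and K K' C \<alpha> :: real
  assumes f: "integrable \<mu> f" and \<alpha>: "0 < \<alpha>" and pos: "0 \<le> K" "0 \<le> K'" "0 \<le> C"
    and F: "F \<subseteq> H" "disjoint F" and H: "countable H"
    and sets: "\<And>P. P \<in> H \<Longrightarrow> P \<in> sets \<mu>"
    and mpos: "\<And>P. P \<in> H \<Longrightarrow> 0 < emeasure \<mu> P" and mfin: "\<And>P. P \<in> H \<Longrightarrow> emeasure \<mu> P < \<infinity>"
    and balls: "\<And>P. P \<in> H \<Longrightarrow> \<exists>r>0. \<exists>x\<in>space \<mu>. P \<subseteq> dball d (space \<mu>) x (K * r) \<and>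
        star_set d (space \<mu>) P r \<in> sets \<mu> \<and>
        emeasure \<mu> (star_set d (space \<mu>) P r) \<le> ennreal K' * emeasure \<mu> P"
    and avg: "\<And>P. P \<in> F \<Longrightarrow> emeasure (norm_density \<mu> f) P \<le> ennreal (C * \<alpha>) * emeasure \<mu> P"
    and off: "AE x in \<mu>. x \<notin> \<Union>F \<longrightarrow> norm (f x) \<le> \<alpha>"
    and total: "\<And>I. finite I \<Longrightarrow> I \<subseteq> H \<Longrightarrow> (\<Sum>P\<in>I. emeasure \<mu> P) \<le> ennreal (2 / \<alpha> * (LINT x|\<mu>. norm (f x)))"
  shows "\<exists>J E r x g b. H = E ` J \<and> cz_decomposition d \<mu> (2 + C + K + 2 * K') f \<alpha> J E r x g b"
proof -
  have [measurable]: "f \<in> borel_measurable \<mu>" using f by simp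
  define J where "J = to_nat_on H ` H"
  define E where "E = from_nat_into H"
  have E_inj: "inj_on E J" unfolding J_def E_def using H
    by (intro inj_onI) auto
  have E_img: "E ` J = H" unfolding J_def E_def using H by (auto simp: image_image)
  have EH: "E j \<in> H" if "j \<in> J" for j using that E_img by blast
  obtain r0 x0 where rx: "\<And>P. P \<in> H \<Longrightarrow> 0 < r0 P \<and> x0 P \<in> space \<mu> \<and>
     P \<subseteq> dball d (space \<mu>) (x0 P) (K * r0 P) \<and> star_set d (space \<mu>) P (r0 P) \<in> sets \<mu> \<and>
     emeasure \<mu> (star_set d (space \<mu>) P (r0 P)) \<le> ennreal K' * emeasure \<mu> P"
    using balls by metis
  define I0 where "I0 = {j\<in>J. E j \<in> F}"
  define av where "av P = (LINT y:P|\<mu>. f y) / complex_of_real (measure \<mu> P)" for P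
  define b where "b j y = (if j \<in> I0 then indicator (E j) y *\<^sub>R (f y - av (E j)) else 0)" for j y
  \<comment> \<open>An ordinary series over all indices makes \<open>g\<close> measurable at once.
    At each point at most one term is nonzero, so by \<open>b_at\<close> and \<open>b_off\<close> it
    agrees with the unordered sum over \<open>J\<close>.\<close>
  define g where "g y = f y - (\<Sum>j. b j y)" for y
  have EI0: "E j \<in> sets \<mu>" if "j \<in> I0" for j using that EH sets by (auto simp: I0_def)
  have b_meas [measurable]: "b j \<in> borel_measurable \<mu>" for j
  proof (cases "j \<in> I0")
    case True
    then have [measurable]: "E j \<in> sets \<mu>" by (rule EI0)
    show ?thesis using True unfolding b_def[abs_def] by simp
  qed (simp add: b_def[abs_def])
  have g_meas: "g \<in> borel_measurable \<mu>" unfolding g_def by measurable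
  have unique: "j = i" if "y \<in> E j" "y \<in> E i" "j \<in> I0" "i \<in> I0" for i j y
  proof -
    have "E j = E i" using that F(2) unfolding I0_def disjoint_def by blast
    then show ?thesis using E_inj that by (auto simp: I0_def inj_on_def)
  qed
  have b_at: "(\<Sum>j. b j y) = b i y \<and> (\<lambda>j. b j y) summable_on J \<and> (\<Sum>\<^sub>\<infinity>j\<in>J. b j y) = b i y"
    if "i \<in> I0" "y \<in> E i" for i y
  proof -
    have z: "b j y = 0" if "j \<noteq> i" for j
      using that unique[of y j i] \<open>i \<in> I0\<close> \<open>y \<in> E i\<close> by (auto simp: b_def indicator_def)
    have "(\<Sum>j. b j y) = (\<Sum>j\<in>{i}. b j y)" by (rule suminf_finite) (auto simp: z)
    moreover have "((\<lambda>j. b j y) has_sum b i y) J"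
      by (rule has_sum_finite_neutralI[of "{i}"]) (use that z in \<open>auto simp: I0_def\<close>)
    ultimately show ?thesis by (auto simp: summable_on_def infsumI)
  qed
  have b_off: "(\<Sum>j. b j y) = 0 \<and> (\<lambda>j. b j y) summable_on J \<and> (\<Sum>\<^sub>\<infinity>j\<in>J. b j y) = 0"
    if "y \<notin> \<Union>F" for y
  proof -
    have "b j y = 0" for j using that by (auto simp: b_def I0_def)
    then show ?thesis by simp
  qed
  have I0_F: "\<exists>i\<in>I0. y \<in> E i" if "y \<in> \<Union>F" for y
    using that F(1) E_img unfolding I0_def by blast
  have fin_m: "emeasure \<mu> (E j) = ennreal (measure \<mu> (E j))" if "j \<in> J" for j
    using mfin[OF EH[OF that]] by (intro emeasure_eq_ennreal_measure) auto
  have pos_m: "0 < measure \<mu> (E j)" if "j \<in> J" for j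
    using mpos[OF EH[OF that]] fin_m[OF that] by (simp add: zero_less_iff_neq_zero less_le)
  have int_E: "set_integrable \<mu> (E j) f" if "j \<in> J" for j
    using f sets[OF EH[OF that]] unfolding set_integrable_def by (intro integrable_mult_indicator)
  define \<nu> where "\<nu> = norm_density \<mu> f"
  have [simp]: "sets \<nu> = sets \<mu>" "space \<nu> = space \<mu>" by (simp_all add: \<nu>_def)
  note \<nu> = emeasure_norm_density[OF f, folded \<nu>_def] and tot = emeasure_norm_density_space[OF f, folded \<nu>_def]
  have LE: "ennreal (norm (LINT y:E j|\<mu>. f y)) \<le> emeasure \<nu> (E j)" if "j \<in> J" for j
  proof -
    have "ennreal (norm (LINT y:E j|\<mu>. f y)) \<le> (\<integral>\<^sup>+x. norm (indicator (E j) x *\<^sub>R f x) \<partial>\<mu>)"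
      unfolding set_lebesgue_integral_def using int_E[OF that] unfolding set_integrable_def
      by (rule integral_norm_bound_ennreal)
    also have "\<dots> = emeasure \<nu> (E j)"
      unfolding \<nu>[OF sets[OF EH[OF that]]] by (intro nn_integral_cong) (auto split: split_indicator)
    finally show ?thesis .
  qed
  have av_eq: "norm (av (E j)) * measure \<mu> (E j) = norm (LINT y:E j|\<mu>. f y)" if "j \<in> J" for j
    using pos_m[OF that] by (simp add: av_def norm_divide)
  have av_le: "norm (av (E j)) \<le> C * \<alpha>" if "j \<in> I0" for j
  proof -
    have j: "j \<in> J" "E j \<in> F" using that by (auto simp: I0_def)
    have "ennreal (norm (av (E j)) * measure \<mu> (E j)) \<le> ennreal (C * \<alpha>) * ennreal (measure \<mu> (E j))"
      using LE[OF j(1)] avg[OF j(2), folded \<nu>_def] fin_m[OF j(1)] unfolding av_eq[OF j(1)] by (metis order_trans)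
    then have "ennreal (norm (av (E j)) * measure \<mu> (E j)) \<le> ennreal (C * \<alpha> * measure \<mu> (E j))"
      using pos \<alpha> by (simp add: ennreal_mult')
    then have "norm (av (E j)) * measure \<mu> (E j) \<le> C * \<alpha> * measure \<mu> (E j)"
      using pos \<alpha> by (subst (asm) ennreal_le_iff) auto
    then show ?thesis using pos_m[OF j(1)] by simp
  qed
  have b_int: "integrable \<mu> (b j)" and b_mean: "(LINT y:E j|\<mu>. b j y) = 0" if "j \<in> J" for j
  proof -
    show "integrable \<mu> (b j)"
    proof (cases "j \<in> I0")
      case True
      have "set_integrable \<mu> (E j) (\<lambda>y. f y - av (E j))"
        using int_E[OF that] mfin[OF EH[OF that]] sets[OF EH[OF that]]
        by (intro set_integral_diff) (auto simp: set_integrable_def)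
      then show ?thesis using True by (simp add: b_def[abs_def] set_integrable_def)
    qed (simp add: b_def[abs_def])
    show "(LINT y:E j|\<mu>. b j y) = 0"
    proof (cases "j \<in> I0")
      case True
      have "(LINT y:E j|\<mu>. b j y) = (LINT y:E j|\<mu>. f y - av (E j))"
        unfolding set_lebesgue_integral_def using True
        by (intro Bochner_Integration.integral_cong) (auto simp: b_def split: split_indicator)
      also have "\<dots> = (LINT y:E j|\<mu>. f y) - (LINT y:E j|\<mu>. av (E j))"
        using int_E[OF that] mfin[OF EH[OF that]] sets[OF EH[OF that]]
        by (intro set_integral_diff) (auto simp: set_integrable_def)
      also have "(LINT y:E j|\<mu>. av (E j)) = measure \<mu> (E j) *\<^sub>R av (E j)"
        using sets[OF EH[OF that]] mfin[OF EH[OF that]] by (simp add: set_lebesgue_integral_def)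
      also have "\<dots> = (LINT y:E j|\<mu>. f y)"
        using pos_m[OF that] by (simp add: av_def scaleR_conv_of_real)
      finally show ?thesis by simp
    qed (simp add: b_def[abs_def])
  qed
  \<comment> \<open>The factor \<open>2\<close> comes from \<open>f\<close> and its average: each
    contributes at most the integral of \<open>|f|\<close> over \<open>E j\<close>.\<close>
  have norm_b: "ennreal (LINT y|\<mu>. norm (b j y)) \<le> 2 * emeasure \<nu> (E j)" if "j \<in> I0" for j
  proof -
    have j: "j \<in> J" using that by (auto simp: I0_def)
    have [measurable]: "E j \<in> sets \<mu>" using that by (rule EI0)
    have "ennreal (LINT y|\<mu>. norm (b j y)) = (\<integral>\<^sup>+y. ennreal (norm (b j y)) \<partial>\<mu>)"
      using b_int[OF j] by (intro nn_integral_eq_integral[symmetric]) auto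
    also have "\<dots> \<le> (\<integral>\<^sup>+y. ennreal (norm (f y)) * indicator (E j) y + ennreal (norm (av (E j))) * indicator (E j) y \<partial>\<mu>)"
    proof (intro nn_integral_mono)
      fix y
      have "ennreal (norm (f y - av (E j))) \<le> ennreal (norm (f y)) + ennreal (norm (av (E j)))"
        using norm_triangle_ineq4[of "f y" "av (E j)"] by (simp add: ennreal_leI flip: ennreal_plus)
      then show "ennreal (norm (b j y)) \<le> ennreal (norm (f y)) * indicator (E j) y + ennreal (norm (av (E j))) * indicator (E j) y"
        using that by (auto simp: b_def split: split_indicator)
    qed
    also have "\<dots> = emeasure \<nu> (E j) + ennreal (norm (av (E j))) * emeasure \<mu> (E j)"
      by (subst nn_integral_add) (auto simp: \<nu> nn_integral_cmult_indicator)
    also have "ennreal (norm (av (E j))) * emeasure \<mu> (E j) = ennreal (norm (LINT y:E j|\<mu>. f y))"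
      unfolding fin_m[OF j] av_eq[OF j, symmetric] by (simp add: ennreal_mult')
    also have "\<dots> \<le> emeasure \<nu> (E j)" by (rule LE[OF j])
    finally show ?thesis by (simp add: mult_2)
  qed
  \<comment> \<open>One constant for all requirements: \<open>2\<close> for the norms of the
    \<open>b j\<close>, \<open>1\<close> and \<open>C\<close> for \<open>g\<close> off and on the
    stopping family, \<open>K\<close> for the enclosing balls, and \<open>2 * K'\<close> for the
    stars.\<close>
  define C0 where "C0 = 2 + C + K + 2 * K'"
  have C0: "2 \<le> C0" "1 \<le> C0" "C \<le> C0" "K \<le> C0" "2 * K' \<le> C0" using pos by (auto simp: C0_def)
  have L0: "0 \<le> (LINT x|\<mu>. norm (f x))" by simp
  have sum_b: "(\<Sum>\<^sub>\<infinity>j\<in>J. ennreal (LINT y|\<mu>. norm (b j y))) \<le> ennreal (C0 * (LINT y|\<mu>. norm (f y)))"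
  proof (rule infsum_ennreal_le)
    fix I assume I: "finite I" "I \<subseteq> J"
    have "(\<Sum>j\<in>I. ennreal (LINT y|\<mu>. norm (b j y))) = (\<Sum>j\<in>I \<inter> I0. ennreal (LINT y|\<mu>. norm (b j y)))"
      using I by (intro sum.mono_neutral_right) (auto simp: b_def)
    also have "\<dots> \<le> (\<Sum>j\<in>I \<inter> I0. 2 * emeasure \<nu> (E j))" by (intro sum_mono norm_b) auto
    also have "\<dots> = 2 * (\<Sum>j\<in>I \<inter> I0. emeasure \<nu> (E j))" by (simp add: sum_distrib_left)
    also have "(\<Sum>j\<in>I \<inter> I0. emeasure \<nu> (E j)) = emeasure \<nu> (\<Union>j\<in>I \<inter> I0. E j)"
      using I EI0 unique by (intro sum_emeasure) (auto simp: disjoint_family_on_def)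
    also have "\<dots> \<le> emeasure \<nu> (space \<mu>)" using emeasure_space[of \<nu>] by simp
    also have "2 * emeasure \<nu> (space \<mu>) = ennreal (2 * (LINT y|\<mu>. norm (f y)))"
      unfolding tot using L0 by (simp add: ennreal_mult)
    also have "\<dots> \<le> ennreal (C0 * (LINT y|\<mu>. norm (f y)))"
      using C0(1) L0 by (intro ennreal_leI mult_right_mono)
    finally show "(\<Sum>j\<in>I. ennreal (LINT y|\<mu>. norm (b j y))) \<le> ennreal (C0 * (LINT y|\<mu>. norm (f y)))"
      by (simp add: mult_left_mono)
  qed
  have sum_star: "(\<Sum>\<^sub>\<infinity>j\<in>J. emeasure \<mu> (star_set d (space \<mu>) (E j) (r0 (E j))))
      \<le> ennreal (C0 / \<alpha> * (LINT y|\<mu>. norm (f y)))"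
  proof (rule infsum_ennreal_le)
    fix I assume I: "finite I" "I \<subseteq> J"
    have "(\<Sum>j\<in>I. emeasure \<mu> (star_set d (space \<mu>) (E j) (r0 (E j)))) \<le> (\<Sum>j\<in>I. ennreal K' * emeasure \<mu> (E j))"
      using I rx EH by (intro sum_mono) blast
    also have "\<dots> = ennreal K' * (\<Sum>P\<in>E ` I. emeasure \<mu> P)"
      using E_inj I by (subst sum.reindex) (auto simp: sum_distrib_left inj_on_subset)
    also have "\<dots> \<le> ennreal K' * ennreal (2 / \<alpha> * (LINT y|\<mu>. norm (f y)))"
      using I EH by (intro mult_left_mono total) auto
    also have "\<dots> = ennreal (K' * (2 / \<alpha> * (LINT y|\<mu>. norm (f y))))"
      using pos by (simp only: ennreal_mult')
    also have "\<dots> \<le> ennreal (C0 / \<alpha> * (LINT y|\<mu>. norm (f y)))"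
    proof (intro ennreal_leI)
      have "2 * K' / \<alpha> * (LINT y|\<mu>. norm (f y)) \<le> C0 / \<alpha> * (LINT y|\<mu>. norm (f y))"
        using C0(5) \<alpha> L0 by (intro mult_right_mono divide_right_mono) auto
      then show "K' * (2 / \<alpha> * (LINT y|\<mu>. norm (f y))) \<le> C0 / \<alpha> * (LINT y|\<mu>. norm (f y))"
        by (simp add: mult_ac)
    qed
    finally show "(\<Sum>j\<in>I. emeasure \<mu> (star_set d (space \<mu>) (E j) (r0 (E j))))
      \<le> ennreal (C0 / \<alpha> * (LINT y|\<mu>. norm (f y)))" .
  qed
  have dec: "(\<lambda>j. b j y) summable_on J \<and> f y = g y + (\<Sum>\<^sub>\<infinity>j\<in>J. b j y)" for y
  proof (cases "y \<in> \<Union>F")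
    case True
    then obtain i where "i \<in> I0" "y \<in> E i" using I0_F by blast
    then show ?thesis using b_at by (simp add: g_def)
  next
    case False
    then show ?thesis using b_off by (simp add: g_def)
  qed
  have dec': "AE y in \<mu>. (\<lambda>j. b j y) summable_on J \<and> f y = g y + (\<Sum>\<^sub>\<infinity>j\<in>J. b j y)"
    using dec by (intro AE_I2)
  have g_le: "AE y in \<mu>. norm (g y) \<le> C0 * \<alpha>"
    using off
  proof eventually_elim
    case (elim y)
    show ?case
    proof (cases "y \<in> \<Union>F")
      case True
      then obtain i where i: "i \<in> I0" "y \<in> E i" using I0_F by blast
      have "g y = av (E i)" using b_at[OF i] i by (simp add: g_def b_def)
      then have "norm (g y) \<le> C * \<alpha>" using av_le[OF i(1)] by simp
      also have "\<dots> \<le> C0 * \<alpha>" using C0 \<alpha> by simp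
      finally show ?thesis .
    next
      case False
      then have "norm (g y) \<le> 1 * \<alpha>" using b_off elim by (simp add: g_def)
      also have "\<dots> \<le> C0 * \<alpha>" using C0 \<alpha> by simp
      finally show ?thesis .
    qed
  qed
  have "cz_decomposition d \<mu> C0 f \<alpha> J E (\<lambda>j. r0 (E j)) (\<lambda>j. x0 (E j)) g b"
    unfolding cz_decomposition_def
  proof (intro conjI ballI g_meas dec' g_le sum_b sum_star)
    fix j assume j: "j \<in> J"
    show "E j \<in> sets \<mu>" "0 < r0 (E j)" "x0 (E j) \<in> space \<mu>"
      "star_set d (space \<mu>) (E j) (r0 (E j)) \<in> sets \<mu>"
      using rx[OF EH[OF j]] sets[OF EH[OF j]] by auto
    show "integrable \<mu> (b j)" "(LINT y:E j|\<mu>. b j y) = 0" using b_int b_mean j by auto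
    show "b j y = 0" if "y \<in> space \<mu> - E j" for y using that by (auto simp: b_def)
    have "ennreal (K * r0 (E j)) \<le> ennreal (C0 * r0 (E j))"
      using C0 rx[OF EH[OF j]] by (intro ennreal_leI mult_right_mono) auto
    then show "E j \<subseteq> dball d (space \<mu>) (x0 (E j)) (C0 * r0 (E j))"
      using rx[OF EH[OF j]] unfolding dball_def by (auto intro: less_le_trans)
  qed
  then show ?thesis unfolding C0_def using E_img by blast
qed

theorem (in nested_basis) CZP_wrt_nested_basis:
  fixes K K' :: real
  assumes pos: "0 \<le> K" "0 \<le> K'" and ne: "D k0 \<noteq> {}"
    and balls: "\<And>P k. P \<in> D k \<Longrightarrow> \<exists>r>0. \<exists>x\<in>space \<mu>. P \<subseteq> dball d (space \<mu>) x (K * r) \<and>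
        star_set d (space \<mu>) P r \<in> sets \<mu> \<and>
        emeasure \<mu> (star_set d (space \<mu>) P r) \<le> ennreal K' * emeasure \<mu> P"
  shows "CZP_wrt d \<mu> (\<Union>k. D k)"
proof -
  let ?C0 = "2 + C + K + 2 * K'"
  \<comment> \<open>The last clause puts every member of the family into some
    \<open>EE f \<alpha>\<close>. This turns the inclusion of the chosen families in the union of
    the \<open>D k\<close> into the equality that \<open>CZP_wrt\<close> demands.\<close>
  define Q where "Q f \<alpha> H \<longleftrightarrow> H \<subseteq> (\<Union>k. D k) \<and>
     (\<exists>J E r x g b. H = E ` J \<and> cz_decomposition d \<mu> ?C0 f \<alpha> J E r x g b) \<and>
     (\<forall>P\<in>(\<Union>k. D k). f = (indicator P :: 'a \<Rightarrow> complex) \<and> \<alpha> = 1 \<longrightarrow> P \<in> H)" for f \<alpha> H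
  have ex: "\<exists>H. Q f \<alpha> H" if f: "integrable \<mu> f" and \<alpha>: "0 < \<alpha>" for f :: "'a \<Rightarrow> complex" and \<alpha>
  proof -
    obtain F where F: "countable F" "disjoint F" "F \<subseteq> (\<Union>k. D k)"
      "\<And>P. P \<in> F \<Longrightarrow> ennreal \<alpha> * emeasure \<mu> P \<le> emeasure (norm_density \<mu> f) P"
      "\<And>P. P \<in> F \<Longrightarrow> emeasure (norm_density \<mu> f) P \<le> ennreal (C * \<alpha>) * emeasure \<mu> P"
      "AE x in \<mu>. x \<notin> \<Union>F \<longrightarrow> norm (f x) \<le> \<alpha>"
    proof (rule stopping_family[OF f \<alpha>], goal_cases)
      case (1 F)
      show ?case by (rule 1(1)[of F]) (use 1 in auto)
    qed
    have [measurable]: "f \<in> borel_measurable \<mu>" using f by simp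
    have Fsets: "F \<subseteq> sets \<mu>" using F(3) sets_D by blast
    let ?L = "LINT x|\<mu>. norm (f x)"
    have Fsum: "(\<Sum>P\<in>I. emeasure \<mu> P) \<le> ennreal (1 / \<alpha> * ?L)" if I: "finite I" "I \<subseteq> F" for I
    proof -
      let ?\<nu> = "norm_density \<mu> f"
      have "ennreal \<alpha> * (\<Sum>P\<in>I. emeasure \<mu> P) = (\<Sum>P\<in>I. ennreal \<alpha> * emeasure \<mu> P)"
        by (simp add: sum_distrib_left)
      also have "\<dots> \<le> (\<Sum>P\<in>I. emeasure ?\<nu> P)" using F(4) I(2) by (intro sum_mono) auto
      also have "\<dots> = emeasure ?\<nu> (\<Union>P\<in>I. P)"
      proof (rule sum_emeasure)
        show "disjoint_family_on (\<lambda>P. P) I"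
          using I F(2) unfolding disjoint_family_on_def disjoint_def by blast
      qed (use I Fsets in auto)
      also have "\<dots> \<le> emeasure ?\<nu> (space \<mu>)" using emeasure_space[of ?\<nu>] by simp
      also have "\<dots> = ennreal ?L" by (rule emeasure_norm_density_space[OF f])
      finally have "((\<Sum>P\<in>I. emeasure \<mu> P) * ennreal \<alpha>) / ennreal \<alpha> \<le> ennreal ?L / ennreal \<alpha>"
        by (intro divide_right_mono_ennreal) (simp add: mult.commute)
      then show ?thesis using \<alpha> by (simp add: ennreal_mult_divide_eq divide_ennreal)
    qed
    have L0: "0 \<le> ?L" by simp
    define H where "H = F \<union> {P \<in> (\<Union>k. D k). f = (indicator P :: 'a \<Rightarrow> complex) \<and> \<alpha> = 1}"
    \<comment> \<open>An indicator function determines its set, so at most one set is added to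
      \<open>F\<close>. Its measure is the norm of \<open>f\<close> and \<alpha> is
      \<open>1\<close>, so it costs no more than the bound for \<open>F\<close> itself.\<close>
    have HF: "\<exists>P0. H \<subseteq> insert P0 F \<and> emeasure \<mu> P0 \<le> ennreal (1 / \<alpha> * ?L)"
    proof (cases "\<exists>P\<in>(\<Union>k. D k). f = (indicator P :: 'a \<Rightarrow> complex) \<and> \<alpha> = 1")
      case True
      then obtain P k where P: "P \<in> D k" "f = (indicator P :: 'a \<Rightarrow> complex)" "\<alpha> = 1" by blast
      have "P' = P" if "f = (indicator P' :: 'a \<Rightarrow> complex)" for P'
        using that P(2) by (metis indicator_eq_1_iff subsetI subset_antisym)
      then have "H \<subseteq> insert P F" by (auto simp: H_def)
      moreover have "?L = measure \<mu> P"
      proof -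
        have "?L = (LINT x|\<mu>. indicator P x)"
          unfolding P(2) by (intro Bochner_Integration.integral_cong) (auto split: split_indicator)
        then show ?thesis using sets_D[OF P(1)] by (simp add: sets.Int_space_eq2)
      qed
      then have "emeasure \<mu> P \<le> ennreal (1 / \<alpha> * ?L)"
        using P(3) fin_D[OF P(1)] by (simp add: emeasure_eq_ennreal_measure)
      ultimately show ?thesis by blast
    next
      case False
      then have "H \<subseteq> insert {} F" by (auto simp: H_def)
      then show ?thesis by (intro exI[of _ "{}"]) simp
    qed
    then obtain P0 where P0: "H \<subseteq> insert P0 F" "emeasure \<mu> P0 \<le> ennreal (1 / \<alpha> * ?L)" by blast
    have H_D: "H \<subseteq> (\<Union>k. D k)" using F(3) by (auto simp: H_def)
    have "\<exists>J E r x g b. H = E ` J \<and> cz_decomposition d \<mu> ?C0 f \<alpha> J E r x g b"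
    proof (rule cz_decomposition_of_stopping_family[OF f \<alpha> pos _ _ F(2)])
      show "0 \<le> C" using C_ge_1 by simp
      show "F \<subseteq> H" by (simp add: H_def)
      show "countable H" using P0(1) F(1) countable_subset countable_insert by metis
      show "P \<in> sets \<mu>" "0 < emeasure \<mu> P" "emeasure \<mu> P < \<infinity>" if "P \<in> H" for P
        using that H_D sets_D pos_D fin_D by blast+
      show "(\<Sum>P\<in>I. emeasure \<mu> P) \<le> ennreal (2 / \<alpha> * ?L)" if I: "finite I" "I \<subseteq> H" for I
      proof -
        have "(\<Sum>P\<in>I. emeasure \<mu> P) \<le> (\<Sum>P\<in>insert P0 (I \<inter> F). emeasure \<mu> P)"
          using I P0(1) by (intro sum_mono2) auto
        also have "\<dots> \<le> emeasure \<mu> P0 + (\<Sum>P\<in>I \<inter> F. emeasure \<mu> P)"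
          using I by (cases "P0 \<in> I \<inter> F") (auto simp: insert_absorb)
        also have "\<dots> \<le> ennreal (1 / \<alpha> * ?L) + ennreal (1 / \<alpha> * ?L)"
          using I by (intro add_mono P0 Fsum) auto
        also have "\<dots> = ennreal (2 / \<alpha> * ?L)" using \<alpha> L0 by (simp flip: ennreal_plus)
        finally show ?thesis .
      qed
      show "AE x in \<mu>. x \<notin> \<Union>F \<longrightarrow> norm (f x) \<le> \<alpha>" by (rule F(6))
    qed (use H_D balls F(5) in blast)+
    then have "Q f \<alpha> H" unfolding Q_def using H_D by (auto simp: H_def)
    then show ?thesis by blast
  qed
  define EE where "EE f \<alpha> = (SOME H. Q f \<alpha> H)" for f \<alpha>
  have Q: "Q f \<alpha> (EE f \<alpha>)" if "integrable \<mu> f" "0 < \<alpha>" for f \<alpha>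
    unfolding EE_def using ex[OF that] by (rule someI_ex)
  have "emeasure \<mu> (space \<mu>) = \<infinity>"
  proof (rule ccontr)
    assume "emeasure \<mu> (space \<mu>) \<noteq> \<infinity>"
    then obtain a where a: "emeasure \<mu> (space \<mu>) = ennreal a" "0 \<le> a" by (cases "emeasure \<mu> (space \<mu>)") auto
    obtain P where "P \<in> D k0" using ne by blast
    from growing[OF this, of "a + 1"] obtain P' where "ennreal (a + 1) \<le> emeasure \<mu> P'" by blast
    then have "ennreal (a + 1) \<le> ennreal a" using emeasure_space[of \<mu> P'] a(1) by simp
    then show False using a(2) by (simp add: ennreal_le_iff)
  qed
  moreover have "(\<Union>k. D k) = \<Union> {EE f \<alpha> | f \<alpha>. integrable \<mu> f \<and> 0 < \<alpha>}"
  proof (intro equalityI subsetI)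
    fix P assume P: "P \<in> (\<Union>k. D k)"
    then have "integrable \<mu> (indicator P :: 'a \<Rightarrow> complex)"
    proof
      fix k assume "P \<in> D k"
      then show ?thesis
        using sets_D fin_D by (intro integrableI_bounded_set[where A = P and B = 1]) auto
    qed
    then have "P \<in> EE (indicator P) 1" "integrable \<mu> (indicator P :: 'a \<Rightarrow> complex)"
      using Q[of "indicator P" 1] P unfolding Q_def by auto
    then show "P \<in> \<Union> {EE f \<alpha> | f \<alpha>. integrable \<mu> f \<and> 0 < \<alpha>}"
      using zero_less_one by blast
  next
    fix P assume "P \<in> \<Union> {EE f \<alpha> | f \<alpha>. integrable \<mu> f \<and> 0 < \<alpha>}"
    then obtain f \<alpha> where "P \<in> EE f \<alpha>" "integrable \<mu> f" "0 < \<alpha>" by blast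
    then show "P \<in> (\<Union>k. D k)" using Q[of f \<alpha>] unfolding Q_def by blast
  qed
  moreover have "1 \<le> ?C0" using pos C_ge_1 by simp
  moreover have "\<forall>f \<alpha>. integrable \<mu> f \<longrightarrow> 0 < \<alpha> \<longrightarrow>
           (\<exists>J E r x g b. EE f \<alpha> = E ` J \<and> cz_decomposition d \<mu> ?C0 f \<alpha> J E r x g b)"
    using Q unfolding Q_def by blast
  ultimately show ?thesis unfolding CZP_wrt_def by blast
qed

section \<open>Admissible cylinders\<close>

text \<open>The cylinder in the coordinates \<open>(n, h)\<close> with \<open>h = exp t\<close>; it
  agrees with \<open>cyl_set\<close> on admissible cylinders by \<open>cyl_set_rect\<close>. The
  combinatorics of cylinders thus becomes independent of the group.\<close>

fun rect :: "'n cyl \<Rightarrow> ('n \<times> real) set" where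
  "rect (Cyl r k Q a) = Q \<times> {a / r<..<a * r}"

lemma rect_halves:
  assumes "0 < r"
  shows "rect (Cyl (sqrt r) k Q (a / sqrt r)) = Q \<times> {a / r<..<a}"
    and "rect (Cyl (sqrt r) k Q (a * sqrt r)) = Q \<times> {a<..<a * r}"
proof -
  have s: "sqrt r \<noteq> 0" "sqrt r * sqrt r = r" using assms by auto
  have 1: "a / sqrt r / sqrt r = a / r" "a * sqrt r * sqrt r = a * r"
    using s(2) by (simp_all only: divide_divide_eq_left mult.assoc)
  have 2: "a / sqrt r * sqrt r = a" "a * sqrt r / sqrt r = a" using s(1) by auto
  show "rect (Cyl (sqrt r) k Q (a / sqrt r)) = Q \<times> {a / r<..<a}"
    "rect (Cyl (sqrt r) k Q (a * sqrt r)) = Q \<times> {a<..<a * r}"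
    by (simp_all only: rect.simps 1 2)
qed

locale cube_tree =
  fixes \<Q> :: "int \<Rightarrow> 'n set set" and \<delta> gam lam :: real
  assumes \<delta>: "0 < \<delta>" "\<delta> < 1" and gam: "5 \<le> gam" and lam: "exp 3 / \<delta> < lam"
    and countable_cubes: "countable (\<Q> k)"
    and disjoint_cubes: "disjoint (\<Q> k)"
    and cube_parent: "Q \<in> \<Q> k \<Longrightarrow> cube_parent \<Q> k Q \<in> \<Q> (k - 1)" "Q \<in> \<Q> k \<Longrightarrow> Q \<subseteq> cube_parent \<Q> k Q"
    and cube_parent_unique: "Q \<in> \<Q> k \<Longrightarrow> P \<in> \<Q> (k - 1) \<Longrightarrow> Q \<inter> P \<noteq> {} \<Longrightarrow> P = cube_parent \<Q> k Q"
begin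

lemma lam_\<delta>: "exp 3 < lam * \<delta>"
  using lam \<delta> by (simp add: field_simps)

lemma lam_pos: "0 < lam"
  using lam \<delta> by (metis divide_pos_pos exp_gt_zero order_less_trans)

text \<open>The size conditions of large cylinders with a real \<open>D\<close> in place of
  \<open>\<delta> powi k\<close>. Passing to a son or to the parent cube multiplies or divides
  \<open>D\<close> by \<delta>.\<close>

definition lg :: "real \<Rightarrow> real \<Rightarrow> real \<Rightarrow> bool" where
  "lg r D a \<longleftrightarrow> 0 < a \<and> exp 1 < r \<and> a * r\<^sup>2 \<le> D \<and> D \<le> lam * a * r powr gam"

definition sm :: "real \<Rightarrow> real \<Rightarrow> real \<Rightarrow> bool" where
  "sm r D a \<longleftrightarrow> 0 < a \<and> 1 < r \<and> r \<le> exp 1 \<and> a * exp 2 * ln r \<le> D \<and> D \<le> lam * a * exp 2 * ln r"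

abbreviation adm :: "'n cyl \<Rightarrow> bool" where
  "adm \<equiv> admissible \<Q> \<delta> gam lam"

abbreviation sons :: "'n cyl \<Rightarrow> 'n cyl set" where
  "sons \<equiv> cyl_sons \<Q> \<delta> gam lam"

lemma adm_Cyl: "adm (Cyl r k Q a) \<longleftrightarrow> Q \<in> \<Q> k \<and> (lg r (\<delta> powi k) a \<or> sm r (\<delta> powi k) a)"
  by (auto simp: admissible_def lg_def sm_def)

text \<open>Multiplying \<open>D\<close> by \<delta> preserves the upper bound, so it is the lower
  one that fails: \<open>D * \<delta> < a * r\<^sup>2\<close>. With
  \<open>exp 3 < lam * \<delta>\<close> this gives \<open>D * exp 3 < lam * a * r\<^sup>2\<close>,
  from which the upper bounds for the halves follow. The half centred at \<open>a / s\<close> has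
  the stricter upper bound, the one centred at \<open>a * s\<close> the stricter lower
  bound.\<close>

lemma lg_halves:
  assumes "lg r D a" "\<not> lg r (D * \<delta>) a"
  defines "s \<equiv> sqrt r"
  shows "(lg s D (a / s) \<or> sm s D (a / s)) \<and> (lg s D (a * s) \<or> sm s D (a * s))"
proof -
  \<comment> \<open>With \<open>s = exp t\<close> and \<open>r = exp (2 * t)\<close> the bounds for
    large cylinders become comparisons of exponents.\<close>
  define t where "t = ln r / 2"
  from assms(1) have a: "0 < a" and r: "exp 1 < r" and lo: "a * r\<^sup>2 \<le> D" and up: "D \<le> lam * a * r powr gam"
    by (auto simp: lg_def)
  have r0: "0 < r" using r by (meson exp_gt_zero order_less_trans)
  have r_t: "r = exp (2 * t)" using r0 by (simp add: t_def)
  have s_t: "s = exp t"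
    unfolding s_def r_t by (rule real_sqrt_unique) (simp_all add: power2_eq_square flip: exp_add)
  have t: "1 / 2 < t" using r by (simp add: r_t)
  have r2: "r\<^sup>2 = exp (4 * t)" unfolding r_t by (simp add: power2_eq_square flip: exp_add)
  have D0: "0 < D" using lo a r0 by (smt (verit) mult_pos_pos zero_less_power)
  have "D * \<delta> \<le> D" using \<delta> D0 by simp
  then have fail: "D * \<delta> < a * exp (4 * t)" using assms(2) a r up r2 by (auto simp: lg_def)
  have D_less: "D * exp 3 < lam * a * exp (4 * t)"
  proof -
    have "D * exp 3 < D * (lam * \<delta>)" using lam_\<delta> D0 by simp
    also have "\<dots> = lam * (D * \<delta>)" by simp
    also have "\<dots> < lam * (a * exp (4 * t))" using fail lam_pos by (rule mult_strict_left_mono)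
    finally show ?thesis by (simp add: mult.assoc)
  qed
  have la: "0 < lam * a" using a lam_pos by simp
  show ?thesis
  \<comment> \<open>Both halves have radius \<open>s\<close>, so both are large or both are small;
    in the second case \<open>t\<close> lies between \<open>1 / 2\<close> and
    \<open>1\<close>.\<close>
  proof (cases "s > exp 1")
    case True
    then have t1: "1 < t" by (simp add: s_t)
    have l: "a * s * s\<^sup>2 \<le> D" "a / s * s\<^sup>2 \<le> D"
    proof -
      have "a * s * s\<^sup>2 = a * exp (3 * t)" unfolding s_t by (simp add: power2_eq_square flip: exp_add)
      also have "\<dots> \<le> a * exp (4 * t)" using a t by simp
      finally show "a * s * s\<^sup>2 \<le> D" using lo r2 by simp
      have "a / s * s\<^sup>2 = a * exp t" unfolding s_t by (simp add: power2_eq_square)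
      also have "\<dots> \<le> a * exp (4 * t)" using a t by simp
      finally show "a / s * s\<^sup>2 \<le> D" using lo r2 by simp
    qed
    have "D \<le> D * exp 3" using D0 by simp
    then have "D \<le> lam * a * exp (4 * t)" using D_less by simp
    \<comment> \<open>Here \<open>gam\<close> must be at least 5: the lower half loses one power of
      \<open>s\<close>, and \<open>gam - 1\<close> must still reach the exponent 4 of
      \<open>a * r\<^sup>2 = a * exp (4 * t)\<close>.\<close>
    also have "\<dots> \<le> lam * a * exp (gam * t - t)"
    proof -
      have "5 * t \<le> gam * t" using gam t by (intro mult_right_mono) auto
      then show ?thesis using la t by (intro mult_left_mono) auto
    qed
    also have "\<dots> = lam * (a / s) * s powr gam"
      unfolding s_t by (simp add: powr_def exp_diff mult.commute)
    finally have u1: "D \<le> lam * (a / s) * s powr gam" .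
    also have "\<dots> \<le> lam * (a * s) * s powr gam"
    proof -
      have "a / s \<le> a * s" using a t by (simp add: s_t divide_le_eq mult.assoc flip: exp_add)
      then show ?thesis using lam_pos by (intro mult_right_mono mult_left_mono) auto
    qed
    finally have u2: "D \<le> lam * (a * s) * s powr gam" .
    show ?thesis using True a l u1 u2 by (auto simp: lg_def s_t)
  next
    case False
    then have t1: "t \<le> 1" by (simp add: s_t)
    have ex: "exp 2 * t \<le> exp (3 * t)"
    proof -
      have "exp 2 * t \<le> exp 2 * (1 + (3 * t - 2))" using t by simp
      also have "\<dots> \<le> exp 2 * exp (3 * t - 2)" using exp_ge_add_one_self[of "3 * t - 2"] by simp
      finally show ?thesis by (simp flip: exp_add)
    qed
    have l2: "a * s * exp 2 * ln s \<le> D"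
    proof -
      have "a * s * exp 2 * ln s = a * exp t * (exp 2 * t)" by (simp add: s_t)
      also have "\<dots> \<le> a * exp t * exp (3 * t)" using ex a by (intro mult_left_mono) auto
      also have "\<dots> = a * exp (4 * t)" by (simp add: mult.assoc flip: exp_add)
      finally show ?thesis using lo r2 by simp
    qed
    have as: "a / s \<le> a * s" using a t by (simp add: s_t divide_le_eq mult.assoc flip: exp_add)
    have "a / s * (exp 2 * ln s) \<le> a * s * (exp 2 * ln s)"
      using as t by (intro mult_right_mono) (auto simp: s_t)
    then have l1: "a / s * exp 2 * ln s \<le> D" using l2 by (simp add: mult.assoc)
    \<comment> \<open>The upper bound for the small lower half amounts to
      \<open>exp (4 * t - 3) \<le> exp (2 - t) * t\<close>, where \<open>3\<close> is the gain in
      \<open>D_less\<close>. It follows from \<open>exp x \<ge> 1 + x\<close> at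
      \<open>x = 5 - 5 * t\<close> and \<open>0 \<le> (5 * t - 1) * (1 - t)\<close>.\<close>
    have "exp (5 * t - 5) \<le> t"
    proof -
      have "exp (5 - 5 * t) \<ge> 1 + (5 - 5 * t)" by (rule exp_ge_add_one_self)
      then have "1 \<le> t * exp (5 - 5 * t)"
      proof -
        have "0 \<le> (5 * t - 1) * (1 - t)" using t t1 by simp
        then have "1 \<le> t * (1 + (5 - 5 * t))" by (simp add: algebra_simps)
        also have "\<dots> \<le> t * exp (5 - 5 * t)" using t exp_ge_add_one_self[of "5 - 5 * t"] by (intro mult_left_mono) auto
        finally show ?thesis .
      qed
      then have "exp (5 * t - 5) * 1 \<le> exp (5 * t - 5) * (t * exp (5 - 5 * t))" by (intro mult_left_mono) auto
      also have "\<dots> = t * exp ((5 * t - 5) + (5 - 5 * t))" by (simp only: exp_add mult_ac)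
      finally show ?thesis by simp
    qed
    then have "exp (4 * t) \<le> exp 5 * t / exp t"
      by (simp add: exp_diff field_simps flip: exp_add)
    then have "lam * a * exp (4 * t) \<le> lam * a * (exp 5 * t / exp t)"
      using la by (intro mult_left_mono) auto
    then have "D * exp 3 \<le> lam * a * (exp 5 * t / exp t)" using D_less by simp
    also have "\<dots> = (lam * (a / s) * exp 2 * ln s) * exp 3"
    proof -
      have "exp 5 = exp 2 * exp (3 :: real)" by (simp flip: exp_add)
      then show ?thesis by (simp add: s_t)
    qed
    finally have u1: "D \<le> lam * (a / s) * exp 2 * ln s" by (rule mult_right_le_imp_le) simp
    also have "\<dots> \<le> lam * (a * s) * exp 2 * ln s"
      using as lam_pos t by (intro mult_right_mono mult_left_mono) (auto simp: s_t)
    finally have u2: "D \<le> lam * (a * s) * exp 2 * ln s" .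
    show ?thesis using False a l1 l2 u1 u2 t by (auto simp: sm_def s_t)
  qed
qed

text \<open>The mechanism of \<open>lg_halves\<close> applies, but the halves are always small. The
  lower bound for the upper half follows because \<open>s \<le> 2\<close> while \<open>ln s\<close>
  is half of \<open>ln r\<close>.\<close>

lemma sm_halves:
  assumes "sm r D a" "\<not> sm r (D * \<delta>) a"
  defines "s \<equiv> sqrt r"
  shows "sm s D (a / s) \<and> sm s D (a * s)"
proof -
  define t where "t = ln r / 2"
  from assms(1) have a: "0 < a" and r: "1 < r" "r \<le> exp 1" and lo: "a * exp 2 * ln r \<le> D"
    and up: "D \<le> lam * a * exp 2 * ln r"
    by (auto simp: sm_def)
  have r_t: "r = exp (2 * t)" using r by (simp add: t_def)
  have s_t: "s = exp t"
    unfolding s_def r_t by (rule real_sqrt_unique) (simp_all add: power2_eq_square flip: exp_add)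
  have t: "0 < t" "t \<le> 1 / 2" using r by (simp_all add: r_t)
  have s2: "s \<le> 2"
  proof (rule power2_le_imp_le)
    have "s\<^sup>2 = r" unfolding s_def using r by simp
    then show "s\<^sup>2 \<le> 2\<^sup>2" using r(2) exp_le by simp
  qed simp
  have s1: "1 < s" "s \<le> exp 1" using t by (simp_all add: s_t)
  have ln_r: "ln r = 2 * t" by (simp add: r_t)
  have la: "0 < lam * a" using a lam_pos by simp
  have D0: "0 < D" using lo a t by (smt (verit) ln_r exp_gt_zero mult_pos_pos)
  have "D * \<delta> \<le> D" using \<delta> D0 by simp
  then have fail: "D * \<delta> < a * exp 2 * (2 * t)" using assms(2) a r up by (auto simp: sm_def ln_r)
  have D_less: "D * exp 3 < lam * a * (exp 2 * (2 * t))"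
  proof -
    have "D * exp 3 < D * (lam * \<delta>)" using lam_\<delta> D0 by simp
    also have "\<dots> = lam * (D * \<delta>)" by simp
    also have "\<dots> < lam * (a * exp 2 * (2 * t))" using fail lam_pos by (rule mult_strict_left_mono)
    finally show ?thesis by (simp add: mult.assoc)
  qed
  have l2: "a * s * exp 2 * ln s \<le> D"
  proof -
    have "a * s * exp 2 * ln s = (a * exp 2 * t) * s" by (simp add: s_t)
    also have "\<dots> \<le> (a * exp 2 * t) * 2" using a t s2 by (intro mult_left_mono) auto
    also have "\<dots> \<le> D" using lo by (simp add: ln_r)
    finally show ?thesis .
  qed
  have as: "a / s \<le> a * s" using a t by (simp add: s_t divide_le_eq mult.assoc flip: exp_add)
  have "a / s * (exp 2 * ln s) \<le> a * s * (exp 2 * ln s)"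
    using as t by (intro mult_right_mono) (auto simp: s_t)
  then have l1: "a / s * exp 2 * ln s \<le> D" using l2 by (simp add: mult.assoc)
  \<comment> \<open>The lower half loses a factor \<open>s\<close> in its centre and a factor
    \<open>2\<close> in the logarithm; \<open>2 * s \<le> 4 \<le> exp 3\<close> absorbs
    both.\<close>
  have "D * (2 * s) \<le> D * exp 3"
    using D0 s2 exp_ge_add_one_self[of 3] by (intro mult_left_mono) auto
  then have "D * (2 * s) \<le> lam * a * (exp 2 * (2 * t))" using D_less by linarith
  then have "D \<le> lam * a * (exp 2 * (2 * t)) / (2 * s)" using s1 by (simp add: pos_le_divide_eq)
  also have "\<dots> = lam * (a / s) * exp 2 * ln s" by (simp add: s_t)
  finally have u1: "D \<le> lam * (a / s) * exp 2 * ln s" .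
  also have "\<dots> \<le> lam * (a * s) * exp 2 * ln s"
    using as lam_pos t by (intro mult_right_mono mult_left_mono) (auto simp: s_t)
  finally have u2: "D \<le> lam * (a * s) * exp 2 * ln s" .
  show ?thesis using a s1 l1 l2 u1 u2 by (auto simp: sm_def)
qed

lemma powi_step: "\<delta> powi (k + 1) = \<delta> powi k * \<delta>" "\<delta> powi (k - 1) = \<delta> powi k / \<delta>"
  using \<delta> by (simp_all add: power_int_add power_int_diff)

lemma cube_sons_D:
  assumes "Q' \<in> cube_sons \<Q> k Q"
  shows "Q' \<in> \<Q> (k + 1)" "Q' \<subseteq> Q" "cube_parent \<Q> (k + 1) Q' = Q"
  using assms cube_parent(2)[of Q' "k + 1"] by (auto simp: cube_sons_def)

lemma sons_cases:
  assumes "adm P" "P' \<in> sons P"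
  obtains (split) r k Q a where "P = Cyl r k Q a"
      "P' = Cyl (sqrt r) k Q (a / sqrt r) \<or> P' = Cyl (sqrt r) k Q (a * sqrt r)"
    | (side) r k Q a Q' where "P = Cyl r k Q a" "P' = Cyl r (k + 1) Q' a" "Q' \<in> cube_sons \<Q> k Q"
  using assms(2) by (cases P) (auto split: if_splits)

text \<open>If the sons are not vertical halves, some half is inadmissible, and the contrapositives
  of \<open>lg_halves\<close> and \<open>sm_halves\<close> show that one generation further the same
  \<open>r\<close> and \<open>a\<close> are admissible.\<close>

lemma adm_sons:
  assumes "adm P" "P' \<in> sons P"
  shows "adm P'"
proof (cases P)
  case P: (Cyl r k Q a)
  show ?thesis
  proof (cases "adm (Cyl (sqrt r) k Q (a / sqrt r)) \<and> adm (Cyl (sqrt r) k Q (a * sqrt r))")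
    case True
    then show ?thesis using assms(2) P by auto
  next
    case False
    then obtain Q' where Q': "Q' \<in> cube_sons \<Q> k Q" "P' = Cyl r (k + 1) Q' a"
      using assms(2) P by auto
    have "Q \<in> \<Q> k" and *: "lg r (\<delta> powi k) a \<or> sm r (\<delta> powi k) a"
      using assms(1) P by (auto simp: adm_Cyl)
    then have "lg r (\<delta> powi k * \<delta>) a \<or> sm r (\<delta> powi k * \<delta>) a"
      using False lg_halves[of r "\<delta> powi k" a] sm_halves[of r "\<delta> powi k" a] unfolding adm_Cyl by blast
    then show ?thesis using cube_sons_D[OF Q'(1)] by (simp add: Q'(2) adm_Cyl powi_step)
  qed
qed

text \<open>The bound on \<open>a * ln r\<close> is a weak lower condition common to large and small
  cylinders. It lets \<open>ln r\<close> be controlled by the size of the cube.\<close>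

lemma adm_D:
  assumes "adm (Cyl r k Q a)"
  shows "Q \<in> \<Q> k" "0 < a" "1 < r" "a * ln r \<le> \<delta> powi k"
    "r \<le> exp 1 \<Longrightarrow> \<delta> powi k \<le> lam * a * exp 2 * ln r"
proof -
  have *: "lg r (\<delta> powi k) a \<or> sm r (\<delta> powi k) a" using assms by (simp add: adm_Cyl)
  show "Q \<in> \<Q> k" using assms by (simp add: adm_Cyl)
  show a: "0 < a" using * by (auto simp: lg_def sm_def)
  have "exp 1 < r \<Longrightarrow> 1 < r" by (meson one_less_exp_iff order_less_trans zero_less_one)
  then show r: "1 < r" using * by (auto simp: lg_def sm_def)
  show "a * ln r \<le> \<delta> powi k"
    using *
  proof
    assume "lg r (\<delta> powi k) a"
    then have "a * r\<^sup>2 \<le> \<delta> powi k" by (simp add: lg_def)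
    moreover have "ln r \<le> r\<^sup>2"
    proof -
      have "ln r \<le> r * 1" using ln_le_minus_one[of r] r by simp
      also have "\<dots> \<le> r * r" using r by (intro mult_left_mono) auto
      finally show ?thesis by (simp add: power2_eq_square)
    qed
    ultimately show ?thesis using a by (meson mult_left_mono order_less_imp_le order_trans)
  next
    assume "sm r (\<delta> powi k) a"
    then have "a * exp 2 * ln r \<le> \<delta> powi k" by (simp add: sm_def)
    moreover have "a * 1 * ln r \<le> a * exp 2 * ln r"
      using a r by (intro mult_right_mono mult_left_mono) auto
    ultimately show ?thesis by simp
  qed
  show "\<delta> powi k \<le> lam * a * exp 2 * ln r" if "r \<le> exp 1"
    using * that by (auto simp: lg_def sm_def)
qed

lemma sons_subset:
  assumes "adm P" "P' \<in> sons P"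
  shows "rect P' \<subseteq> rect P"
  using assms
proof (cases rule: sons_cases)
  case (split r k Q a)
  have r: "1 < r" "0 < a" using adm_D assms(1) split(1) by auto
  have ar: "a / r \<le> a" "a \<le> a * r" using r by (auto simp: divide_le_eq)
  have "{a / r<..<a} \<subseteq> {a / r<..<a * r}" "{a<..<a * r} \<subseteq> {a / r<..<a * r}"
    using order.strict_trans2[OF _ ar(2)] order.strict_trans1[OF ar(1)] by auto
  then have "Q \<times> {a / r<..<a} \<subseteq> Q \<times> {a / r<..<a * r}" "Q \<times> {a<..<a * r} \<subseteq> Q \<times> {a / r<..<a * r}"
    by blast+
  then show ?thesis using split rect_halves[of r k Q a] r by (metis rect.simps order_less_trans zero_less_one)
next
  case (side r k Q a Q')
  then show ?thesis using cube_sons_D(2) by auto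
qed

lemma sons_disjoint:
  assumes "adm P" "P1 \<in> sons P" "P2 \<in> sons P" "rect P1 \<inter> rect P2 \<noteq> {}"
  shows "P1 = P2"
proof (cases P)
  case P: (Cyl r k Q a)
  have r: "1 < r" "0 < a" using adm_D assms(1) P by auto
  show ?thesis
  proof (cases "adm (Cyl (sqrt r) k Q (a / sqrt r)) \<and> adm (Cyl (sqrt r) k Q (a * sqrt r))")
    case True
    then have "{P1, P2} \<subseteq> {Cyl (sqrt r) k Q (a / sqrt r), Cyl (sqrt r) k Q (a * sqrt r)}"
      using assms(2,3) P by auto
    moreover have "rect (Cyl (sqrt r) k Q (a / sqrt r)) \<inter> rect (Cyl (sqrt r) k Q (a * sqrt r)) = {}"
      using r rect_halves[of r k Q a] by auto
    ultimately show ?thesis using assms(4) by (auto simp: Int_commute)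
  next
    case False
    then obtain Q1 Q2 where Q: "Q1 \<in> cube_sons \<Q> k Q" "P1 = Cyl r (k + 1) Q1 a"
      "Q2 \<in> cube_sons \<Q> k Q" "P2 = Cyl r (k + 1) Q2 a"
      using assms(2,3) P by auto
    then have "Q1 \<inter> Q2 \<noteq> {}" using assms(4) by auto
    then have "Q1 = Q2" using disjoint_cubes[of "k + 1"] cube_sons_D(1)[OF Q(1)] cube_sons_D(1)[OF Q(3)]
      by (auto simp: disjoint_def)
    then show ?thesis using Q by simp
  qed
qed

lemma countable_sons: "countable (sons P)"
proof (cases P)
  case P: (Cyl r k Q a)
  have "countable (cube_sons \<Q> k Q)"
    by (rule countable_subset[OF _ countable_cubes[of "k + 1"]]) (auto simp: cube_sons_def)
  then have "countable ((\<lambda>Q'. Cyl r (k + 1) Q' a) ` cube_sons \<Q> k Q)" by simp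
  then show ?thesis unfolding P by (auto simp: setcompr_eq_image)
qed

section \<open>Covering by sons and shrinking of iterated sons\<close>

definition good_cube :: "'n \<Rightarrow> bool" where
  "good_cube n \<longleftrightarrow> (\<forall>j. n \<in> \<Union>(\<Q> j))"

text \<open>The height \<open>a\<close> is excluded because the two vertical halves, being open,
  both miss it.\<close>

lemma sons_cover:
  assumes "adm (Cyl r k Q a)" "(n, h) \<in> rect (Cyl r k Q a)" "good_cube n" "h \<noteq> a"
  shows "\<exists>P'\<in>sons (Cyl r k Q a). (n, h) \<in> rect P'"
proof (cases "adm (Cyl (sqrt r) k Q (a / sqrt r)) \<and> adm (Cyl (sqrt r) k Q (a * sqrt r))")
  case True
  have r: "1 < r" "0 < a" using adm_D assms(1) by auto
  have "(n, h) \<in> rect (Cyl (sqrt r) k Q (a / sqrt r)) \<union> rect (Cyl (sqrt r) k Q (a * sqrt r))"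
    using assms(2,4) r rect_halves[of r k Q a] by auto
  then show ?thesis using True by auto
next
  case False
  obtain Q' where Q': "Q' \<in> \<Q> (k + 1)" "n \<in> Q'" using assms(3) unfolding good_cube_def by blast
  have "Q = cube_parent \<Q> (k + 1) Q'"
    using Q' assms(1,2) adm_D(1) by (intro cube_parent_unique) auto
  then have "Q' \<in> cube_sons \<Q> k Q" using Q' by (simp add: cube_sons_def)
  then have "Cyl r (k + 1) Q' a \<in> sons (Cyl r k Q a)" using False by auto
  moreover have "(n, h) \<in> rect (Cyl r (k + 1) Q' a)" using Q' assms(2) by auto
  ultimately show ?thesis by blast
qed

abbreviation desc :: "nat \<Rightarrow> 'n cyl \<Rightarrow> 'n cyl set" where
  "desc \<equiv> cyl_desc \<Q> \<delta> gam lam"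

lemma adm_desc: "adm P \<Longrightarrow> P' \<in> desc i P \<Longrightarrow> adm P'"
  by (induction i arbitrary: P') (auto intro: adm_sons)

lemma desc_subset: "adm P \<Longrightarrow> P' \<in> desc i P \<Longrightarrow> rect P' \<subseteq> rect P"
proof (induction i arbitrary: P')
  case (Suc i)
  then obtain P1 where "P1 \<in> desc i P" "P' \<in> sons P1" by auto
  then show ?case using Suc sons_subset[of P1 P'] adm_desc by blast
qed simp

lemma desc_disjoint:
  "adm P \<Longrightarrow> P1 \<in> desc i P \<Longrightarrow> P2 \<in> desc i P \<Longrightarrow> rect P1 \<inter> rect P2 \<noteq> {} \<Longrightarrow> P1 = P2"
proof (induction i arbitrary: P1 P2)
  case (Suc i)
  then obtain R1 R2 where R: "R1 \<in> desc i P" "P1 \<in> sons R1" "R2 \<in> desc i P" "P2 \<in> sons R2" by auto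
  then have a: "adm R1" "adm R2" using Suc.prems(1) adm_desc by auto
  have "rect R1 \<inter> rect R2 \<noteq> {}"
    using sons_subset[OF a(1) R(2)] sons_subset[OF a(2) R(4)] Suc.prems(4) by blast
  then have "R1 = R2" using Suc R by blast
  then show ?case using sons_disjoint[OF a(1)] R Suc.prems(4) by blast
qed simp

lemma countable_desc: "countable (desc i P)"
  by (induction i) (auto intro!: countable_UN countable_sons)

text \<open>Here \<open>p\<close> counts the vertical halvings and \<open>q\<close> the subdivisions
  of the cube among the \<open>i\<close> steps.\<close>

lemma desc_params:
  assumes "adm (Cyl r k Q a)" "Cyl r' k' Q' a' \<in> desc i (Cyl r k Q a)"
  shows "\<exists>p q. p + q = i \<and> ln r' = ln r / 2 ^ p \<and> k' = k + int q"
  using assms(2)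
proof (induction i arbitrary: r' k' Q' a')
  case 0
  then show ?case by auto
next
  case (Suc i)
  then obtain P1 where P1: "P1 \<in> desc i (Cyl r k Q a)" "Cyl r' k' Q' a' \<in> sons P1" by auto
  have adm1: "adm P1" using P1 assms adm_desc by blast
  from adm1 P1(2) show ?case
  proof (cases rule: sons_cases)
    case (split r1 k1 Q1 a1)
    then obtain p q where pq: "p + q = i" "ln r1 = ln r / 2 ^ p" "k1 = k + int q" using Suc.IH P1(1) by blast
    have "0 < r1" using adm_D(3) adm1 split(1) by fastforce
    then have "ln r' = ln r / 2 ^ Suc p" "k' = k + int q" "Suc p + q = Suc i"
      using split pq by (auto simp: ln_sqrt)
    then show ?thesis by blast
  next
    case (side r1 k1 Q1 a1 Q2)
    then obtain p q where pq: "p + q = i" "ln r1 = ln r / 2 ^ p" "k1 = k + int q" using Suc.IH P1(1) by blast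
    then have "ln r' = ln r / 2 ^ p" "k' = k + int (Suc q)" "p + Suc q = Suc i" using side by auto
    then show ?thesis by blast
  qed
qed

text \<open>Among \<open>2 * M\<close> steps there are \<open>M\<close> subdivisions or
  \<open>M\<close> halvings. A cylinder containing the height \<open>h\<close> has its centre
  \<open>a'\<close> between \<open>h / r\<close> and \<open>h * r\<close>, so admissibility
  transfers smallness from the parameter reduced often to the other one.\<close>

lemma desc_small:
  assumes P: "adm (Cyl r k Q a)" and h: "0 < h" and \<epsilon>: "0 < \<epsilon>"
  shows "\<exists>i. \<forall>r' k' Q' a'. Cyl r' k' Q' a' \<in> desc i (Cyl r k Q a) \<longrightarrow> h \<in> {a' / r'<..<a' * r'} \<longrightarrow>
     ln r' < \<epsilon> \<and> \<delta> powi k' < \<epsilon>"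
proof -
  \<comment> \<open>\<open>C\<close> dominates the prefactors of all estimates below and
    \<open>m\<close> dominates both ratios \<delta> and \<open>1 / 2\<close>, so every bound has the
    form \<open>C * m ^ M\<close>.\<close>
  define C where "C = \<delta> powi k * (r / h) + \<delta> powi k + lam * h * r * exp 2 * ln r + ln r + 1"
  have r: "1 < r" using adm_D P by auto
  have C: "\<delta> powi k * (r / h) \<le> C" "\<delta> powi k \<le> C" "lam * h * r * exp 2 * ln r \<le> C" "ln r \<le> C" "0 < C"
    using r h lam_pos \<delta> unfolding C_def by (simp_all add: add_nonneg_nonneg add_nonneg_pos)
  define m where "m = max \<delta> (1 / 2)"
  have m: "0 < m" "m < 1" "\<delta> \<le> m" "1 / 2 \<le> m" using \<delta> by (auto simp: m_def)
  \<comment> \<open>The minimum with \<open>1\<close> forces \<open>ln r' < 1\<close> in the second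
    case, so the cylinder is small and its upper bound in terms of \<open>ln r'\<close> is
    available.\<close>
  have "0 < min \<epsilon> 1 / C" using \<epsilon> C by simp
  then obtain M where "m ^ M < min \<epsilon> 1 / C" using real_arch_pow_inv m(2) by blast
  then have M: "C * m ^ M < min \<epsilon> 1" using C(5) by (simp add: field_simps)
  have "ln r' < \<epsilon> \<and> \<delta> powi k' < \<epsilon>"
    if *: "Cyl r' k' Q' a' \<in> desc (2 * M) (Cyl r k Q a)" and hh: "h \<in> {a' / r'<..<a' * r'}" for r' k' Q' a'
  proof -
    obtain p q where pq: "p + q = 2 * M" "ln r' = ln r / 2 ^ p" "k' = k + int q"
      using desc_params[OF P *] by blast
    have adm': "adm (Cyl r' k' Q' a')" using adm_desc P * by blast
    note A = adm_D[OF adm']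
    have "ln r' \<le> ln r" using r by (simp add: pq(2) divide_le_eq mult_le_cancel_left1)
    then have r'r: "r' \<le> r" using A(3) r by simp
    have a'h: "a' < h * r" "h / r < a'"
    proof -
      have "a' < h * r'" using hh A(3) by (simp add: divide_less_eq)
      also have "\<dots> \<le> h * r" using r'r h by simp
      finally show "a' < h * r" .
      have "h < a' * r'" using hh by simp
      also have "\<dots> \<le> a' * r" using r'r A(2) by simp
      finally show "h / r < a'" using r by (simp add: divide_less_eq)
    qed
    consider "M \<le> q" | "M \<le> p" using pq(1) by linarith
    then show ?thesis
    proof cases
      case 1
      have "\<delta> ^ q \<le> \<delta> ^ M" using 1 \<delta> by (intro power_decreasing) auto
      also have "\<dots> \<le> m ^ M" using \<delta> m by (intro power_mono) auto
      finally have d: "\<delta> ^ q \<le> m ^ M" .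
      have k': "\<delta> powi k' = \<delta> powi k * \<delta> ^ q" using \<delta> by (simp add: pq(3) power_int_add)
      have "\<delta> powi k' \<le> C * m ^ M" unfolding k' using d C \<delta> by (intro mult_mono) auto
      moreover have "ln r' < \<epsilon>"
      proof -
        have "h / r * ln r' \<le> a' * ln r'" using a'h A(3) by (intro mult_right_mono) auto
        also have "\<dots> \<le> \<delta> powi k'" by (rule A(4))
        finally have "h * ln r' \<le> \<delta> powi k' * r" using r by (simp add: divide_le_eq)
        then have "ln r' \<le> \<delta> powi k' * r / h" using h by (simp add: pos_le_divide_eq mult.commute)
        also have "\<dots> = \<delta> powi k * (r / h) * \<delta> ^ q" by (simp add: k')
        also have "\<dots> \<le> C * m ^ M" using d C \<delta> m by (intro mult_mono) auto
        finally show ?thesis using M by simp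
      qed
      ultimately show ?thesis using M by simp
    next
      case 2
      have "(1 / 2) ^ p \<le> (1 / 2 :: real) ^ M" using 2 by (intro power_decreasing) auto
      also have "\<dots> \<le> m ^ M" using m by (intro power_mono) auto
      finally have d: "(1 / 2) ^ p \<le> m ^ M" .
      have ln_r': "ln r' = ln r * (1 / 2) ^ p" by (simp add: pq(2) power_divide)
      have l: "ln r' \<le> C * m ^ M" unfolding ln_r' using d C r m by (intro mult_mono) auto
      then have "ln r' < 1" using M by simp
      then have "ln r' < ln (exp 1)" by simp
      then have "r' < exp 1" using A(3) by (subst (asm) ln_less_cancel_iff) auto
      then have "\<delta> powi k' \<le> lam * a' * exp 2 * ln r'" using A(5) by simp
      also have "\<dots> \<le> lam * (h * r) * exp 2 * ln r'"
        using a'h lam_pos A(3) by (intro mult_right_mono mult_left_mono) auto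
      also have "\<dots> = lam * h * r * exp 2 * ln r * (1 / 2) ^ p" by (simp add: ln_r')
      also have "\<dots> \<le> C * m ^ M" using d C m by (intro mult_mono) auto
      finally show ?thesis using l M by simp
    qed
  qed
  then show ?thesis by blast
qed

end

section \<open>The chain of cylinders and the partitions\<close>

text \<open>The ends of the height interval and the height at which a vertical split cuts it. The
  open cylinders miss these heights, so they are excluded in \<open>good\<close>.\<close>

fun heights :: "'n cyl \<Rightarrow> real set" where
  "heights (Cyl r k Q a) = {a, a * r, a / r}"

context cube_tree
begin

lemma lg_exp:
  assumes "0 < a" "1 < s" "a * exp (u + 2 * s) \<le> D" "D \<le> lam * a * exp (u + gam * s)"
  shows "lg (exp s) D (a * exp u)"
proof -
  have 1: "a * exp u * (exp s)\<^sup>2 = a * exp (u + 2 * s)" by (simp add: exp_add exp_double)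
  have 2: "lam * (a * exp u) * exp s powr gam = lam * a * exp (u + gam * s)"
    by (simp add: powr_def exp_add)
  show ?thesis unfolding lg_def 1 2 using assms by simp
qed

text \<open>Dividing \<open>D\<close> by \<delta> preserves the lower bound, so the upper one fails:
  \<open>lam * a * r powr gam * \<delta> < D\<close>, and hence \<open>a * r ^ 5 \<le> D\<close>.
  For radius \<open>r ^ p\<close> and centre \<open>a\<close> times \<open>r\<close> to the power
  \<open>q\<close>, it then suffices that \<open>q + 2 * p \<le> 5\<close> and
  \<open>gam \<le> q + gam * p\<close>. The four cylinders have \<open>p = 2, q = 1\<close>, then
  \<open>p = 3, q = -2\<close>, \<open>p = 1, q = 2\<close> and \<open>p = 2, q = -3\<close>; the
  first one needs the full exponent 5.\<close>

lemma lg_vertical: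
  assumes "lg r D a" "\<not> lg r (D / \<delta>) a"
  shows "lg (r\<^sup>2) D (a * r)" "lg (r ^ 3) D (a / r\<^sup>2)" "lg r D (a * r\<^sup>2)" "lg (r\<^sup>2) D (a / r ^ 3)"
proof -
  define t where "t = ln r"
  from assms(1) have a: "0 < a" and r: "exp 1 < r" and lo: "a * r\<^sup>2 \<le> D" and up: "D \<le> lam * a * r powr gam"
    by (auto simp: lg_def)
  have r0: "0 < r" using r by (meson exp_gt_zero order_less_trans)
  have r_t: "r = exp t" using r0 by (simp add: t_def)
  have t: "1 < t" using r by (simp add: r_t)
  have D0: "0 < D" using lo a r0 by (smt (verit) mult_pos_pos zero_less_power)
  have "D \<le> D / \<delta>" using \<delta> D0 by (simp add: pos_le_divide_eq)
  then have "lam * a * r powr gam < D / \<delta>" using assms a r lo by (auto simp: lg_def)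
  then have "lam * a * exp (gam * t) * \<delta> < D" using \<delta> by (simp add: pos_less_divide_eq r_t powr_def)
  moreover have "a * exp (5 * t) \<le> lam * a * exp (gam * t) * \<delta>"
  proof -
    have "5 * t \<le> gam * t" using gam t by (intro mult_right_mono) auto
    then have "a * exp (5 * t) \<le> a * exp (gam * t)" using a by simp
    also have "\<dots> \<le> (lam * \<delta>) * (a * exp (gam * t))"
    proof -
      have "1 < exp (3 :: real)" by simp
      then have "1 \<le> lam * \<delta>" using lam_\<delta> by linarith
      then have "1 * (a * exp (gam * t)) \<le> (lam * \<delta>) * (a * exp (gam * t))"
        using a by (intro mult_right_mono) auto
      then show ?thesis by simp
    qed
    finally show ?thesis by (simp add: mult_ac)
  qed
  ultimately have lo': "a * exp (5 * t) \<le> D" by simp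
  have up': "D \<le> lam * a * exp (gam * t)" using up by (simp add: r_t powr_def)
  have gt: "5 * t \<le> gam * t" using gam t by (intro mult_right_mono) auto
  \<comment> \<open>Radius and centre in logarithmic form: \<open>s\<close> stands for
    \<open>p * t\<close> and \<open>u\<close> for \<open>q * t\<close>.\<close>
  have *: "lg (exp s) D (a * exp u)" if "1 < s" "u + 2 * s \<le> 5 * t" "gam * t \<le> u + gam * s" for s u
  proof (rule lg_exp[OF a that(1)])
    have "a * exp (u + 2 * s) \<le> a * exp (5 * t)" using that a by simp
    then show "a * exp (u + 2 * s) \<le> D" using lo' by simp
    have "lam * a * exp (gam * t) \<le> lam * a * exp (u + gam * s)"
      using that(3) a lam_pos by simp
    then show "D \<le> lam * a * exp (u + gam * s)" using up' by simp
  qed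
  have e: "exp t ^ n = exp (real n * t)" for n by (simp add: exp_of_nat_mult)
  have "lg (exp (2 * t)) D (a * exp t)" using t gt by (intro *) (simp_all add: mult.left_commute)
  then show "lg (r\<^sup>2) D (a * r)" by (simp add: r_t e)
  have "lg (exp (3 * t)) D (a * exp (- (2 * t)))" using t gt by (intro *) (simp_all add: mult.left_commute)
  then show "lg (r ^ 3) D (a / r\<^sup>2)" by (simp add: r_t e exp_minus divide_inverse)
  have "lg (exp t) D (a * exp (2 * t))" using t gt by (intro *) (simp_all add: mult.left_commute)
  then show "lg r D (a * r\<^sup>2)" by (simp add: r_t e)
  have "lg (exp (2 * t)) D (a * exp (- (3 * t)))" using t gt by (intro *) (simp_all add: mult.left_commute)
  then show "lg (r\<^sup>2) D (a / r ^ 3)" by (simp add: r_t e exp_minus divide_inverse)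
qed

end

locale cyl_tree = cube_tree \<Q> \<delta> gam lam for \<Q> :: "int \<Rightarrow> 'n set set" and \<delta> gam lam +
  fixes r0 :: real and k0 :: int and Q0 :: "'n set"
  assumes start: "large_admissible \<Q> \<delta> gam lam (Cyl r0 k0 Q0 1)"
begin

abbreviation "ch \<equiv> cyl_chain \<Q> \<delta> gam lam (Cyl r0 k0 Q0 1)"
definition "R n = (case fst (ch n) of Cyl r k Q a \<Rightarrow> r)"
definition "K n = (case fst (ch n) of Cyl r k Q a \<Rightarrow> k)"
definition "QQ n = (case fst (ch n) of Cyl r k Q a \<Rightarrow> Q)"
definition "A n = (case fst (ch n) of Cyl r k Q a \<Rightarrow> a)"
definition "Up n = snd (ch n)"
definition "Side n \<longleftrightarrow> adm (p_side \<Q> (fst (ch n)))"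

lemma ch_eq: "ch n = (Cyl (R n) (K n) (QQ n) (A n), Up n)"
  by (cases "ch n"; cases "fst (ch n)") (auto simp: R_def K_def QQ_def A_def Up_def)

lemma step_side:
  assumes "Side n"
  shows "R (Suc n) = R n" "K (Suc n) = K n - 1" "QQ (Suc n) = cube_parent \<Q> (K n) (QQ n)"
    "A (Suc n) = A n" "Up (Suc n) = Up n"
proof -
  have "ch (Suc n) = (Cyl (R n) (K n - 1) (cube_parent \<Q> (K n) (QQ n)) (A n), Up n)"
    using assms ch_eq[of n] by (simp add: Side_def)
  then show "R (Suc n) = R n" "K (Suc n) = K n - 1" "QQ (Suc n) = cube_parent \<Q> (K n) (QQ n)"
    "A (Suc n) = A n" "Up (Suc n) = Up n" using ch_eq[of "Suc n"] by auto
qed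

lemma step_up:
  assumes "\<not> Side n" "Up n"
  shows "R (Suc n) = (R n)\<^sup>2" "K (Suc n) = K n" "QQ (Suc n) = QQ n" "A (Suc n) = A n * R n" "\<not> Up (Suc n)"
proof -
  have "ch (Suc n) = (Cyl ((R n)\<^sup>2) (K n) (QQ n) (A n * R n), False)"
    using assms ch_eq[of n] by (simp add: Side_def)
  then show "R (Suc n) = (R n)\<^sup>2" "K (Suc n) = K n" "QQ (Suc n) = QQ n" "A (Suc n) = A n * R n" "\<not> Up (Suc n)"
    using ch_eq[of "Suc n"] by auto
qed

lemma step_down:
  assumes "\<not> Side n" "\<not> Up n"
  shows "R (Suc n) = R n ^ 3" "K (Suc n) = K n" "QQ (Suc n) = QQ n" "A (Suc n) = A n / (R n)\<^sup>2" "Up (Suc n)"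
proof -
  have "ch (Suc n) = (Cyl (R n ^ 3) (K n) (QQ n) (A n / (R n)\<^sup>2), True)"
    using assms ch_eq[of n] by (simp add: Side_def)
  then show "R (Suc n) = R n ^ 3" "K (Suc n) = K n" "QQ (Suc n) = QQ n" "A (Suc n) = A n / (R n)\<^sup>2" "Up (Suc n)"
    using ch_eq[of "Suc n"] by auto
qed

text \<open>The radius exceeds \<open>exp 1\<close>, so admissibility of the cylinder over the
  parent cube can only be as a large one.\<close>

lemma Side_D:
  assumes "Side n" "exp 1 < R n"
  shows "cube_parent \<Q> (K n) (QQ n) \<in> \<Q> (K n - 1)" "lg (R n) (\<delta> powi K n / \<delta>) (A n)"
  using assms unfolding Side_def ch_eq by (auto simp: adm_Cyl powi_step sm_def)

lemma not_Side_D: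
  assumes "\<not> Side n" "QQ n \<in> \<Q> (K n)"
  shows "\<not> lg (R n) (\<delta> powi K n / \<delta>) (A n)"
  using assms cube_parent(1)[of "QQ n" "K n"] unfolding Side_def ch_eq by (auto simp: adm_Cyl powi_step)

lemma chain_large: "QQ n \<in> \<Q> (K n) \<and> lg (R n) (\<delta> powi K n) (A n)"
proof (induction n)
  case 0
  have "ch 0 = (Cyl r0 k0 Q0 1, True)" by simp
  then have "R 0 = r0" "K 0 = k0" "QQ 0 = Q0" "A 0 = 1" using ch_eq[of 0] by auto
  then show ?case using start by (auto simp: lg_def)
next
  case (Suc n)
  then have Q: "QQ n \<in> \<Q> (K n)" and l: "lg (R n) (\<delta> powi K n) (A n)" by auto
  show ?case
  proof (cases "Side n")
    case True
    have "exp 1 < R n" using l by (simp add: lg_def)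
    then show ?thesis using Side_D[OF True] step_side[OF True] by (simp add: powi_step)
  next
    case False
    note v = lg_vertical[OF l not_Side_D[OF False Q]]
    show ?thesis using Q v(1,2) step_up[OF False] step_down[OF False] by (cases "Up n") simp_all
  qed
qed

lemma QQ: "QQ n \<in> \<Q> (K n)" and lgR: "lg (R n) (\<delta> powi K n) (A n)"
  using chain_large by auto

lemma R_gt: "exp 1 < R n" "1 < R n" and A_pos: "0 < A n"
  and large_bound: "\<delta> powi K n \<le> lam * A n * R n powr gam"
proof -
  show R: "exp 1 < R n" and "0 < A n" "\<delta> powi K n \<le> lam * A n * R n powr gam"
    using lgR[of n] by (auto simp: lg_def)
  have "1 < exp (1::real)" by simp
  then show "1 < R n" using R by linarith
qed

definition "lo n = A n / R n"
definition "hi n = A n * R n"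
text \<open>With \<open>A'\<close>, the radius and centre of the height interval that a vertical
  step at \<open>n\<close> adds.\<close>

definition "R' n = (if Up n then R n else (R n)\<^sup>2)"
definition "A' n = (if Up n then A n * (R n)\<^sup>2 else A n / R n ^ 3)"

abbreviation "sl \<equiv> slab \<Q> \<delta> gam lam (Cyl r0 k0 Q0 1)"
abbreviation "rs \<equiv> rest_slab \<Q> \<delta> gam lam (Cyl r0 k0 Q0 1)"

lemma slab_eq: "sl n = {Cyl (R n) (K n) Q (A n) | Q. Q \<in> \<Q> (K n)}"
  by (simp add: slab_def ch_eq)

lemma rest_eq: "rs n = (if Side n then {} else {Cyl (R' n) (K n) Q (A' n) | Q. Q \<in> \<Q> (K n)})"
  by (simp add: rest_slab_def ch_eq Side_def R'_def A'_def)

lemma adm_slab: "P \<in> sl n \<Longrightarrow> adm P"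
  using lgR[of n] by (auto simp: slab_eq adm_Cyl)

lemma adm_rest: "P \<in> rs n \<Longrightarrow> adm P"
  using lg_vertical(3,4)[OF lgR[of n] not_Side_D[OF _ QQ]]
  by (auto simp: rest_eq adm_Cyl R'_def A'_def split: if_splits)

lemma ends_side: "Side n \<Longrightarrow> lo (Suc n) = lo n \<and> hi (Suc n) = hi n"
  using step_side[of n] by (simp add: lo_def hi_def)

lemma ends_up:
  assumes "\<not> Side n" "Up n"
  shows "lo (Suc n) = lo n" "A' n / R' n = hi n" "A' n * R' n = hi (Suc n)" "hi (Suc n) = hi n * (R n)\<^sup>2"
  using step_up[OF assms] assms(2) R_gt(2)[of n]
  by (simp_all add: lo_def hi_def A'_def R'_def power2_eq_square)

lemma ends_down:
  assumes "\<not> Side n" "\<not> Up n"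
  shows "hi (Suc n) = hi n" "A' n / R' n = lo (Suc n)" "A' n * R' n = lo n" "lo (Suc n) = lo n / R n ^ 4"
  using step_down[OF assms] assms(2) R_gt(2)[of n]
  by (simp_all add: lo_def hi_def A'_def R'_def power2_eq_square power3_eq_cube power4_eq_xxxx)

lemma lo_pos: "0 < lo n" and hi_pos: "0 < hi n"
  using A_pos[of n] R_gt(2)[of n] by (simp_all add: lo_def hi_def)

lemma lo_less_hi: "lo n < hi n"
proof -
  have "A n / R n < A n / 1" using A_pos[of n] R_gt(2)[of n] by (intro divide_strict_left_mono) auto
  also have "\<dots> < A n * R n" using A_pos[of n] R_gt(2)[of n] by simp
  finally show ?thesis by (simp add: lo_def hi_def)
qed

lemma ends_Suc: "lo (Suc n) \<le> lo n \<and> hi n \<le> hi (Suc n)"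
proof (cases "Side n")
  case False
  show ?thesis
  proof (cases "Up n")
    case True
    have "1 \<le> (R n)\<^sup>2" using R_gt(2)[of n] by (intro one_le_power) auto
    then show ?thesis using ends_up[OF False True] hi_pos[of n] by (simp add: mult_le_cancel_left1)
  next
    case False
    have "1 \<le> R n ^ 4" using R_gt(2)[of n] by (intro one_le_power) auto
    then show ?thesis using ends_down[OF \<open>\<not> Side n\<close> False] lo_pos[of n] by (simp add: divide_le_eq mult_le_cancel_left1)
  qed
qed (simp add: ends_side)

lemma lo_mono: "n \<le> n' \<Longrightarrow> lo n' \<le> lo n" and hi_mono: "n \<le> n' \<Longrightarrow> hi n \<le> hi n'"
  using ends_Suc lift_Suc_antimono_le[of lo n n'] lift_Suc_mono_le[of hi n n'] by blast+

text \<open>Horizontal steps keep \<open>R\<close> and \<open>A\<close> while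
  \<open>\<delta> powi K n\<close> is divided by \<delta> each time, against the fixed bound of
  \<open>large_bound\<close>; a run of them is therefore finite. They also keep \<open>Up\<close>,
  so the next vertical step has the direction already pending.\<close>

lemma next_vertical: "\<exists>n'\<ge>n. \<not> Side n' \<and> Up n' = Up n"
proof -
  have "\<exists>i. \<not> Side (n + i)"
  proof (rule ccontr)
    assume "\<not> ?thesis"
    then have side: "Side (n + i)" for i by blast
    have *: "R (n + i) = R n \<and> A (n + i) = A n \<and> K (n + i) = K n - int i" for i
      by (induction i) (use step_side[OF side] in auto)
    define b where "b = lam * A n * R n powr gam / \<delta> powi K n"
    obtain i where i: "b < (1 / \<delta>) ^ i" using real_arch_pow[of "1 / \<delta>" b] \<delta> by auto
    have "\<delta> powi K (n + i) = \<delta> powi K n * (1 / \<delta>) ^ i"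
      using * \<delta> by (simp add: power_int_diff power_divide)
    moreover have "\<delta> powi K (n + i) \<le> lam * A n * R n powr gam" using large_bound[of "n + i"] * by simp
    ultimately have "(1 / \<delta>) ^ i * \<delta> powi K n \<le> lam * A n * R n powr gam" by (simp add: mult.commute)
    then have "(1 / \<delta>) ^ i \<le> b" using \<delta> unfolding b_def by (simp add: pos_le_divide_eq)
    then show False using i by simp
  qed
  then have least: "\<not> Side (n + (LEAST i. \<not> Side (n + i)))" by (rule LeastI_ex)
  have "Up (n + i) = Up n" if "i \<le> (LEAST i. \<not> Side (n + i))" for i
    using that
  proof (induction i)
    case (Suc i)
    then have "Side (n + i)" using not_less_Least[of i "\<lambda>i. \<not> Side (n + i)"] by auto
    then show ?case using Suc step_side(5)[of "n + i"] by simp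
  qed simp
  from this[OF order_refl] least show ?thesis by (meson le_add1)
qed

lemma next_vertical': "\<exists>n'\<ge>n. \<not> Side n' \<and> Up n' = b"
proof -
  obtain n1 where n1: "n \<le> n1" "\<not> Side n1" "Up n1 = Up n" using next_vertical by blast
  show ?thesis
  proof (cases "Up n = b")
    case True
    then show ?thesis using n1 by blast
  next
    case False
    have "Up (Suc n1) = (\<not> Up n1)" using step_up(5)[OF n1(2)] step_down(5)[OF n1(2)] by blast
    moreover obtain n2 where "Suc n1 \<le> n2" "\<not> Side n2" "Up n2 = Up (Suc n1)" using next_vertical by blast
    ultimately show ?thesis using n1 False by (meson Suc_leD order_trans)
  qed
qed

lemma R_Suc: "ln (R n) \<le> ln (R (Suc n))" "\<not> Side n \<Longrightarrow> ln (R n) + 1 \<le> ln (R (Suc n))"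
proof -
  have R0: "0 < R n" using R_gt(2)[of n] by simp
  have "ln (exp 1) < ln (R n)" using R0 R_gt(1)[of n] by (subst ln_less_cancel_iff) auto
  then have R: "0 < R n" "1 < ln (R n)" using R0 by simp_all
  have v: "ln (R n) + 1 \<le> ln (R (Suc n))" if "\<not> Side n"
    using R step_up(1)[OF that] step_down(1)[OF that] by (cases "Up n") (auto simp: ln_realpow)
  then show "\<not> Side n \<Longrightarrow> ln (R n) + 1 \<le> ln (R (Suc n))" .
  show "ln (R n) \<le> ln (R (Suc n))" using v step_side(1)[of n] by (cases "Side n") auto
qed

lemma R_unbounded: "\<exists>n'\<ge>n. M \<le> ln (R n')"
proof -
  have "\<exists>n'\<ge>n. real i \<le> ln (R n')" for i
  proof (induction i)
    case 0
    have "0 \<le> ln (R n)" using R_gt(2)[of n] by simp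
    then show ?case by auto
  next
    case (Suc i)
    then obtain n' where n': "n \<le> n'" "real i \<le> ln (R n')" by blast
    obtain n'' where n'': "n' \<le> n''" "\<not> Side n''" using next_vertical by blast
    have "ln (R n') \<le> ln (R n'')"
      by (rule lift_Suc_mono_le[of "\<lambda>n. ln (R n)", OF R_Suc(1) n''(1)])
    then have "real (Suc i) \<le> ln (R (Suc n''))" using n' R_Suc(2)[OF n''(2)] by simp
    then show ?case using n'(1) n''(1) by (meson le_SucI order_trans)
  qed
  moreover obtain i where "M \<le> real i" using real_arch_simple by blast
  ultimately show ?thesis by (meson order_trans)
qed

text \<open>Upward steps recur for ever, and each multiplies the upper end by the square of a radius
  larger than \<open>2\<close>.\<close>

lemma hi_unbounded: "\<exists>n. M < hi n"
proof -
  have "\<exists>n. hi 0 * 2 ^ i \<le> hi n" for i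
  proof (induction i)
    case (Suc i)
    then obtain n where n: "hi 0 * 2 ^ i \<le> hi n" by blast
    obtain n' where n': "n \<le> n'" "\<not> Side n'" "Up n'" using next_vertical'[of n True] by blast
    have "2 \<le> (R n')\<^sup>2"
    proof -
      have "2 \<le> exp (1::real)" using exp_ge_add_one_self[of 1] by simp
      then have "2 \<le> R n'" using R_gt(1)[of n'] by linarith
      then have "2 * 1 \<le> R n' * R n'" by (intro mult_mono) auto
      then show ?thesis by (simp add: power2_eq_square)
    qed
    then have "hi n * 2 \<le> hi n' * (R n')\<^sup>2" using hi_mono[OF n'(1)] hi_pos by (intro mult_mono) (auto intro: less_imp_le)
    then have "hi 0 * 2 ^ Suc i \<le> hi (Suc n')" using n ends_up(4)[OF n'(2,3)] by simp
    then show ?case by blast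
  qed auto
  moreover obtain i where "M / hi 0 < 2 ^ i" using real_arch_pow[of 2 "M / hi 0"] by auto
  ultimately show ?thesis using hi_pos[of 0] by (metis divide_less_eq less_le_trans mult.commute)
qed

lemma lo_to_0: "0 < \<epsilon> \<Longrightarrow> \<exists>n. lo n < \<epsilon>"
proof -
  assume \<epsilon>: "0 < \<epsilon>"
  have "\<exists>n. lo n * 2 ^ i \<le> lo 0" for i
  proof (induction i)
    case (Suc i)
    then obtain n where n: "lo n * 2 ^ i \<le> lo 0" by blast
    obtain n' where n': "n \<le> n'" "\<not> Side n'" "\<not> Up n'" using next_vertical'[of n False] by blast
    have "2 \<le> R n' ^ 4"
    proof -
      have "2 \<le> exp (1::real)" using exp_ge_add_one_self[of 1] by simp
      then have "2 \<le> R n'" using R_gt(1)[of n'] by linarith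
      also have "\<dots> = R n' ^ 1" by simp
      also have "\<dots> \<le> R n' ^ 4" using R_gt(2)[of n'] by (intro power_increasing) auto
      finally show ?thesis .
    qed
    then have "lo (Suc n') * 2 \<le> lo (Suc n') * R n' ^ 4" using lo_pos by (intro mult_left_mono) (auto intro: less_imp_le)
    also have "\<dots> = lo n'" using ends_down(4)[OF n'(2,3)] R_gt(2)[of n'] by simp
    also have "\<dots> \<le> lo n" using lo_mono n'(1) .
    finally have "lo (Suc n') * 2 * 2 ^ i \<le> lo n * 2 ^ i" by (rule mult_right_mono) simp
    then have "lo (Suc n') * 2 ^ Suc i \<le> lo 0" using n by (simp only: power_Suc mult.assoc)
    then show ?case by blast
  qed auto
  moreover obtain i where i: "lo 0 / \<epsilon> < 2 ^ i" using real_arch_pow[of 2 "lo 0 / \<epsilon>"] by auto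
  ultimately obtain n where "lo n * 2 ^ i \<le> lo 0" by blast
  also have "lo 0 < \<epsilon> * 2 ^ i" using i \<epsilon> by (simp add: divide_less_eq mult.commute)
  finally have "lo n < \<epsilon>" by simp
  then show ?thesis by blast
qed

lemma eventually_between: "0 < h \<Longrightarrow> \<exists>n\<ge>k. lo n < h \<and> h < hi n"
proof -
  assume h: "0 < h"
  obtain n1 n2 where "lo n1 < h" "h < hi n2" using lo_to_0[OF h] hi_unbounded by blast
  moreover have "lo (max k (max n1 n2)) \<le> lo n1" "hi n2 \<le> hi (max k (max n1 n2))"
    by (auto intro!: lo_mono hi_mono)
  ultimately show ?thesis by (meson le_less_trans less_le_trans max.cobounded1)
qed

section \<open>The generations of the family and their disjointness\<close>

abbreviation "DN \<equiv> DZ_neg \<Q> \<delta> gam lam (Cyl r0 k0 Q0 1)"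
abbreviation "DP \<equiv> DZ_pos \<Q> \<delta> gam lam (Cyl r0 k0 Q0 1)"

text \<open>One sequence over all integers. Both branches agree at \<open>0\<close>, because
  \<open>DZ_pos\<close> starts from generation 0 of \<open>DZ_neg\<close>.\<close>

definition DD :: "int \<Rightarrow> 'n cyl set" where
  "DD k = (if 0 \<le> k then DP (nat k) else DN (nat (- k)))"

lemma DD_pos [simp]: "DD (int n) = DP n" and DD_neg [simp]: "DD (- int n) = DN n"
  by (auto simp: DD_def)

lemma DZ_eq: "DZ \<Q> \<delta> gam lam (Cyl r0 k0 Q0 1) = (\<Union>k. DD k)"
proof -
  have 1: "(\<Union>k. DD k) \<subseteq> (\<Union>k. DN k) \<union> (\<Union>k. DP k)" by (auto simp: DD_def split: if_splits)
  have 2: "DN n \<subseteq> (\<Union>k. DD k)" "DP n \<subseteq> (\<Union>k. DD k)" for n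
    using DD_neg[of n] DD_pos[of n] by blast+
  show ?thesis unfolding DZ_def by (intro equalityI Un_least UN_least 1 2)
qed

lemma DN_eq: "DN k = sl k \<union> (\<Union>l\<in>{k..}. \<Union>P\<in>rs l. desc (l - k) P)"
proof -
  have "{k..} = insert k {k<..}" by auto
  then show ?thesis unfolding DZ_neg_def by auto
qed

lemma DN_cases:
  assumes "P \<in> DN k"
  obtains (slab) "P \<in> sl k" | (rest) l P0 where "k \<le> l" "P0 \<in> rs l" "P \<in> desc (l - k) P0"
  using assms unfolding DN_eq by auto

lemma adm_DN: "P \<in> DN k \<Longrightarrow> adm P"
  by (erule DN_cases) (auto intro: adm_slab adm_desc adm_rest)

lemma adm_DP: "P \<in> DP n \<Longrightarrow> adm P"
  by (induction n arbitrary: P) (auto intro: adm_DN adm_sons)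

lemma adm_DD: "P \<in> DD k \<Longrightarrow> adm P"
  by (auto simp: DD_def intro: adm_DN adm_DP split: if_splits)

lemma countable_DD: "countable (DD k)"
proof -
  have s: "countable (sl n)" "countable (rs n)" for n
    using countable_cubes[of "K n"] by (auto simp: slab_eq rest_eq setcompr_eq_image)
  then have n: "countable (DN k)" for k
    unfolding DN_eq by (auto intro!: countable_UN countable_desc)
  have "countable (DP k)" for k by (induction k) (auto simp: n intro!: countable_UN countable_sons)
  then show ?thesis using n by (simp add: DD_def)
qed

lemma rest_height: "P \<in> rs l \<Longrightarrow> (n, h) \<in> rect P \<Longrightarrow>
    (hi l < h \<and> h < hi (Suc l)) \<or> (lo (Suc l) < h \<and> h < lo l)"
  using ends_up[of l] ends_down[of l] by (cases "Up l") (auto simp: rest_eq split: if_splits)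

lemma slab_height: "P \<in> sl k \<Longrightarrow> (n, h) \<in> rect P \<Longrightarrow> lo k < h \<and> h < hi k"
  by (auto simp: slab_eq lo_def hi_def)

text \<open>Heights separate the pieces: the slab \<open>k\<close> lies between \<open>lo k\<close>
  and \<open>hi k\<close>, and the rests of different levels from \<open>k\<close> on occupy
  disjoint intervals outside. Within one level the cubes are disjoint, and
  \<open>desc_disjoint\<close> handles iterated sons.\<close>

lemma DN_disjoint:
  assumes "P1 \<in> DN k" "P2 \<in> DN k" "rect P1 \<inter> rect P2 \<noteq> {}"
  shows "P1 = P2"
proof -
  obtain n h where x: "(n, h) \<in> rect P1" "(n, h) \<in> rect P2" using assms(3) by auto
  have sr: False if "(n, h) \<in> rect P" "P \<in> sl k" "(n, h) \<in> rect P'" "P' \<in> desc (l - k) P0" "P0 \<in> rs l" "k \<le> l"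
    for P P' P0 l
  proof -
    have "(n, h) \<in> rect P0" using desc_subset[OF adm_rest[OF that(5)] that(4)] that(3) by blast
    from rest_height[OF that(5) this] slab_height[OF that(2,1)] lo_mono[OF that(6)] hi_mono[OF that(6)]
    show False by linarith
  qed
  have rr: "l = l'" if "(n, h) \<in> rect P" "P \<in> rs l" "(n, h) \<in> rect P'" "P' \<in> rs l'" for P P' l l'
  proof -
    have False if "l < l'" "(n, h) \<in> rect P" "P \<in> rs l" "(n, h) \<in> rect P'" "P' \<in> rs l'" for P P' l l'
      using rest_height[OF that(3,2)] rest_height[OF that(5,4)] lo_mono[of "Suc l" l'] hi_mono[of "Suc l" l']
        lo_mono[of l l'] hi_mono[of l l'] that(1) lo_less_hi[of l] lo_less_hi[of l']
      by (elim disjE) linarith+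
    from this[of l l' P P'] this[of l' l P' P] that show ?thesis by (meson linorder_neqE_nat)
  qed
  show ?thesis
    using assms(1)
  proof (cases rule: DN_cases)
    case slab
    from assms(2) show ?thesis
    proof (cases rule: DN_cases)
      case slab2: slab
      obtain Q1 Q2 where Q: "P1 = Cyl (R k) (K k) Q1 (A k)" "Q1 \<in> \<Q> (K k)"
        "P2 = Cyl (R k) (K k) Q2 (A k)" "Q2 \<in> \<Q> (K k)"
        using slab slab2 by (auto simp: slab_eq)
      then have "Q1 = Q2" using disjoint_cubes[of "K k"] x by (auto simp: disjoint_def)
      then show ?thesis using Q by simp
    next
      case (rest l P0)
      then show ?thesis using sr[OF x(1) slab x(2)] by blast
    qed
  next
    case (rest l P0)
    from assms(2) show ?thesis
    proof (cases rule: DN_cases)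
      case slab
      then show ?thesis using sr[OF x(2) slab x(1)] rest by blast
    next
      case rest2: (rest l' P0')
      have x0: "(n, h) \<in> rect P0" using desc_subset[OF adm_rest rest(3)] rest(2) x(1) by blast
      have x0': "(n, h) \<in> rect P0'" using desc_subset[OF adm_rest rest2(3)] rest2(2) x(2) by blast
      have l: "l = l'" using rr[OF x0 rest(2) x0' rest2(2)] .
      obtain Q1 Q2 where Q: "P0 = Cyl (R' l) (K l) Q1 (A' l)" "Q1 \<in> \<Q> (K l)"
        "P0' = Cyl (R' l) (K l) Q2 (A' l)" "Q2 \<in> \<Q> (K l)"
        using rest(2) rest2(2) l by (auto simp: rest_eq split: if_splits)
      then have "Q1 = Q2" using disjoint_cubes[of "K l"] x0 x0' by (auto simp: disjoint_def)
      then have "P0 = P0'" using Q by simp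
      then show ?thesis
        using desc_disjoint[OF adm_rest[OF rest(2)] rest(3), of P2] rest2(3) l assms(3) by simp
    qed
  qed
qed

lemma DP_disjoint: "P1 \<in> DP k \<Longrightarrow> P2 \<in> DP k \<Longrightarrow> rect P1 \<inter> rect P2 \<noteq> {} \<Longrightarrow> P1 = P2"
proof (induction k arbitrary: P1 P2)
  case 0
  then show ?case using DN_disjoint[of P1 0 P2] by simp
next
  case (Suc k)
  then obtain S1 S2 where R: "S1 \<in> DP k" "P1 \<in> sons S1" "S2 \<in> DP k" "P2 \<in> sons S2" by auto
  then have a: "adm S1" "adm S2" using adm_DP by auto
  have "rect S1 \<inter> rect S2 \<noteq> {}"
    using sons_subset[OF a(1) R(2)] sons_subset[OF a(2) R(4)] Suc.prems(3) by blast
  then have "S1 = S2" using Suc.IH R by blast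
  then show ?case using sons_disjoint[OF a(1)] R Suc.prems(3) by blast
qed

lemma DD_disjoint: "P1 \<in> DD k \<Longrightarrow> P2 \<in> DD k \<Longrightarrow> rect P1 \<inter> rect P2 \<noteq> {} \<Longrightarrow> P1 = P2"
  using DN_disjoint[of P1 "nat (- k)" P2] DP_disjoint[of P1 "nat k" P2]
  unfolding DD_def by (cases "0 \<le> k") simp_all

end

section \<open>Parents, growth and covering\<close>

context cyl_tree
begin

text \<open>The relation between a cylinder and its parent, reduced to what the comparison of
  measures uses. The factor \<open>3\<close> is due to \<open>p_down\<close>, which cubes the
  radius.\<close>

definition step :: "'n cyl \<Rightarrow> 'n cyl \<Rightarrow> bool" where
  "step P P' \<longleftrightarrow> rect P \<subseteq> rect P' \<and> (\<exists>r k Q a r' k' Q' a'. P = Cyl r k Q a \<and> P' = Cyl r' k' Q' a' \<and>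
     ((Q' = Q \<and> ln r' \<le> 3 * ln r) \<or> (r' = r \<and> Q' = cube_parent \<Q> k Q)))"

lemma step_sons:
  assumes "adm P'" "P \<in> sons P'"
  shows "step P P'"
proof -
  have sub: "rect P \<subseteq> rect P'" using sons_subset[OF assms] .
  from assms show ?thesis
  proof (cases rule: sons_cases)
    case (split r k Q a)
    then have "1 < r" using adm_D(3) assms(1) by blast
    then have "ln r \<le> 3 * ln (sqrt r)" by (simp add: ln_sqrt)
    then show ?thesis using split sub unfolding step_def by blast
  next
    case (side r k Q a Q')
    then show ?thesis using sub cube_sons_D(3)[OF side(3)] unfolding step_def by blast
  qed
qed

lemma step_slab:
  assumes "P \<in> sl n"
  shows "\<exists>P'\<in>sl (Suc n). step P P'"
proof -
  obtain Q where P: "P = Cyl (R n) (K n) Q (A n)" and Q: "Q \<in> \<Q> (K n)" using assms by (auto simp: slab_eq)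
  show ?thesis
  proof (cases "Side n")
    case True
    define P' where "P' = Cyl (R n) (K n - 1) (cube_parent \<Q> (K n) Q) (A n)"
    have "P' \<in> sl (Suc n)" using step_side[OF True] cube_parent(1)[OF Q] by (auto simp: slab_eq P'_def)
    moreover have "rect P \<subseteq> rect P'" using cube_parent(2)[OF Q] by (auto simp: P P'_def)
    ultimately show ?thesis unfolding step_def P P'_def by blast
  next
    case False
    define P' where "P' = Cyl (R (Suc n)) (K n) Q (A (Suc n))"
    have K: "K (Suc n) = K n" using step_up(2)[OF False] step_down(2)[OF False] by (cases "Up n") auto
    have "P' \<in> sl (Suc n)" using K Q by (auto simp: slab_eq P'_def)
    moreover have "rect P \<subseteq> rect P'"
      using ends_Suc[of n] by (auto simp: P P'_def lo_def hi_def)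
    moreover have "ln (R (Suc n)) \<le> 3 * ln (R n)"
      using step_up(1)[OF False] step_down(1)[OF False] R_gt(2)[of n] by (cases "Up n") (auto simp: ln_realpow)
    ultimately show ?thesis unfolding step_def P P'_def by blast
  qed
qed

lemma step_rest:
  assumes "P \<in> rs n"
  shows "\<exists>P'\<in>sl (Suc n). step P P'"
proof -
  obtain Q where P: "P = Cyl (R' n) (K n) Q (A' n)" and Q: "Q \<in> \<Q> (K n)" and ns: "\<not> Side n"
    using assms by (auto simp: rest_eq split: if_splits)
  define P' where "P' = Cyl (R (Suc n)) (K n) Q (A (Suc n))"
  have K: "K (Suc n) = K n" using step_up(2)[OF ns] step_down(2)[OF ns] by (cases "Up n") auto
  have P': "P' \<in> sl (Suc n)" using K Q by (auto simp: slab_eq P'_def)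
  have "rect P \<subseteq> rect P'"
  proof
    fix x assume "x \<in> rect P"
    moreover obtain y h where x: "x = (y, h)" by (cases x)
    ultimately have "(hi n < h \<and> h < hi (Suc n)) \<or> (lo (Suc n) < h \<and> h < lo n)"
      using rest_height[OF assms] by simp
    then have "lo (Suc n) < h \<and> h < hi (Suc n)"
      using ends_Suc[of n] lo_less_hi[of n] by (elim disjE) auto
    then show "x \<in> rect P'" using \<open>x \<in> rect P\<close> by (simp add: x P P'_def lo_def hi_def)
  qed
  moreover have "ln (R (Suc n)) \<le> 3 * ln (R' n)"
    using step_up(1)[OF ns] step_down(1)[OF ns] R_gt(2)[of n] by (cases "Up n") (auto simp: ln_realpow R'_def)
  ultimately have "step P P'" unfolding step_def P P'_def by blast
  then show ?thesis using P' by blast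
qed

lemma sl_DN: "sl n \<subseteq> DN n" and rs_desc_DN: "n \<le> l \<Longrightarrow> P0 \<in> rs l \<Longrightarrow> desc (l - n) P0 \<subseteq> DN n"
  unfolding DN_eq by auto

text \<open>A rest of level \<open>l\<close> has been subdivided \<open>l - n\<close> times in
  generation \<open>-n\<close>, and passing to generation \<open>-(n + 1)\<close> undoes one
  subdivision. When none is left, the parent lies in the next slab.\<close>

lemma step_DN:
  assumes "P \<in> DN n"
  shows "\<exists>P'\<in>DN (Suc n). step P P'"
  using assms
proof (cases rule: DN_cases)
  case slab
  then show ?thesis using step_slab sl_DN[of "Suc n"] by blast
next
  case (rest l P0)
  show ?thesis
  proof (cases "l = n")
    case True
    then show ?thesis using rest step_rest[of P n] sl_DN[of "Suc n"] by auto
  next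
    case False
    then have l: "Suc n \<le> l" "l - n = Suc (l - Suc n)" using rest(1) by auto
    then obtain P' where P': "P' \<in> desc (l - Suc n) P0" "P \<in> sons P'" using rest(3) by auto
    then have "P' \<in> DN (Suc n)" using rs_desc_DN[OF l(1) rest(2)] by blast
    then show ?thesis using step_sons[OF adm_DN P'(2)] by blast
  qed
qed

lemma step_DD:
  assumes "P \<in> DD (k + 1)"
  shows "\<exists>P'\<in>DD k. step P P'"
proof (cases "0 \<le> k")
  case True
  then have "nat (k + 1) = Suc (nat k)" by simp
  then have "P \<in> DP (Suc (nat k))" using assms True by (simp add: DD_def)
  then obtain P' where "P' \<in> DP (nat k)" "P \<in> sons P'" by auto
  then show ?thesis using True step_sons[OF adm_DP] by (auto simp: DD_def)
next
  case False
  \<comment> \<open>For \<open>k = -1\<close> this is \<open>n = 0\<close>, and generation 0 is then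
    read as \<open>DN 0\<close>.\<close>
  define n where "n = nat (- (k + 1))"
  have k: "k + 1 = - int n" "k = - int (Suc n)" using False by (auto simp: n_def)
  have "P \<in> DN n" using assms unfolding k(1) by simp
  then have "\<exists>P'\<in>DN (Suc n). step P P'" by (rule step_DN)
  then show ?thesis unfolding k(2) DD_neg .
qed

lemma ancestor_DP: "P \<in> DP n \<Longrightarrow> \<exists>P'\<in>DN 0. rect P \<subseteq> rect P'"
proof (induction n arbitrary: P)
  case (Suc n)
  then obtain P' where "P' \<in> DP n" "P \<in> sons P'" by auto
  then show ?case using Suc.IH[of P'] sons_subset[OF adm_DP] by blast
qed auto

lemma DN_in_slab:
  assumes "P \<in> DN n"
  shows "\<exists>l\<ge>n. \<exists>P'\<in>sl l. rect P \<subseteq> rect P'"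
  using assms
proof (cases rule: DN_cases)
  case slab
  then show ?thesis by blast
next
  case (rest l P0)
  have "rect P \<subseteq> rect P0" using desc_subset[OF adm_rest[OF rest(2)] rest(3)] .
  moreover obtain P' where "P' \<in> sl (Suc l)" "rect P0 \<subseteq> rect P'"
    using step_rest[OF rest(2)] unfolding step_def by blast
  ultimately show ?thesis using rest(1) by (intro exI[of _ "Suc l"]) auto
qed

lemma slab_grows:
  "Q \<in> \<Q> (K n) \<Longrightarrow> \<exists>Q'\<in>\<Q> (K (n + i)). Q \<subseteq> Q' \<and>
     rect (Cyl (R n) (K n) Q (A n)) \<subseteq> rect (Cyl (R (n + i)) (K (n + i)) Q' (A (n + i)))"
proof (induction i)
  case (Suc i)
  then obtain Q' where Q': "Q' \<in> \<Q> (K (n + i))" "Q \<subseteq> Q'"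
    "rect (Cyl (R n) (K n) Q (A n)) \<subseteq> rect (Cyl (R (n + i)) (K (n + i)) Q' (A (n + i)))"
    by blast
  then have "Cyl (R (n + i)) (K (n + i)) Q' (A (n + i)) \<in> sl (n + i)" by (auto simp: slab_eq)
  from step_slab[OF this] obtain Q'' where Q'': "Q'' \<in> \<Q> (K (Suc (n + i)))"
    "rect (Cyl (R (n + i)) (K (n + i)) Q' (A (n + i)))
      \<subseteq> rect (Cyl (R (Suc (n + i))) (K (Suc (n + i))) Q'' (A (Suc (n + i))))"
    by (auto simp: slab_eq step_def simp del: rect.simps)
  \<comment> \<open>The height interval contains its centre, hence is nonempty; without a common
    height the inclusion of rectangles would say nothing about the cubes.\<close>
  have ne: "A (n + i) \<in> {A (n + i) / R (n + i)<..<A (n + i) * R (n + i)}"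
    using A_pos[of "n + i"] R_gt(2)[of "n + i"] by (simp add: divide_less_eq)
  have "Q' \<subseteq> Q''"
  proof
    fix x assume "x \<in> Q'"
    then have "(x, A (n + i)) \<in> rect (Cyl (R (n + i)) (K (n + i)) Q' (A (n + i)))" using ne by simp
    from subsetD[OF Q''(2) this] show "x \<in> Q''" by simp
  qed
  then have "Q \<subseteq> Q''" using Q'(2) by blast
  moreover have "rect (Cyl (R n) (K n) Q (A n)) \<subseteq> rect (Cyl (R (n + Suc i)) (K (n + Suc i)) Q'' (A (n + Suc i)))"
    using order_trans[OF Q'(3) Q''(2)] by (simp only: add_Suc_right)
  ultimately show ?case using Q''(1) by (intro bexI[of _ Q'']) (simp_all only: add_Suc_right)
qed auto

text \<open>One cube \<open>Q0\<close> serves for all \<open>M\<close>: its positive measure is a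
  fixed factor, so that the unbounded \<open>ln r\<close> alone makes the measures tend to
  infinity.\<close>

lemma growing_DD:
  assumes "P \<in> DD k"
  shows "\<exists>j0. \<exists>Q0\<in>\<Q> j0. \<forall>M. \<exists>j\<le>k. \<exists>r k' Q a. Cyl r k' Q a \<in> DD j \<and>
    rect P \<subseteq> rect (Cyl r k' Q a) \<and> Q0 \<subseteq> Q \<and> M \<le> ln r"
proof -
  obtain n P1 where n: "- int n \<le> k" "P1 \<in> DN n" "rect P \<subseteq> rect P1"
  proof (cases "0 \<le> k")
    case True
    then show ?thesis using assms ancestor_DP[of P "nat k"] that[of 0] by (auto simp: DD_def)
  next
    case False
    then show ?thesis using assms that[of "nat (- k)" P] by (auto simp: DD_def)
  qed
  obtain l P2 where l: "n \<le> l" "P2 \<in> sl l" "rect P1 \<subseteq> rect P2" using DN_in_slab[OF n(2)] by blast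
  obtain Q where Q: "P2 = Cyl (R l) (K l) Q (A l)" "Q \<in> \<Q> (K l)" using l(2) by (auto simp: slab_eq)
  have "\<exists>j\<le>k. \<exists>r k' Q' a. Cyl r k' Q' a \<in> DD j \<and> rect P \<subseteq> rect (Cyl r k' Q' a) \<and> Q \<subseteq> Q' \<and> M \<le> ln r" for M
  proof -
    obtain l' where l': "l \<le> l'" "M \<le> ln (R l')" using R_unbounded by blast
    obtain Q' where Q': "Q' \<in> \<Q> (K l')" "Q \<subseteq> Q'" "rect P2 \<subseteq> rect (Cyl (R l') (K l') Q' (A l'))"
      using slab_grows[OF Q(2), of "l' - l"] l'(1) Q(1) by auto
    have "Cyl (R l') (K l') Q' (A l') \<in> DD (- int l')"
      unfolding DD_neg using Q'(1) sl_DN[of l'] by (auto simp: slab_eq)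
    moreover have "- int l' \<le> k" using n(1) l(1) l'(1) by linarith
    ultimately show ?thesis using Q' n(3) l(3) l'(2) by blast
  qed
  then show ?thesis using Q(2) by blast
qed

definition good :: "'n \<times> real \<Rightarrow> bool" where
  "good x \<longleftrightarrow> good_cube (fst x) \<and> 0 < snd x \<and> (\<forall>k. \<forall>P\<in>DD k. snd x \<notin> heights P)"

lemma countable_heights: "countable (\<Union>k. \<Union>P\<in>DD k. heights P)"
proof -
  have "countable (heights P)" for P :: "'n cyl" by (cases P) simp
  then show ?thesis by (auto intro!: countable_UN countable_DD)
qed

text \<open>For \<open>i \<le> l\<close> the iterated sons belong to generation
  \<open>-(l - i)\<close> of the family, so \<open>good\<close> keeps the point off the heights
  where they are cut.\<close>

lemma cover_desc:
  assumes x: "good (n, h)" "P0 \<in> rs l" "(n, h) \<in> rect P0"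
  shows "i \<le> l \<Longrightarrow> \<exists>P\<in>desc i P0. (n, h) \<in> rect P"
proof (induction i)
  case 0
  then show ?case using x by auto
next
  case (Suc i)
  then obtain P where P: "P \<in> desc i P0" "(n, h) \<in> rect P" by auto
  have "P \<in> DN (l - i)" using rs_desc_DN[of "l - i" l P0] x(2) P(1) Suc.prems by auto
  then have "P \<in> DD (- int (l - i))" by simp
  then have "h \<notin> heights P" using x(1) unfolding good_def snd_conv by blast
  moreover have "adm P" using adm_desc adm_rest x(2) P(1) by blast
  moreover obtain r k Q a where "P = Cyl r k Q a" by (cases P)
  ultimately have "\<exists>P'\<in>sons P. (n, h) \<in> rect P'"
    using sons_cover[of r k Q a n h] x(1) P(2) by (auto simp: good_def)
  then show ?case using P(1) by auto
qed

text \<open>Every positive height eventually lies between \<open>lo\<close> and \<open>hi\<close>.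
  Going back along the chain, either it is still there at level \<open>k\<close>, or it drops out at
  some level \<open>l\<close> and so lies in the rest of that level, where \<open>cover_desc\<close>
  with \<open>l - k\<close> steps applies.\<close>

lemma cover_DN:
  assumes x: "good (n, h)"
  shows "\<exists>P\<in>DN k. (n, h) \<in> rect P"
proof -
  have h: "0 < h" using x by (simp add: good_def)
  have q: "\<exists>Q\<in>\<Q> j. n \<in> Q" for j using x by (auto simp: good_def good_cube_def)
  have slab: "\<exists>P\<in>sl l. (n, h) \<in> rect P" if "lo l < h" "h < hi l" for l
    using q[of "K l"] that by (force simp: slab_eq lo_def hi_def)
  have ends: "h \<noteq> lo l \<and> h \<noteq> hi l" for l
  proof -
    have "Cyl (R l) (K l) (QQ l) (A l) \<in> DD (- int l)"
      unfolding DD_neg using sl_DN[of l] QQ[of l] by (auto simp: slab_eq)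
    then have "h \<notin> heights (Cyl (R l) (K l) (QQ l) (A l))" using x unfolding good_def snd_conv by blast
    then show ?thesis by (auto simp: lo_def hi_def)
  qed
  have "lo (k + i) < h \<Longrightarrow> h < hi (k + i) \<Longrightarrow> \<exists>P\<in>DN k. (n, h) \<in> rect P" for i
  proof (induction i)
    case 0
    then show ?case using slab[of k] sl_DN[of k] by auto
  next
    case (Suc i)
    show ?case
    proof (cases "lo (k + i) < h \<and> h < hi (k + i)")
      case True
      then show ?thesis using Suc.IH by blast
    next
      case False
      define l where "l = k + i"
      have l: "lo (Suc l) < h" "h < hi (Suc l)" "h < lo l \<or> hi l < h"
        using Suc.prems False ends[of l] by (auto simp: l_def)
      have ns: "\<not> Side l" using l ends_side[of l] by auto
      obtain Q where Q: "Q \<in> \<Q> (K l)" "n \<in> Q" using q by blast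
      define P0 where "P0 = Cyl (R' l) (K l) Q (A' l)"
      have P0: "P0 \<in> rs l" using ns Q by (auto simp: rest_eq P0_def)
      have "A' l / R' l < h \<and> h < A' l * R' l"
        using l ends_up[OF ns] ends_down[OF ns] lo_less_hi[of l] by (cases "Up l") auto
      then have "(n, h) \<in> rect P0" using Q by (simp add: P0_def)
      from cover_desc[OF x P0 this, of "l - k"] obtain P where "P \<in> desc (l - k) P0" "(n, h) \<in> rect P"
        by auto
      then show ?thesis using rs_desc_DN[of k l P0] P0 by (auto simp: l_def)
    qed
  qed
  moreover obtain n' where "k \<le> n'" "lo n' < h" "h < hi n'" using eventually_between[OF h] by blast
  ultimately show ?thesis by (metis le_add_diff_inverse)
qed

lemma small_DD:
  assumes x: "good (n, h)" and \<epsilon>: "0 < \<epsilon>"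
  shows "\<exists>j r k Q a. Cyl r k Q a \<in> DD j \<and> (n, h) \<in> rect (Cyl r k Q a) \<and> ln r < \<epsilon> \<and> \<delta> powi k < \<epsilon>"
proof -
  obtain P0 where P0: "P0 \<in> DN 0" "(n, h) \<in> rect P0" using cover_DN[OF x] by blast
  have chain: "\<exists>P\<in>desc i P0. (n, h) \<in> rect P \<and> P \<in> DP i" for i
  proof (induction i)
    case 0
    then show ?case using P0 by auto
  next
    case (Suc i)
    then obtain P where P: "P \<in> desc i P0" "(n, h) \<in> rect P" "P \<in> DP i" by blast
    then have "P \<in> DD (int i)" by simp
    then have "h \<notin> heights P" using x unfolding good_def snd_conv by blast
    moreover obtain r k Q a where "P = Cyl r k Q a" by (cases P)
    ultimately have "\<exists>P'\<in>sons P. (n, h) \<in> rect P'"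
      using sons_cover[of r k Q a n h] x P adm_DP by (auto simp: good_def)
    then show ?case using P by auto
  qed
  obtain r k Q a where P0_eq: "P0 = Cyl r k Q a" by (cases P0)
  have "0 < h" using x by (simp add: good_def)
  from desc_small[OF adm_DN[OF P0(1), unfolded P0_eq] this \<epsilon>] obtain i where
    i: "\<And>r' k' Q' a'. Cyl r' k' Q' a' \<in> desc i P0 \<Longrightarrow> h \<in> {a' / r'<..<a' * r'} \<Longrightarrow>
     ln r' < \<epsilon> \<and> \<delta> powi k' < \<epsilon>"
    unfolding P0_eq by blast
  obtain P where P: "P \<in> desc i P0" "(n, h) \<in> rect P" "P \<in> DP i" using chain by blast
  obtain r' k' Q' a' where P_eq: "P = Cyl r' k' Q' a'" by (cases P)
  have "ln r' < \<epsilon> \<and> \<delta> powi k' < \<epsilon>" using i P unfolding P_eq by simp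
  moreover have "P \<in> DD (int i)" using P(3) by simp
  ultimately show ?thesis using P(2) unfolding P_eq by blast
qed

end

section \<open>Cylinders in the group\<close>

lemma interval_iff_ln:
  fixes h a r :: real
  assumes "0 < h" "0 < a" "0 < r"
  shows "h \<in> {a / r<..<a * r} \<longleftrightarrow> \<bar>ln h - ln a\<bar> < ln r"
proof -
  have "a / r < h \<longleftrightarrow> ln (a / r) < ln h" using assms by simp
  moreover have "h < a * r \<longleftrightarrow> ln h < ln (a * r)" using assms by simp
  ultimately show ?thesis using assms by (auto simp: ln_div ln_mult abs_less_iff)
qed

lemma interval_pos:
  fixes a r :: real
  assumes "0 < a" "0 < r"
  shows "{a / r<..<a * r} \<subseteq> {0<..}"
  using less_trans[OF divide_pos_pos[OF assms]] by auto

lemma nn_integral_inverse_interval: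
  assumes "0 < s" "s \<le> t"
  shows "(\<integral>\<^sup>+h\<in>{s<..<t}. ennreal (1 / h) \<partial>lborel) = ennreal (ln t - ln s)"
proof -
  have "AE h in lborel. h \<noteq> s \<and> h \<noteq> t"
    using AE_lborel_singleton[of s] AE_lborel_singleton[of t] by auto
  then have "(\<integral>\<^sup>+h\<in>{s<..<t}. ennreal (1 / h) \<partial>lborel) = (\<integral>\<^sup>+h\<in>{s..t}. ennreal (1 / h) \<partial>lborel)"
    by (intro nn_integral_cong_AE) (auto simp: indicator_def)
  also have "\<dots> = ennreal (ln t - ln s)"
    using assms by (intro nn_integral_FTC_Icc) (auto intro!: derivative_eq_intros)
  finally show ?thesis .
qed

lemma star_set_iff: "x \<in> star_set d X E r \<longleftrightarrow> x \<in> X \<and> (\<exists>y\<in>E. d x y < ennreal r)"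
  by (auto simp: star_set_def INF_less_iff)

locale cz_setting = carnot_group m V S B
  for m :: "'n::euclidean_space \<Rightarrow> 'n \<Rightarrow> 'n" and V S B +
  fixes \<mu> :: "('n \<times> real) measure" and \<Q> :: "int \<Rightarrow> 'n set set" and \<delta> C1 c gam lam r0 :: real
    and k0 :: int and Q0 :: "'n set"
  assumes flow: "\<mu> \<in> flow_class m V S B"
    and christ: "christ_cubes (dN m B) (mu_N m V S \<mu>) \<Q> \<delta> C1 c"
    and gam5: "5 \<le> gam" and lam3: "exp 3 / \<delta> < lam"
    and large0: "large_admissible \<Q> \<delta> gam lam (Cyl r0 k0 Q0 1)"
begin

abbreviation "ball_N \<equiv> dball dist_N UNIV"
abbreviation "star_G \<equiv> star_set dist_G G_set"
abbreviation "\<nu> \<equiv> mu_N m V S \<mu>"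
text \<open>The same choice as in the definition of \<open>mu_N\<close>, so that \<open>mu_N\<close>
  has the density \<open>\<phi> (n, 1)\<close> by definition.\<close>

definition "\<phi> = (SOME \<phi>. flow_density m V S \<mu> \<phi>)"

lemma flow_density: "flow_density m V S \<mu> \<phi>"
proof -
  obtain \<psi> where "flow_density m V S \<mu> \<psi>"
    using flow unfolding flow_class_def flow_measure_def by blast
  then show ?thesis unfolding \<phi>_def by (rule someI[of "flow_density m V S \<mu>" \<psi>])
qed

lemma nu_eq: "\<nu> = density lborel (\<lambda>n. ennreal (\<phi> (n, 1)))"
  by (simp add: mu_N_def \<phi>_def)

lemma sets_nu [simp]: "sets \<nu> = sets borel" and space_nu [simp]: "space \<nu> = UNIV"
  by (simp_all add: nu_eq)

lemma open_G: "open (G_set :: ('n \<times> real) set)"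
  unfolding G_set_def by (intro open_Times) auto

lemma mu_eq: "\<mu> = density rho (\<lambda>x. ennreal (\<phi> x))" and phi_measurable: "\<phi> \<in> borel_measurable rho"
  and phi_flow: "\<And>x t. x \<in> G_set \<Longrightarrow> \<phi> x = \<phi> (gm x (exp_X0 t))"
  using flow_density unfolding flow_density_def by auto

lemma space_mu [simp]: "space \<mu> = G_set"
  by (subst mu_eq) (simp add: rho_def space_restrict_space)

lemma sets_mu: "A \<in> sets \<mu> \<longleftrightarrow> A \<in> sets borel \<and> A \<subseteq> G_set"
  using open_G by (subst mu_eq) (auto simp: rho_def sets_restrict_space_iff borel_open)

lemma phi_eq: "0 < h \<Longrightarrow> \<phi> (n, h) = \<phi> (n, 1)"
  using phi_flow[of "(n, 1)" "ln h"] by (simp add: gm_X0 G_set_def)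

lemma phi_measurable': "\<phi> \<in> borel_measurable (restrict_space borel G_set)"
proof -
  have "sets (rho :: ('n \<times> real) measure) = sets (restrict_space borel G_set)"
    by (simp add: rho_def cong: sets_restrict_space_cong)
  then show ?thesis using phi_measurable by (simp cong: measurable_cong_sets)
qed

lemma phi1_measurable [measurable]: "(\<lambda>n. \<phi> (n, 1)) \<in> borel_measurable borel"
proof -
  have "(\<lambda>n. (n, 1)) \<in> borel \<rightarrow>\<^sub>M restrict_space borel (G_set :: ('n \<times> real) set)"
    by (intro measurable_restrict_space2 borel_measurable_continuous_onI continuous_intros) (auto simp: G_set_def)
  from measurable_compose[OF this phi_measurable'] show ?thesis .
qed

text \<open>Along flow lines the density \<phi> is constant, so by Tonelli the measure is the
  product of \<open>mu_N\<close> and \<open>dh / h\<close>.\<close>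

lemma emeasure_rectangle:
  assumes [measurable]: "Q \<in> sets borel" "I \<in> sets borel" and I: "I \<subseteq> {0<..}"
  shows "emeasure \<mu> (Q \<times> I) = emeasure \<nu> Q * (\<integral>\<^sup>+h\<in>I. ennreal (1 / h) \<partial>lborel)"
proof -
  have QI: "Q \<times> I \<in> sets \<mu>" using I by (auto simp: sets_mu G_set_def intro: borel_Times)
  then have QI': "Q \<times> I \<in> sets rho" by (subst (asm) mu_eq) simp
  have "emeasure \<mu> (Q \<times> I) = (\<integral>\<^sup>+x. ennreal (\<phi> x) * indicator (Q \<times> I) x \<partial>rho)"
    using QI' phi_measurable by (subst mu_eq) (simp add: emeasure_density)
  also have "\<dots> = (\<integral>\<^sup>+x. ennreal (1 / snd x) * (ennreal (\<phi> x) * indicator (Q \<times> I) x)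
      \<partial>restrict_space lborel G_set)"
    unfolding rho_def
  proof (rule nn_integral_density)
    have "(\<lambda>x. ennreal (\<phi> x) * indicator (Q \<times> I) x) \<in> borel_measurable rho"
      using QI' phi_measurable by measurable
    then show "(\<lambda>x. ennreal (\<phi> x) * indicator (Q \<times> I) x) \<in> borel_measurable (restrict_space lborel G_set)"
      by (simp add: rho_def)
    show "(\<lambda>x. ennreal (1 / snd x)) \<in> borel_measurable (restrict_space lborel (G_set :: ('n \<times> real) set))"
      by (intro measurable_restrict_space1) (simp add: borel_prod[symmetric])
  qed
  also have "\<dots> = (\<integral>\<^sup>+x. ennreal (1 / snd x) * (ennreal (\<phi> x) * indicator (Q \<times> I) x) * indicator G_set x \<partial>lborel)"
    by (rule nn_integral_restrict_space) (simp add: open_G borel_open)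
  also have "\<dots> = (\<integral>\<^sup>+x. (ennreal (\<phi> (fst x, 1)) * indicator Q (fst x)) * (ennreal (1 / snd x) * indicator I (snd x)) \<partial>lborel)"
  proof (rule nn_integral_cong)
    fix x :: "'n \<times> real"
    obtain n h where x: "x = (n, h)" by (cases x)
    show "ennreal (1 / snd x) * (ennreal (\<phi> x) * indicator (Q \<times> I) x) * indicator G_set x
        = (ennreal (\<phi> (fst x, 1)) * indicator Q (fst x)) * (ennreal (1 / snd x) * indicator I (snd x))"
    proof (cases "n \<in> Q \<and> h \<in> I")
      case True
      then have "x \<in> G_set" "0 < h" using I by (auto simp: x G_set_def)
      then show ?thesis using True phi_eq[of h n] by (simp add: x mult.commute)
    qed (auto simp: x)
  qed
  also have "\<dots> = (\<integral>\<^sup>+x. (ennreal (\<phi> (fst x, 1)) * indicator Q (fst x)) * (ennreal (1 / snd x) * indicator I (snd x)) \<partial>(lborel \<Otimes>\<^sub>M lborel))"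
    by (simp add: lborel_prod)
  also have "\<dots> = (\<integral>\<^sup>+n. \<integral>\<^sup>+h. (ennreal (\<phi> (n, 1)) * indicator Q n) * (ennreal (1 / h) * indicator I h) \<partial>lborel \<partial>lborel)"
    by (subst lborel.nn_integral_fst[symmetric]) simp_all
  also have "\<dots> = (\<integral>\<^sup>+n. ennreal (\<phi> (n, 1)) * indicator Q n * (\<integral>\<^sup>+h\<in>I. ennreal (1 / h) \<partial>lborel) \<partial>lborel)"
    by (simp add: nn_integral_cmult)
  also have "\<dots> = (\<integral>\<^sup>+n. ennreal (\<phi> (n, 1)) * indicator Q n \<partial>lborel) * (\<integral>\<^sup>+h\<in>I. ennreal (1 / h) \<partial>lborel)"
    by (simp add: nn_integral_multc)
  also have "(\<integral>\<^sup>+n. ennreal (\<phi> (n, 1)) * indicator Q n \<partial>lborel) = emeasure \<nu> Q"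
    by (simp add: nu_eq emeasure_density)
  finally show ?thesis .
qed

section \<open>Properties of the Christ cubes and cylinders as rectangles\<close>

lemmas christ_parts = christ[unfolded christ_cubes_def]
lemmas christ_tail = christ_parts[THEN conjunct2, THEN conjunct2, THEN conjunct2, THEN conjunct2]

lemma \<delta>01: "0 < \<delta>" "\<delta> < 1" and C1: "3 \<le> C1" and c_pos: "0 < c"
  by (rule christ_parts[THEN conjunct1] christ_parts[THEN conjunct2, THEN conjunct1]
      christ_parts[THEN conjunct2, THEN conjunct2, THEN conjunct1]
      christ_parts[THEN conjunct2, THEN conjunct2, THEN conjunct2, THEN conjunct1])+

lemma countable_cubes': "countable (\<Q> k)" and disjoint_cubes': "disjoint (\<Q> k)"
  and open_cube: "Q \<in> \<Q> k \<Longrightarrow> open Q"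
  using christ_tail[THEN conjunct1, rule_format, of k] by simp_all

lemma null_cubes: "emeasure \<nu> (UNIV - \<Union>(\<Q> k)) = 0"
  using christ_tail[THEN conjunct2, THEN conjunct1] by simp

lemma parent_ex1: "Q \<in> \<Q> k \<Longrightarrow> \<exists>!P. P \<in> \<Q> (k - 1) \<and> Q \<subseteq> P"
  and parent_disj: "Q \<in> \<Q> k \<Longrightarrow> P \<in> \<Q> (k - 1) \<Longrightarrow> P \<noteq> cube_parent \<Q> k Q \<Longrightarrow> Q \<inter> P = {}"
proof -
  note * = christ_tail[THEN conjunct2, THEN conjunct2, THEN conjunct1, THEN spec, THEN bspec, of Q k]
  show "Q \<in> \<Q> k \<Longrightarrow> \<exists>!P. P \<in> \<Q> (k - 1) \<and> Q \<subseteq> P"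
    by (rule conjunct1[OF *])
  show "Q \<in> \<Q> k \<Longrightarrow> P \<in> \<Q> (k - 1) \<Longrightarrow> P \<noteq> cube_parent \<Q> k Q \<Longrightarrow> Q \<inter> P = {}"
    using conjunct2[OF *] by simp
qed

lemma cube_center: "Q \<in> \<Q> k \<Longrightarrow> \<exists>n\<in>Q. ball_N n (c * \<delta> powi k) \<subseteq> Q \<and>
        Q \<subseteq> ball_N n (C1 * \<delta> powi k)"
  by (rule christ_tail[THEN conjunct2, THEN conjunct2, THEN conjunct2, THEN conjunct1, THEN spec, THEN bspec])

lemma parent_measure: "Q \<in> \<Q> k \<Longrightarrow> emeasure \<nu> (cube_parent \<Q> k Q) \<le> ennreal C1 * emeasure \<nu> Q"
  by (rule christ_tail[THEN conjunct2, THEN conjunct2, THEN conjunct2, THEN conjunct2, THEN spec, THEN bspec, THEN conjunct1])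

sublocale cyl_tree \<Q> \<delta> gam lam r0 k0 Q0
proof
  show "cube_parent \<Q> k Q \<in> \<Q> (k - 1)" "Q \<subseteq> cube_parent \<Q> k Q" if "Q \<in> \<Q> k" for Q k
    using theI'[OF parent_ex1[OF that]] unfolding cube_parent_def by auto
  show "P = cube_parent \<Q> k Q" if "Q \<in> \<Q> k" "P \<in> \<Q> (k - 1)" "Q \<inter> P \<noteq> {}" for P Q k
    using parent_disj that by blast
qed (use \<delta>01 gam5 lam3 large0 countable_cubes' disjoint_cubes' in auto)

lemma cyl_set_rect: "adm P \<Longrightarrow> cyl_set m V S P = rect P"
proof (cases P)
  case (Cyl r k Q a)
  assume "adm P"
  then have r: "0 < a" "1 < r" using adm_D Cyl by auto
  have "h \<in> {a / r<..<a * r} \<longleftrightarrow> (\<exists>t. h = exp t \<and> ln (a / r) < t \<and> t < ln (a * r))" for h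
  proof
    assume h: "h \<in> {a / r<..<a * r}"
    then have "0 < h" using r by (meson divide_pos_pos greaterThanLessThan_iff less_trans zero_less_one)
    then show "\<exists>t. h = exp t \<and> ln (a / r) < t \<and> t < ln (a * r)"
      using h r by (intro exI[of _ "ln h"]) simp
  next
    assume "\<exists>t. h = exp t \<and> ln (a / r) < t \<and> t < ln (a * r)"
    then obtain t where t: "h = exp t" "ln (a / r) < t" "t < ln (a * r)" by blast
    have "exp (ln (a / r)) < exp t" "exp t < exp (ln (a * r))"
      using t(2,3) by (simp_all only: exp_less_cancel_iff)
    then show "h \<in> {a / r<..<a * r}" using r t(1) by simp
  qed
  then show ?thesis unfolding Cyl cyl_set.simps gm_X0 rect.simps by auto
qed

lemma rect_subset_G: "adm P \<Longrightarrow> rect P \<subseteq> G_set"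
proof (cases P)
  case (Cyl r k Q a)
  assume "adm P"
  then show ?thesis using Cyl interval_pos[of a r] adm_D[of r k Q a] by (auto simp: G_set_def)
qed

lemma open_rect: "adm P \<Longrightarrow> open (rect P)"
  by (cases P) (auto intro!: open_Times dest!: adm_D(1) open_cube)

lemma sets_rect: "adm P \<Longrightarrow> rect P \<in> sets \<mu>"
  by (simp add: sets_mu rect_subset_G open_rect borel_open)

lemma emeasure_rect:
  assumes "adm (Cyl r k Q a)"
  shows "emeasure \<mu> (rect (Cyl r k Q a)) = emeasure \<nu> Q * ennreal (2 * ln r)"
proof -
  have r: "0 < a" "1 < r" "Q \<in> \<Q> k" using adm_D assms by auto
  have "a / r \<le> a / 1" "a * 1 \<le> a * r"
    using r by (intro divide_left_mono mult_left_mono; simp)+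
  then have "a / r \<le> a * r" by linarith
  moreover have "0 < a / r" using r by simp
  ultimately have "0 < a / r" "a / r \<le> a * r" by simp_all
  then have "(\<integral>\<^sup>+h\<in>{a / r<..<a * r}. ennreal (1 / h) \<partial>lborel) = ennreal (ln (a * r) - ln (a / r))"
    by (rule nn_integral_inverse_interval)
  also have "ln (a * r) - ln (a / r) = 2 * ln r" using r by (simp add: ln_mult ln_div)
  finally show ?thesis using r open_cube[OF r(3)] interval_pos[of a r]
    by (subst rect.simps, subst emeasure_rectangle) (simp_all add: borel_open)
qed

lemma nu_ball: "0 < r \<Longrightarrow> ball_N x r \<in> sets borel"
    "0 < r \<Longrightarrow> 0 < emeasure \<nu> (ball_N x r)"
    "0 < r \<Longrightarrow> emeasure \<nu> (ball_N x r) < \<infinity>"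
  and nu_doubling: "1 < C \<Longrightarrow> \<exists>D>1. \<forall>x. \<forall>r>0.
     emeasure \<nu> (ball_N x (C * r)) \<le> ennreal D * emeasure \<nu> (ball_N x r)"
  using flow unfolding flow_class_def doubling_def by auto

lemma nu_cube: "Q \<in> \<Q> k \<Longrightarrow> 0 < emeasure \<nu> Q" "Q \<in> \<Q> k \<Longrightarrow> emeasure \<nu> Q < \<infinity>"
proof -
  assume Q: "Q \<in> \<Q> k"
  then obtain n where n: "ball_N n (c * \<delta> powi k) \<subseteq> Q" "Q \<subseteq> ball_N n (C1 * \<delta> powi k)"
    using cube_center by blast
  have p: "0 < c * \<delta> powi k" "0 < C1 * \<delta> powi k" using c_pos \<delta>01 C1 by auto
  have "0 < emeasure \<nu> (ball_N n (c * \<delta> powi k))" using nu_ball(2) p by blast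
  also have "\<dots> \<le> emeasure \<nu> Q" using n open_cube[OF Q] by (intro emeasure_mono) (auto simp: borel_open)
  finally show "0 < emeasure \<nu> Q" .
  have "emeasure \<nu> Q \<le> emeasure \<nu> (ball_N n (C1 * \<delta> powi k))"
    using n nu_ball(1)[OF p(2)] by (intro emeasure_mono) auto
  also have "\<dots> < \<infinity>" using nu_ball(3) p by blast
  finally show "emeasure \<nu> Q < \<infinity>" .
qed

section \<open>Topology of the balls of \<open>N\<close> and \<open>G\<close>\<close>

lemma small_power: "0 < \<epsilon> \<Longrightarrow> \<exists>k::int. \<delta> powi k < \<epsilon>"
  using real_arch_pow_inv[of \<epsilon> \<delta>] \<delta>01 by (metis power_int_of_nat)

lemma N_nhd:
  assumes "0 < \<epsilon>"
  obtains U where "open U" "x \<in> U" "U \<subseteq> ball_N x \<epsilon>"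
proof (rule dist_N_ball_nhd[OF _ assms])
  fix \<epsilon> :: real assume \<epsilon>: "0 < \<epsilon>"
  obtain k where k: "\<delta> powi k < \<epsilon> / C1" using small_power[of "\<epsilon> / C1"] \<epsilon> C1 by auto
  \<comment> \<open>Without cubes of generation \<open>k\<close> the whole of \<open>N\<close> would
    be a null set, although balls have positive measure.\<close>
  have "\<Q> k \<noteq> {}"
  proof
    assume "\<Q> k = {}"
    then have "emeasure \<nu> UNIV = 0" using null_cubes[of k] by simp
    moreover have "emeasure \<nu> (ball_N 0 1) \<le> emeasure \<nu> UNIV" by (intro emeasure_mono) auto
    ultimately show False using nu_ball(2)[of 1 0] by simp
  qed
  then obtain Q where Q: "Q \<in> \<Q> k" by blast
  then obtain n where n: "n \<in> Q" "Q \<subseteq> ball_N n (C1 * \<delta> powi k)" using cube_center by blast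
  have "C1 * \<delta> powi k \<le> \<epsilon>" using k C1 by (simp add: field_simps)
  then have "ball_N n (C1 * \<delta> powi k) \<subseteq> ball_N n \<epsilon>"
    by (auto simp: dball_def intro: less_le_trans ennreal_leI)
  then show "\<exists>x U. open U \<and> x \<in> U \<and> U \<subseteq> ball_N x \<epsilon>"
    using n open_cube[OF Q] by blast
qed (use that in blast)

lemma G_nhd:
  assumes x: "x \<in> G_set" and \<epsilon>: "0 < \<epsilon>"
  obtains W where "open W" "x \<in> W" "W \<subseteq> G_set" "\<And>y. y \<in> W \<Longrightarrow> dist_G x y < ennreal \<epsilon>"
proof -
  obtain n h where xn: "x = (n, h)" "0 < h" using x by (auto simp: G_set_def)
  \<comment> \<open>At height \<open>h\<close> a displacement of \<open>h * \<epsilon> / 2\<close>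
    in \<open>N\<close> costs \<open>\<epsilon> / 2\<close>; the other half of \<epsilon> is left
    for the vertical motion.\<close>
  obtain U where U: "open U" "n \<in> U" "U \<subseteq> ball_N n (h * \<epsilon> / 2)"
    using N_nhd[of "h * \<epsilon> / 2" n] xn(2) \<epsilon> by auto
  let ?I = "{h / exp (\<epsilon> / 2)<..<h * exp (\<epsilon> / 2)}"
  have I: "?I \<subseteq> {0<..}" using xn(2) by (intro interval_pos) auto
  have "dist_G x y < ennreal \<epsilon>" if y: "y \<in> U \<times> ?I" for y
  proof -
    obtain n' h' where yn: "y = (n', h')" "n' \<in> U" "h' \<in> ?I" using y by auto
    then have h': "0 < h'" "\<bar>ln h' - ln h\<bar> < \<epsilon> / 2"
      using I interval_iff_ln[of h' h "exp (\<epsilon> / 2)"] xn(2) by auto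
    have d: "dist_N n n' < ennreal (h * \<epsilon> / 2)" using U(3) yn(2) by (auto simp: dball_def)
    have "dist_G (n, h) (n', h') < ennreal (\<bar>ln h - ln h\<bar> + h * \<epsilon> / 2 / h + \<bar>ln h - ln h'\<bar>)"
      using xn(2) h'(1) \<epsilon> by (intro dist_G_via d) auto
    also have "\<dots> \<le> ennreal \<epsilon>" using h'(2) xn(2) by (intro ennreal_leI) (simp add: abs_minus_commute)
    finally show ?thesis by (simp add: xn yn)
  qed
  moreover have "x \<in> U \<times> ?I" using U(2) xn \<epsilon> by (simp add: divide_less_eq)
  moreover have "U \<times> ?I \<subseteq> G_set" using I by (auto simp: G_set_def)
  moreover have "open (U \<times> ?I)" using U(1) by (intro open_Times) auto
  ultimately show ?thesis using that by blast
qed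

lemma dist_G_triangle: "dist_G x z \<le> dist_G x y + dist_G y z"
  unfolding dG_def by (rule cc_dist_triangle)

lemma dist_G_commute: "dist_G x y = dist_G y x"
  unfolding dG_def by (rule cc_dist_commute)

lemma dist_N_triangle: "dist_N x z \<le> dist_N x y + dist_N y z"
  unfolding dN_def by (rule cc_dist_triangle)

lemma dist_N_commute: "dist_N x y = dist_N y x"
  unfolding dN_def by (rule cc_dist_commute)

text \<open>By the triangle inequality and \<open>G_nhd\<close>, stars of arbitrary sets are open;
  this gives the measurability required in \<open>cz_decomposition\<close>.\<close>

lemma open_star: "open (star_G E \<rho>)"
proof (subst open_subopen, intro ballI)
  fix x assume "x \<in> star_G E \<rho>"
  then obtain y where x: "x \<in> G_set" "y \<in> E" "dist_G x y < ennreal \<rho>" by (auto simp: star_set_iff)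
  then obtain s where s: "dist_G x y = ennreal s" "0 \<le> s" "s < \<rho>"
    by (cases "dist_G x y") (auto simp: ennreal_less_iff)
  obtain W where W: "open W" "x \<in> W" "W \<subseteq> G_set" "\<And>y. y \<in> W \<Longrightarrow> dist_G x y < ennreal (\<rho> - s)"
    using G_nhd[OF x(1), of "\<rho> - s"] s by auto
  have "W \<subseteq> star_G E \<rho>"
  proof
    fix z assume z: "z \<in> W"
    have "dist_G z y \<le> dist_G z x + dist_G x y" by (rule dist_G_triangle)
    also have "\<dots> < ennreal (\<rho> - s) + ennreal s"
      using W(4)[OF z] s by (simp add: dist_G_commute[of z x] add.commute[of _ "ennreal s"] ennreal_add_left_cancel_less)
    also have "\<dots> = ennreal \<rho>" using s by (simp flip: ennreal_plus)
    finally show "z \<in> star_G E \<rho>" using W(3) z x(2) by (auto simp: star_set_iff)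
  qed
  then show "\<exists>T. open T \<and> x \<in> T \<and> T \<subseteq> star_G E \<rho>" using W by blast
qed

lemma star_in_sets: "star_G E \<rho> \<in> sets \<mu>"
  using open_star by (auto simp: sets_mu borel_open star_set_def)

lemma dist_N_ball_add:
  assumes "y \<in> ball_N x r" "dist_N y z \<le> ennreal s" "0 < r" "0 \<le> s"
  shows "z \<in> ball_N x (r + s)"
proof -
  have "dist_N x z \<le> dist_N x y + dist_N y z" by (rule dist_N_triangle)
  also have "\<dots> \<le> dist_N x y + ennreal s" using assms(2) by (intro add_left_mono)
  also have "\<dots> < ennreal r + ennreal s"
    using assms by (simp add: dball_def add.commute[of _ "ennreal s"] ennreal_add_left_cancel_less)
  also have "\<dots> = ennreal (r + s)" using assms by simp
  finally show ?thesis by (simp add: dball_def)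
qed

lemma small_rect_in_nhd:
  assumes x: "good x" and W: "open W" "x \<in> W"
  shows "\<exists>j. \<exists>P\<in>DD j. x \<in> rect P \<and> rect P \<subseteq> W"
proof -
  obtain n h where xn: "x = (n, h)" by (cases x)
  have h: "0 < h" using x by (simp add: good_def xn)
  obtain U I where "open U" "open I" "x \<in> U \<times> I" "U \<times> I \<subseteq> W"
    by (rule open_prod_elim[OF W])
  then have UI: "open U" "open I" "n \<in> U" "h \<in> I" "U \<times> I \<subseteq> W" by (simp_all add: xn)
  obtain \<epsilon>1 where \<epsilon>1: "0 < \<epsilon>1" "ball_N n \<epsilon>1 \<subseteq> U"
    using small_dist_N_ball[OF UI(1,3)] .
  have "open (exp -` I)" using UI(2) by (intro open_vimage continuous_intros)
  moreover have "ln h \<in> exp -` I" using UI(4) h by simp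
  ultimately obtain \<epsilon>2 where \<epsilon>2: "0 < \<epsilon>2" "\<And>s. dist s (ln h) < \<epsilon>2 \<Longrightarrow> exp s \<in> I"
    unfolding open_dist by auto
  \<comment> \<open>Two points of a cube are compared through its centre, at distance below
    \<open>2 * C1 * \<delta> powi k\<close>; two logarithmic heights are compared through
    \<open>ln a\<close>, at distance below \<open>2 * ln r\<close>.\<close>
  define \<epsilon> where "\<epsilon> = min (\<epsilon>1 / (2 * C1)) (\<epsilon>2 / 2)"
  have "0 < \<epsilon>" using \<epsilon>1 \<epsilon>2 C1 by (simp add: \<epsilon>_def)
  from small_DD[OF x[unfolded xn] this] obtain j r k Q a where
    P: "Cyl r k Q a \<in> DD j" "(n, h) \<in> rect (Cyl r k Q a)" "ln r < \<epsilon>" "\<delta> powi k < \<epsilon>"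
    by blast
  note A = adm_D[OF adm_DD[OF P(1)]]
  obtain q where q: "Q \<subseteq> ball_N q (C1 * \<delta> powi k)" using cube_center[OF A(1)] by blast
  have pos: "0 < C1 * \<delta> powi k" using C1 \<delta>01 by simp
  have "rect (Cyl r k Q a) \<subseteq> U \<times> I"
  proof
    fix y assume "y \<in> rect (Cyl r k Q a)"
    then obtain n' h' where y: "y = (n', h')" "n' \<in> Q" "h' \<in> {a / r<..<a * r}" by auto
    have "dist_N q n' < ennreal (C1 * \<delta> powi k)" using q y(2) by (auto simp: dball_def)
    moreover have "q \<in> ball_N n (C1 * \<delta> powi k)"
      using q P(2) by (auto simp: dball_def dist_N_commute[of n q])
    ultimately have "n' \<in> ball_N n (C1 * \<delta> powi k + C1 * \<delta> powi k)"
      using pos by (intro dist_N_ball_add) auto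
    moreover have "C1 * \<delta> powi k + C1 * \<delta> powi k \<le> \<epsilon>1"
    proof -
      have "\<delta> powi k < \<epsilon>1 / (2 * C1)" using P(4) by (simp add: \<epsilon>_def)
      then show ?thesis using C1 by (simp add: field_simps)
    qed
    ultimately have "n' \<in> ball_N n \<epsilon>1"
      by (auto simp: dball_def intro: less_le_trans ennreal_leI)
    then have nU: "n' \<in> U" using \<epsilon>1(2) by blast
    have h': "0 < h'" using y(3) A(2,3) interval_pos[of a r] by auto
    have "\<bar>ln h' - ln a\<bar> < ln r" "\<bar>ln h - ln a\<bar> < ln r"
      using interval_iff_ln[of h' a r] interval_iff_ln[of h a r] h h' A(2,3) y(3) P(2)
      by auto
    moreover have "ln r < \<epsilon>2 / 2" using P(3) by (simp add: \<epsilon>_def)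
    ultimately have "dist (ln h') (ln h) < \<epsilon>2" by (simp add: dist_real_def)
    then have "exp (ln h') \<in> I" by (rule \<epsilon>2(2))
    then show "y \<in> U \<times> I" using nU h' y(1) by simp
  qed
  then show ?thesis using P(1,2) UI(5) unfolding xn by blast
qed

text \<open>The exceptional points lie in countably many null sets: gaps between cubes times all
  heights, and horizontal slices, which are null for \<open>dh / h\<close>.\<close>

lemma AE_good: "AE x in \<mu>. good x"
proof -
  have 1: "AE x in \<mu>. \<forall>j. fst x \<in> \<Union>(\<Q> j)"
    unfolding AE_all_countable
  proof
    fix j
    let ?N = "(UNIV - \<Union>(\<Q> j)) \<times> {0<..} :: ('n \<times> real) set"
    have m: "UNIV - \<Union>(\<Q> j) \<in> sets borel"
      using open_cube by (intro borel_closed) (auto intro: open_Union simp flip: Compl_eq_Diff_UNIV)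
    then have "emeasure \<mu> ?N = 0" using null_cubes[of j] by (subst emeasure_rectangle) auto
    moreover have "?N \<in> sets \<mu>" using m by (auto simp: sets_mu G_set_def intro: borel_Times)
    ultimately have "?N \<in> null_sets \<mu>" by (intro null_setsI)
    then show "AE x in \<mu>. fst x \<in> \<Union>(\<Q> j)" by (rule AE_I') (auto simp: G_set_def)
  qed
  have 2: "AE x in \<mu>. \<forall>h\<in>(\<Union>k. \<Union>P\<in>DD k. heights P). snd x \<noteq> h"
    unfolding AE_ball_countable[OF countable_heights]
  proof
    fix h
    let ?N = "UNIV \<times> ({h} \<inter> {0<..}) :: ('n \<times> real) set"
    have "(\<integral>\<^sup>+t\<in>{h} \<inter> {0<..}. ennreal (1 / t) \<partial>lborel) = (\<integral>\<^sup>+t. 0 \<partial>(lborel :: real measure))"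
    proof (rule nn_integral_cong_AE)
      show "AE t in lborel. ennreal (1 / t) * indicator ({h} \<inter> {0<..}) t = 0"
        using AE_lborel_singleton[of h] by eventually_elim simp
    qed
    then have "emeasure \<mu> ?N = 0" by (subst emeasure_rectangle) auto
    moreover have "?N \<in> sets \<mu>" by (auto simp: sets_mu G_set_def intro!: borel_Times)
    ultimately have "?N \<in> null_sets \<mu>" by (intro null_setsI)
    then show "AE x in \<mu>. snd x \<noteq> h" by (rule AE_I') (auto simp: G_set_def)
  qed
  have 3: "AE x in \<mu>. 0 < snd x" by (rule AE_I2) (auto simp: G_set_def)
  from 1 2 3 show ?thesis
    by eventually_elim (auto simp: good_def good_cube_def)
qed

section \<open>The cylinders as a nested basis\<close>

abbreviation "DG k \<equiv> rect ` DD k"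

text \<open>If the cube stays, \<open>3 \<le> C1\<close> absorbs the growth of \<open>ln r\<close>;
  if the radius stays, the ratio is that of a parent cube to its son.\<close>

lemma emeasure_step:
  assumes p: "adm P" "adm P'" "step P P'"
  shows "emeasure \<mu> (rect P') \<le> ennreal C1 * emeasure \<mu> (rect P)"
proof -
  obtain r k Q a r' k' Q' a' where P: "P = Cyl r k Q a" "P' = Cyl r' k' Q' a'"
    and or: "(Q' = Q \<and> ln r' \<le> 3 * ln r) \<or> (r' = r \<and> Q' = cube_parent \<Q> k Q)"
    using p(3) unfolding step_def by blast
  note A = adm_D[OF p(1)[unfolded P]] and A' = adm_D[OF p(2)[unfolded P]]
  have "emeasure \<nu> Q' * ennreal (2 * ln r') \<le> ennreal C1 * (emeasure \<nu> Q * ennreal (2 * ln r))"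
    using or
  proof (elim disjE conjE)
    assume *: "Q' = Q" "ln r' \<le> 3 * ln r"
    have "3 * ln r \<le> C1 * ln r" using C1 A(3) by (intro mult_right_mono) auto
    then have "ennreal (2 * ln r') \<le> ennreal (C1 * (2 * ln r))" using * by (intro ennreal_leI) simp
    then have "emeasure \<nu> Q' * ennreal (2 * ln r') \<le> emeasure \<nu> Q * ennreal (C1 * (2 * ln r))"
      using * by (intro mult_mono) auto
    also have "\<dots> = ennreal C1 * (emeasure \<nu> Q * ennreal (2 * ln r))"
      using C1 A(3) by (simp add: ennreal_mult mult_ac)
    finally show ?thesis .
  next
    assume *: "r' = r" "Q' = cube_parent \<Q> k Q"
    have "emeasure \<nu> Q' * ennreal (2 * ln r') \<le> (ennreal C1 * emeasure \<nu> Q) * ennreal (2 * ln r)"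
      using parent_measure[OF A(1)] * by (intro mult_mono) auto
    then show ?thesis by (simp add: mult.assoc)
  qed
  then show ?thesis using emeasure_rect p(1,2) unfolding P by simp
qed

sublocale nested_basis \<mu> DG C1
proof
  show "1 \<le> C1" using C1 by simp
  show "countable (DG k)" for k using countable_DD by simp
  show "disjoint (DG k)" for k using DD_disjoint[of _ k] unfolding disjoint_def by blast
  fix P k assume "P \<in> DG k"
  then obtain p where p: "P = rect p" "p \<in> DD k" by blast
  have adm: "adm p" using adm_DD[OF p(2)] .
  show "P \<in> sets \<mu>" using sets_rect[OF adm] p(1) by simp
  obtain r j Q a where p_eq: "p = Cyl r j Q a" by (cases p)
  note A = adm_D[OF adm[unfolded p_eq]]
  have em: "emeasure \<mu> P = emeasure \<nu> Q * ennreal (2 * ln r)"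
    using emeasure_rect adm p(1) unfolding p_eq by simp
  show "0 < emeasure \<mu> P" unfolding em using nu_cube(1)[OF A(1)] A(3) by (simp add: ennreal_zero_less_mult_iff)
  show "emeasure \<mu> P < \<infinity>" unfolding em using nu_cube(2)[OF A(1)] by (simp add: ennreal_mult_less_top)
  fix M
  obtain j0 q where q: "q \<in> \<Q> j0" and grow: "\<forall>M. \<exists>j\<le>k. \<exists>r k' Q a. Cyl r k' Q a \<in> DD j \<and>
      rect p \<subseteq> rect (Cyl r k' Q a) \<and> q \<subseteq> Q \<and> M \<le> ln r"
    using growing_DD[OF p(2)] by (elim exE bexE)
  obtain w where w: "emeasure \<nu> q = ennreal w" "0 < w"
    using nu_cube[OF q] by (cases "emeasure \<nu> q") (auto simp: ennreal_zero_less_mult_iff)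
  \<comment> \<open>The cube \<open>q\<close> of measure \<open>w\<close> stays inside
    \<open>Q'\<close>, so the measure is at least \<open>w * (2 * ln r')\<close>; this explains
    \<open>M / (2 * w)\<close>.\<close>
  obtain j' r' k' Q' a' where P': "j' \<le> k" "Cyl r' k' Q' a' \<in> DD j'" "rect p \<subseteq> rect (Cyl r' k' Q' a')"
    "q \<subseteq> Q'" "M / (2 * w) \<le> ln r'"
    using grow[THEN spec, of "M / (2 * w)"] by (elim exE conjE)
  note A' = adm_D[OF adm_DD[OF P'(2)]]
  have "ennreal M \<le> ennreal (w * (2 * ln r'))"
    using P'(5) w(2) by (intro ennreal_leI) (simp add: field_simps)
  also have "\<dots> = emeasure \<nu> q * ennreal (2 * ln r')" using w by (simp add: ennreal_mult')
  also have "\<dots> \<le> emeasure \<nu> Q' * ennreal (2 * ln r')"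
    using P'(4) open_cube[OF A'(1)] by (intro mult_right_mono emeasure_mono) (auto simp: borel_open)
  also have "\<dots> = emeasure \<mu> (rect (Cyl r' k' Q' a'))"
    using emeasure_rect[OF adm_DD[OF P'(2)]] by simp
  finally show "\<exists>j\<le>k. \<exists>P'\<in>DG j. P \<subseteq> P' \<and> ennreal M \<le> emeasure \<mu> P'"
    using P'(1,2,3) p(1) by blast
next
  fix P k assume "P \<in> DG (k + 1)"
  then obtain p where p: "P = rect p" "p \<in> DD (k + 1)" by blast
  from step_DD[OF p(2)] obtain p' where p': "p' \<in> DD k" "step p p'" by blast
  then show "\<exists>P'\<in>DG k. P \<subseteq> P' \<and> emeasure \<mu> P' \<le> ennreal C1 * emeasure \<mu> P"
    using emeasure_step[OF adm_DD[OF p(2)] adm_DD[OF p'(1)] p'(2)] p(1)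
    by (intro bexI[of _ "rect p'"]) (auto simp: step_def)
next
  have "DD 0 = DN 0" by (simp add: DD_def)
  then have "x \<in> \<Union>(DG 0)" if "good x" for x using cover_DN[of "fst x" "snd x" 0] that by auto
  note * = this
  show "AE x in \<mu>. x \<in> \<Union>(DG 0)" using AE_good by eventually_elim (rule *)
next
  fix P0 A and \<epsilon> :: real
  assume P0: "P0 \<in> DG 0" and A: "A \<in> sets \<mu>" "A \<subseteq> P0" and \<epsilon>: "0 < \<epsilon>"
  obtain p where p: "P0 = rect p" "p \<in> DD 0" using P0 by blast
  note adm = adm_DD[OF p(2)]
  have P0s: "P0 \<in> sets \<mu>" "open P0" using sets_rect[OF adm] open_rect[OF adm] p(1) by auto
  \<comment> \<open>Outer regularity is applied to a finite Borel measure on the whole space, so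
    \<mu> is restricted to \<open>P0\<close> and transported to the Borel sets.\<close>
  define \<eta> where "\<eta> = distr (restrict_space \<mu> P0) borel (\<lambda>x. x)"
  have \<eta>: "emeasure \<eta> E = emeasure \<mu> (E \<inter> P0)" if "E \<in> sets borel" for E
  proof -
    have "(\<lambda>x. x) \<in> restrict_space \<mu> P0 \<rightarrow>\<^sub>M borel"
      using open_G by (intro measurable_restrict_space1 measurableI)
        (auto simp: sets_mu intro!: sets.Int borel_open)
    then have "emeasure \<eta> E = emeasure (restrict_space \<mu> P0) ((\<lambda>x. x) -` E \<inter> space (restrict_space \<mu> P0))"
      unfolding \<eta>_def using that by (rule emeasure_distr)
    also have "(\<lambda>x. x) -` E \<inter> space (restrict_space \<mu> P0) = E \<inter> P0"
      using P0s sets.sets_into_space[OF P0s(1)] by (auto simp: space_restrict_space)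
    also have "emeasure (restrict_space \<mu> P0) (E \<inter> P0) = emeasure \<mu> (E \<inter> P0)"
      using sets.Int_space_eq2[OF P0s(1)] P0s(1) by (intro emeasure_restrict_space) simp_all
    finally show ?thesis .
  qed
  have finP: "emeasure \<mu> P0 < \<infinity>"
  proof -
    obtain r j Q a where p_eq: "p = Cyl r j Q a" by (cases p)
    show ?thesis using emeasure_rect[OF adm[unfolded p_eq]] nu_cube(2)[OF adm_D(1)[OF adm[unfolded p_eq]]]
      unfolding p(1) p_eq by (simp add: ennreal_mult_less_top)
  qed
  have "emeasure \<eta> (space \<eta>) \<noteq> \<infinity>" using \<eta>[of UNIV] finP by (simp add: \<eta>_def)
  moreover have Ab: "A \<in> sets borel" using A by (simp add: sets_mu)
  ultimately have reg: "emeasure \<eta> A = (INF U \<in> {U. A \<subseteq> U \<and> open U}. emeasure \<eta> U)"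
    by (intro outer_regular) (auto simp: \<eta>_def)
  have \<eta>A: "emeasure \<eta> A = emeasure \<mu> A" using \<eta>[OF Ab] A(2) by (simp add: Int_absorb2)
  have "emeasure \<mu> A < emeasure \<mu> A + ennreal \<epsilon>"
  proof -
    have "emeasure \<mu> A < \<infinity>" using emeasure_mono[OF A(2) P0s(1)] finP by (rule le_less_trans)
    then show ?thesis using \<epsilon> by (cases "emeasure \<mu> A") (auto simp: ennreal_less_iff simp flip: ennreal_plus)
  qed
  then obtain U where U: "A \<subseteq> U" "open U" "emeasure \<eta> U < emeasure \<mu> A + ennreal \<epsilon>"
    using reg unfolding \<eta>A by (auto simp: INF_less_iff)
  have "U \<inter> P0 \<in> sets \<mu>" using U(2) P0s by (simp add: sets_mu borel_open open_Int le_infI2)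
  moreover have "A \<subseteq> U \<inter> P0" using U(1) A(2) by blast
  moreover have "emeasure \<mu> (U \<inter> P0) \<le> emeasure \<mu> A + ennreal \<epsilon>"
    using U(3) \<eta>[of U] U(2) by (simp add: borel_open)
  moreover have "AE x in \<mu>. x \<in> A \<longrightarrow> (\<exists>k. \<exists>P\<in>DG k. x \<in> P \<and> P \<subseteq> U \<inter> P0)"
    using AE_good
  proof eventually_elim
    case (elim x)
    show ?case
    proof
      assume "x \<in> A"
      then have "x \<in> U \<inter> P0" using U(1) A(2) by blast
      then show "\<exists>k. \<exists>P\<in>DG k. x \<in> P \<and> P \<subseteq> U \<inter> P0"
        using small_rect_in_nhd[OF elim, of "U \<inter> P0"] U(2) P0s(2) by (auto simp: open_Int)
    qed
  qed
  ultimately show "\<exists>U\<in>sets \<mu>. A \<subseteq> U \<and> emeasure \<mu> U \<le> emeasure \<mu> A + ennreal \<epsilon> \<and>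
        (AE x in \<mu>. x \<in> A \<longrightarrow> (\<exists>k. \<exists>P\<in>DG k. x \<in> P \<and> P \<subseteq> U))" by blast
qed

text \<open>The leading \<open>2\<close> undoes the halving in \<open>ln r / 2\<close>. Ascending
  and descending cost \<open>2 * gam * ln r\<close>, the position within the cylinder costs less
  than another \<open>ln r\<close>, and the horizontal path costs at most
  \<open>C1 * lam * exp 2 * ln r\<close>.\<close>

lemma rect_subset_ball:
  assumes P: "adm (Cyl r k Q a)" and q: "Q \<subseteq> ball_N q (C1 * \<delta> powi k)"
  shows "rect (Cyl r k Q a) \<subseteq> dball dist_G G_set (q, a) (2 * (2 * gam + 2 + C1 * lam * exp 2) * (ln r / 2))"
proof
  note A = adm_D[OF P]
  define \<rho> where "\<rho> = C1 * \<delta> powi k"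
  have \<rho>: "0 < \<rho>" using C1 \<delta>01 by (simp add: \<rho>_def)
  have t: "0 < ln r" using A(3) by simp
  fix y assume y: "y \<in> rect (Cyl r k Q a)"
  then obtain n h where yn: "y = (n, h)" "n \<in> Q" "h \<in> {a / r<..<a * r}" by auto
  have h: "0 < h" using yn(3) interval_pos[of a r] A(2,3) by auto
  have lnh: "\<bar>ln h - ln a\<bar> < ln r" using interval_iff_ln[of h a r] h A(2,3) yn(3) by auto
  have d: "dist_N q n < ennreal \<rho>" using q yn(2) by (auto simp: dball_def \<rho>_def)
  have gt: "0 \<le> gam * ln r" using gam5 t by simp
  \<comment> \<open>A small cylinder has a cube of size comparable to \<open>a * ln r\<close>, so
    one moves at height \<open>a\<close>. A large one is crossed at height
    \<open>a * r powr gam\<close>, where its cube has bounded size.\<close>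
  have "\<exists>H>0. \<bar>ln a - ln H\<bar> + \<rho> / H + \<bar>ln H - ln h\<bar> \<le> (2 * gam + 2 + C1 * lam * exp 2) * ln r"
  proof (cases "r \<le> exp 1")
    case True
    have "\<rho> \<le> C1 * (lam * a * exp 2 * ln r)"
      unfolding \<rho>_def using A(5)[OF True] C1 by (intro mult_left_mono) auto
    then have "\<rho> / a \<le> C1 * lam * exp 2 * ln r" using A(2) by (simp add: divide_le_eq mult_ac)
    then show ?thesis using lnh A(2) gt t by (intro exI[of _ a]) (simp add: algebra_simps)
  next
    case False
    then have "lg r (\<delta> powi k) a" using P by (simp add: adm_Cyl sm_def)
    then have up: "\<delta> powi k \<le> lam * a * r powr gam" by (simp add: lg_def)
    define H where "H = a * r powr gam"
    have H: "0 < H" "ln H = ln a + gam * ln r" using A(2,3) by (simp_all add: H_def ln_mult ln_powr)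
    have "\<rho> \<le> C1 * (lam * H)"
      unfolding \<rho>_def H_def using up C1 by (intro mult_left_mono) (auto simp: mult.assoc)
    then have "\<rho> / H \<le> C1 * lam" using H(1) by (simp add: divide_le_eq mult_ac)
    also have "\<dots> \<le> C1 * lam * (exp 2 * ln r)"
    proof -
      have "ln (exp 1) \<le> ln r" using False A(3) by (subst ln_le_cancel_iff) auto
      then have "1 * 1 \<le> exp 2 * ln r" by (intro mult_mono) auto
      then have "C1 * lam * 1 \<le> C1 * lam * (exp 2 * ln r)"
        using C1 lam_pos by (intro mult_left_mono) auto
      then show ?thesis by simp
    qed
    finally have "\<rho> / H \<le> C1 * lam * exp 2 * ln r" by (simp add: mult.assoc)
    then show ?thesis using lnh H gt t by (intro exI[of _ H]) (simp add: algebra_simps)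
  qed
  then obtain H where H: "0 < H"
    "\<bar>ln a - ln H\<bar> + \<rho> / H + \<bar>ln H - ln h\<bar> \<le> (2 * gam + 2 + C1 * lam * exp 2) * ln r" by blast
  have "dist_G (q, a) (n, h) < ennreal (\<bar>ln a - ln H\<bar> + \<rho> / H + \<bar>ln H - ln h\<bar>)"
    using A(2) H(1) h \<rho> d by (intro dist_G_via)
  also have "\<dots> \<le> ennreal ((2 * gam + 2 + C1 * lam * exp 2) * ln r)"
    by (rule ennreal_leI[OF H(2)])
  also have "(2 * gam + 2 + C1 * lam * exp 2) * ln r = 2 * (2 * gam + 2 + C1 * lam * exp 2) * (ln r / 2)"
    by simp
  finally show "y \<in> dball dist_G G_set (q, a) (2 * (2 * gam + 2 + C1 * lam * exp 2) * (ln r / 2))"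
    using rect_subset_G[OF P] y by (auto simp: dball_def yn(1))
qed

text \<open>From a height below \<open>a * r\<close>, a path of length \<open>ln r / 2\<close> stays
  below \<open>a * r powr (3 / 2)\<close> and moves in \<open>N\<close> by at most this height times
  \<open>ln r / 2\<close>. The lower bounds of admissibility make that at most
  \<open>\<delta> powi k\<close>; this is \<open>key\<close>.\<close>

lemma star_subset:
  assumes P: "adm (Cyl r k Q a)" and q: "Q \<subseteq> ball_N q (C1 * \<delta> powi k)"
  shows "star_G (rect (Cyl r k Q a)) (ln r / 2)
    \<subseteq> ball_N q ((C1 + 1) * \<delta> powi k) \<times> {a / exp (3 / 2 * ln r)<..<a * exp (3 / 2 * ln r)}"
proof
  note A = adm_D[OF P]
  define t where "t = ln r"
  have t: "0 < t" "r = exp t" using A(3) by (simp_all add: t_def)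
  have D0: "0 < \<delta> powi k" using \<delta>01 by simp
  have key: "a * exp (3 / 2 * t) * (t / 2) \<le> \<delta> powi k"
    using P unfolding adm_Cyl
  proof (elim conjE disjE)
    assume "lg r (\<delta> powi k) a"
    then have lo: "a * r\<^sup>2 \<le> \<delta> powi k" by (simp add: lg_def)
    have r2: "r\<^sup>2 = exp (3 / 2 * t) * exp (t / 2)" unfolding t(2) by (simp flip: exp_double exp_add)
    have "t / 2 \<le> exp (t / 2)" using exp_ge_add_one_self[of "t / 2"] by linarith
    then have "a * exp (3 / 2 * t) * (t / 2) \<le> a * exp (3 / 2 * t) * exp (t / 2)"
      using A(2) by (intro mult_left_mono) auto
    also have "\<dots> = a * r\<^sup>2" by (simp add: r2)
    finally show ?thesis using lo by simp
  next
    assume "sm r (\<delta> powi k) a"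
    then have lo: "a * exp 2 * t \<le> \<delta> powi k" and "t \<le> 1" using t by (simp_all add: sm_def)
    then have "exp (3 / 2 * t) \<le> exp 2" by simp
    then have "a * exp (3 / 2 * t) * (t / 2) \<le> a * exp 2 * t"
      using A(2) t(1) by (intro mult_mono) auto
    then show ?thesis using lo by simp
  qed
  fix x assume "x \<in> star_G (rect (Cyl r k Q a)) (ln r / 2)"
  then obtain y where y: "x \<in> G_set" "y \<in> rect (Cyl r k Q a)" "dist_G x y < ennreal (t / 2)"
    unfolding star_set_iff t_def by blast
  obtain n' h' where xn: "x = (n', h')" "0 < h'" using y(1) by (auto simp: G_set_def)
  obtain n h where yn: "y = (n, h)" "n \<in> Q" "h \<in> {a / r<..<a * r}" using y(2) by auto
  have h: "0 < h" using yn(3) interval_pos[of a r] A(2,3) by auto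
  have lnh: "\<bar>ln h - ln a\<bar> < t"
    using interval_iff_ln[of h a r] h A(2,3) yn(3) by (auto simp: t_def)
  have "dist_G (n, h) (n', h') < ennreal (t / 2)" using y(3) by (simp add: xn yn dist_G_commute)
  from dist_G_lessD[OF h _ this] t(1)
  have l: "\<bar>ln h - ln h'\<bar> < t / 2" and dN: "dist_N n n' < ennreal (h * exp (t / 2) * (t / 2))" by auto
  have "h * exp (t / 2) * (t / 2) \<le> a * exp t * exp (t / 2) * (t / 2)"
    using yn(3) t by (intro mult_right_mono) auto
  also have "\<dots> = a * exp (3 / 2 * t) * (t / 2)" by (simp add: mult.assoc flip: exp_add)
  also have "\<dots> \<le> \<delta> powi k" by (rule key)
  finally have "ennreal (h * exp (t / 2) * (t / 2)) \<le> ennreal (\<delta> powi k)" by (rule ennreal_leI)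
  with dN have "dist_N n n' \<le> ennreal (\<delta> powi k)" by (meson less_imp_le order_trans)
  then have "n' \<in> ball_N q (C1 * \<delta> powi k + \<delta> powi k)"
    using q yn(2) D0 C1 by (intro dist_N_ball_add[of n]) auto
  moreover have "\<bar>ln h' - ln a\<bar> < 3 / 2 * t" using l lnh by linarith
  then have "h' \<in> {a / exp (3 / 2 * t)<..<a * exp (3 / 2 * t)}"
    using interval_iff_ln[of h' a "exp (3 / 2 * t)"] xn(2) A(2) by simp
  ultimately show "x \<in> ball_N q ((C1 + 1) * \<delta> powi k) \<times> {a / exp (3 / 2 * ln r)<..<a * exp (3 / 2 * ln r)}"
    by (simp add: xn t_def distrib_right)
qed

lemma star_measure:
  "\<exists>D\<ge>0. \<forall>r k Q a. adm (Cyl r k Q a) \<longrightarrow>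
     emeasure \<mu> (star_G (rect (Cyl r k Q a)) (ln r / 2)) \<le> ennreal D * emeasure \<mu> (rect (Cyl r k Q a))"
proof -
  \<comment> \<open>Enlarged by \<open>f\<close>, the inner ball of radius
    \<open>c * \<delta> powi k\<close> contains the ball of radius
    \<open>(C1 + 1) * \<delta> powi k\<close>; the summand \<open>2\<close> ensures
    \<open>1 < f\<close>. The factor \<open>3 / 2\<close> in the final constant is the ratio of
    logarithmic heights.\<close>
  define f where "f = (C1 + 1) / c + 2"
  have f: "1 < f" using C1 c_pos by (simp add: f_def add_pos_pos)
  obtain D where D: "1 < D" "\<And>x r. 0 < r \<Longrightarrow>
     emeasure \<nu> (ball_N x (f * r)) \<le> ennreal D * emeasure \<nu> (ball_N x r)"
    using nu_doubling[OF f] by blast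
  have "emeasure \<mu> (star_G (rect (Cyl r k Q a)) (ln r / 2))
      \<le> ennreal (3 / 2 * D) * emeasure \<mu> (rect (Cyl r k Q a))" if P: "adm (Cyl r k Q a)" for r k Q a
  proof -
    note A = adm_D[OF P]
    have D0: "0 < \<delta> powi k" using \<delta>01 by simp
    obtain q where q: "ball_N q (c * \<delta> powi k) \<subseteq> Q" "Q \<subseteq> ball_N q (C1 * \<delta> powi k)"
      using cube_center[OF A(1)] by blast
    let ?B = "ball_N q ((C1 + 1) * \<delta> powi k)"
    let ?I = "{a / exp (3 / 2 * ln r)<..<a * exp (3 / 2 * ln r)}"
    have B: "?B \<in> sets borel" using C1 D0 by (intro nu_ball) simp
    have I: "?I \<subseteq> {0<..}" using A(2) by (intro interval_pos) auto
    have le: "a / exp (3 / 2 * ln r) \<le> a * exp (3 / 2 * ln r)"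
    proof -
      have "1 \<le> exp (3 / 2 * ln r)" using A(3) by simp
      then have "a / exp (3 / 2 * ln r) \<le> a / 1" "a * 1 \<le> a * exp (3 / 2 * ln r)"
        using A(2) by (intro divide_left_mono mult_left_mono; simp)+
      then show ?thesis by linarith
    qed
    have BQ: "emeasure \<nu> ?B \<le> ennreal D * emeasure \<nu> Q"
    proof -
      have "(C1 + 1) * \<delta> powi k \<le> f * (c * \<delta> powi k)"
      proof -
        have "f * (c * \<delta> powi k) = (C1 + 1) * \<delta> powi k + 2 * (c * \<delta> powi k)"
          using c_pos by (simp add: f_def field_simps)
        then show ?thesis using c_pos D0 by simp
      qed
      then have "?B \<subseteq> ball_N q (f * (c * \<delta> powi k))"
        by (auto simp: dball_def intro: less_le_trans ennreal_leI)
      then have "emeasure \<nu> ?B \<le> emeasure \<nu> (ball_N q (f * (c * \<delta> powi k)))"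
        using f c_pos D0 by (intro emeasure_mono) (auto intro!: nu_ball(1))
      also have "\<dots> \<le> ennreal D * emeasure \<nu> (ball_N q (c * \<delta> powi k))"
        using c_pos D0 by (intro D(2)) simp
      also have "\<dots> \<le> ennreal D * emeasure \<nu> Q"
        using q(1) open_cube[OF A(1)] by (intro mult_left_mono emeasure_mono) (auto simp: borel_open)
      finally show ?thesis .
    qed
    have BI: "?B \<times> ?I \<in> sets \<mu>" using B I by (auto simp: sets_mu G_set_def intro: borel_Times)
    have "emeasure \<mu> (star_G (rect (Cyl r k Q a)) (ln r / 2)) \<le> emeasure \<mu> (?B \<times> ?I)"
      using star_subset[OF P q(2)] BI by (intro emeasure_mono)
    also have "\<dots> = emeasure \<nu> ?B * (\<integral>\<^sup>+h\<in>?I. ennreal (1 / h) \<partial>lborel)"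
      using B I by (intro emeasure_rectangle) auto
    also have "(\<integral>\<^sup>+h\<in>?I. ennreal (1 / h) \<partial>lborel) = ennreal (ln (a * exp (3 / 2 * ln r)) - ln (a / exp (3 / 2 * ln r)))"
      using A(2) le by (intro nn_integral_inverse_interval) auto
    also have "ln (a * exp (3 / 2 * ln r)) - ln (a / exp (3 / 2 * ln r)) = 3 / 2 * (2 * ln r)"
      using A(2) by (simp add: ln_mult ln_div)
    also have "emeasure \<nu> ?B * ennreal (3 / 2 * (2 * ln r)) \<le> (ennreal D * emeasure \<nu> Q) * ennreal (3 / 2 * (2 * ln r))"
      by (intro mult_right_mono BQ) simp
    also have "\<dots> = ennreal (3 / 2 * D) * (emeasure \<nu> Q * ennreal (2 * ln r))"
    proof -
      have "ennreal D * ennreal (3 / 2 * (2 * ln r)) = ennreal (3 / 2 * D) * ennreal (2 * ln r)"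
        using D(1) A(3) by (simp flip: ennreal_mult)
      then show ?thesis by (metis mult.assoc mult.commute)
    qed
    also have "\<dots> = ennreal (3 / 2 * D) * emeasure \<mu> (rect (Cyl r k Q a))"
      by (simp only: emeasure_rect[OF P])
    finally show ?thesis .
  qed
  then show ?thesis using D(1) by (intro exI[of _ "3 / 2 * D"]) auto
qed

lemma CZP: "CZP_wrt dist_G \<mu> (cyl_set m V S ` DZ \<Q> \<delta> gam lam (Cyl r0 k0 Q0 1))"
proof -
  obtain D where D: "0 \<le> D" "\<And>r k Q a. adm (Cyl r k Q a) \<Longrightarrow>
     emeasure \<mu> (star_G (rect (Cyl r k Q a)) (ln r / 2)) \<le> ennreal D * emeasure \<mu> (rect (Cyl r k Q a))"
    using star_measure by blast
  have "CZP_wrt dist_G \<mu> (\<Union>k. DG k)"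
  proof (rule CZP_wrt_nested_basis[OF _ D(1)])
    show "0 \<le> 2 * (2 * gam + 2 + C1 * lam * exp 2)" using gam5 C1 lam_pos by simp
    have "Cyl (R 0) (K 0) (QQ 0) (A 0) \<in> DD (- int 0)"
      unfolding DD_neg using sl_DN[of 0] QQ[of 0] by (auto simp: slab_eq)
    then show "DG (- int 0) \<noteq> {}" by blast
  next
    fix P j assume "P \<in> DG j"
    then obtain p where p: "P = rect p" "p \<in> DD j" by blast
    obtain r k Q a where p_eq: "p = Cyl r k Q a" by (cases p)
    note adm = adm_DD[OF p(2), unfolded p_eq]
    obtain q where q: "Q \<subseteq> ball_N q (C1 * \<delta> powi k)"
      using cube_center[OF adm_D(1)[OF adm]] by blast
    show "\<exists>r>0. \<exists>x\<in>space \<mu>. P \<subseteq> dball dist_G (space \<mu>) x (2 * (2 * gam + 2 + C1 * lam * exp 2) * r) \<and>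
        star_set dist_G (space \<mu>) P r \<in> sets \<mu> \<and>
        emeasure \<mu> (star_set dist_G (space \<mu>) P r) \<le> ennreal D * emeasure \<mu> P"
      unfolding p(1) p_eq space_mu
    proof (intro exI[of _ "ln r / 2"] bexI[of _ "(q, a)"] conjI star_in_sets)
      show "0 < ln r / 2" using adm_D(3)[OF adm] by simp
      show "(q, a) \<in> G_set" using adm_D(2)[OF adm] by (simp add: G_set_def)
      show "rect (Cyl r k Q a) \<subseteq> dball dist_G G_set (q, a) (2 * (2 * gam + 2 + C1 * lam * exp 2) * (ln r / 2))"
        by (rule rect_subset_ball[OF adm q])
      show "emeasure \<mu> (star_G (rect (Cyl r k Q a)) (ln r / 2)) \<le> ennreal D * emeasure \<mu> (rect (Cyl r k Q a))"
        by (rule D(2)[OF adm])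
    qed
  qed
  moreover have "cyl_set m V S ` DZ \<Q> \<delta> gam lam (Cyl r0 k0 Q0 1) = (\<Union>k. DG k)"
  proof -
    have "cyl_set m V S P = rect P" if "P \<in> (\<Union>k. DD k)" for P
      using that adm_DD cyl_set_rect by blast
    then have "cyl_set m V S ` (\<Union>k. DD k) = rect ` (\<Union>k. DD k)" by (intro image_cong) auto
    then show ?thesis unfolding DZ_eq by (simp add: image_UN)
  qed
  ultimately show ?thesis by simp
qed

end

theorem theorem6p1:
  fixes m :: "'n::euclidean_space \<Rightarrow> 'n \<Rightarrow> 'n"
    and V :: "nat \<Rightarrow> 'n set" and S :: nat and B :: "'n set"
    and \<mu> :: "('n \<times> real) measure"
    and \<Q> :: "int \<Rightarrow> 'n set set" and \<delta> C1 c gam lam r0 :: real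
    and k0 :: int and Q0 :: "'n set"
  assumes "stratified_group m V S"
    and "independent B" and "span B = V 1"
    and "\<mu> \<in> flow_class m V S B"
    and "christ_cubes (dN m B) (mu_N m V S \<mu>) \<Q> \<delta> C1 c"
    and "5 \<le> gam" and "exp 3 / \<delta> < lam"
    and "large_admissible \<Q> \<delta> gam lam (Cyl r0 k0 Q0 1)"
  shows "CZP_wrt (dG m V S B) \<mu> (cyl_set m V S ` DZ \<Q> \<delta> gam lam (Cyl r0 k0 Q0 1))"
proof -
  interpret cz_setting m V S B \<mu> \<Q> \<delta> C1 c gam lam r0 k0 Q0
    by unfold_locales (fact assms)+
  show ?thesis by (rule CZP)
qed

end
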